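(* There are the following isomorphisms of graded $\mathbb{F}_p$-algebras, where the right-hand sides are polynomial algebras and the subscript of each generator $x$ indicates its cohomological degree: (1) for $p=5$, $G=E_8$, $A=E_{E_8}^3$: $(\Gamma H^*BA)^{W(A)}=\mathbb{F}_5[x_{62},x_{200},x_{240}]$; (2) for $p=3$, $G=F_4$, $A=E_{F_4}^3$: $(\Gamma H^*BA)^{W(A)}=\mathbb{F}_3[x_{26},x_{36},x_{48}]$; (3) for $p=3$, $G=E_6$, $A=E_{3E_6}^4$: $(\Gamma H^*BA)^{W(A)}=\mathbb{F}_3[x_{26},x_{36},x_{48},x_{54}]$; (4) for $p=3$, $G=E_7$, $A=E_{2E_7}^4$: $(\Gamma H^*BA)^{W(A)}=\mathbb{F}_3[x_{26},x_{36},x_{48},x_{108}]$; (5) for $p=3$, $G=E_8$, $A=E_{E_8}^{5a}$: $(\Gamma H^*BA)^{W(A)}=\mathbb{F}_3[x_4,x_{26},x_{36},x_{48},x_{324}]$.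
   Context: Cohomology is taken with coefficients in $\mathbb{F}_p$, $p$ an odd prime. $G$ is the simply connected compact simple Lie group of the indicated type, and $A\subset G$ is an elementary abelian $p$-subgroup of rank $n$. Put $\Gamma H^*BA=H^*BA/\sqrt{0}$, where $\sqrt{0}$ is the ideal of nilpotent elements; it is a polynomial algebra $\mathbb{F}_p[t_1,\dots,t_n]$ with each $t_i$ of cohomological degree $2$. The Weyl group $W(A)=N_G(A)/C_G(A)$ acts on $A$ by conjugation, and hence on $\Gamma H^*BA$ by $gx=B(g^{-1})^*x$. Choosing a basis $v_1,\dots,v_n$ of $A$ (written additively as an $\mathbb{F}_p$-vector space) one regards $W(A)$ as a subgroup of $GL_n(\mathbb{F}_p)$ acting by $gv_i=\sum_j a_{j,i}(g)v_j$, where $a_{i,j}(g)$ is the $(i,j)$-entry of $g$; equivalently, with $t_1,\dots,t_n$ corresponding to the dual basis, $gt_i=\sum_j a_{i,j}(g^{-1})t_j$. The groups $A$ are maximal nontoral elementary abelian $p$-subgroups (nontoral means not contained in a torus of $G$). In the cases $(p,G)=(5,E_8)$, $(3,F_4)$, $(3,E_6)$, $(3,E_7)$ there is exactly one up to conjugacy, denoted $E_{E_8}^3$, $E_{F_4}^3$, $E_{3E_6}^4$, $E_{2E_7}^4$ respectively; for $(3,E_8)$ there are exactly two up to conjugacy, denoted $E_{E_8}^{5a}$ and $E_{E_8}^{5b}$. The superscript number is the rank. By the known description due to Andersen, Grodal, Møller and Viruel, the Weyl groups, for suitable bases, are: - $W(E_{E_8}^3)=SL_3(\mathbb{F}_5)$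 for $p=5$; - $W(E_{F_4}^3)=SL_3(\mathbb{F}_3)$; - $W(E_{3E_6}^4)\subset GL_4(\mathbb{F}_3)$ is the group of all matrices $\begin{pmatrix}1&m_0\\0&g_2\end{pmatrix}$ with $g_2\in SL_3(\mathbb{F}_3)$ and $m_0$ an arbitrary $1\times 3$ matrix; - $W(E_{2E_7}^4)\subset GL_4(\mathbb{F}_3)$ is the group of all matrices $\begin{pmatrix}g_1&m_0\\0&g_2\end{pmatrix}$ with $g_1\in GL_1(\mathbb{F}_3)$, $g_2\in SL_3(\mathbb{F}_3)$ and $m_0$ an arbitrary $1\times 3$ matrix; - $W(E_{E_8}^{5a})\subset GL_5(\mathbb{F}_3)$ is the group of all matrices $\begin{pmatrix}g_1&m_0'&m_0''\\0&g_2'&0\\0&0&\epsilon\end{pmatrix}$ with $g_1,\epsilon\in GL_1(\mathbb{F}_3)$, $g_2'\in SL_3(\mathbb{F}_3)$, and $m_0'$, $m_0''$ arbitrary $1\times 3$ and $1\times 1$ matrices. *)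

theory Defs
  imports
    "HOL-Algebra.Group_Action"
    "HOL-Library.Poly_Mapping"
    "Jordan_Normal_Form.Determinant"
    "Berlekamp_Zassenhaus.Finite_Field"
begin

section \<open>Elementary abelian subgroups and their Weyl groups\<close>

text \<open>
  The field with $p$ elements is the type \<open>'p mod_ring\<close> with \<open>CARD('p) = p\<close>.
  Subgroups are written multiplicatively, so the vector with coordinates $x$ with respect to
  $v_1,\dots,v_n$ is the product of the powers $v_i^{x_i}$.  All indices start at 0.
\<close>

definition elementary_abelian :: "nat \<Rightarrow> ('g, 'm) monoid_scheme \<Rightarrow> 'g set \<Rightarrow> bool" where
  "elementary_abelian p G A \<longleftrightarrow>
     subgroup A G \<and> comm_group (G\<lparr>carrier := A\<rparr>) \<and> (\<forall>a\<in>A. a [^]\<^bsub>G\<^esub> p = \<one>\<^bsub>G\<^esub>)"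

definition lin_comb ::
  "('g, 'm) monoid_scheme \<Rightarrow> 'g set \<Rightarrow> 'g list \<Rightarrow> 'p::prime_card mod_ring vec \<Rightarrow> 'g" where
  "lin_comb G A v x =
     (\<Otimes>\<^bsub>G\<lparr>carrier := A\<rparr>\<^esub>i\<in>{..<length v}. (v ! i) [^]\<^bsub>G\<^esub> to_int_mod_ring (x $ i))"

definition Fp_basis ::
  "'p::prime_card itself \<Rightarrow> ('g, 'm) monoid_scheme \<Rightarrow> 'g set \<Rightarrow> 'g list \<Rightarrow> bool" where
  "Fp_basis _ G A v \<longleftrightarrow> set v \<subseteq> A \<and>
     bij_betw (lin_comb G A v) (carrier_vec (length v) :: 'p mod_ring vec set) A"

definition coords ::
  "('g, 'm) monoid_scheme \<Rightarrow> 'g set \<Rightarrow> 'g list \<Rightarrow> 'g \<Rightarrow> 'p::prime_card mod_ring vec" where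
  "coords G A v a = the_inv_into (carrier_vec (length v)) (lin_comb G A v) a"

text \<open>The matrix of conjugation by $g$: its $i$-th column consists of the coordinates of
  $g v_i g^{-1}$, that is, $g v_i = \sum_j a_{j,i}(g) v_j$.\<close>

definition conj_mat ::
  "('g, 'm) monoid_scheme \<Rightarrow> 'g set \<Rightarrow> 'g list \<Rightarrow> 'g \<Rightarrow> 'p::prime_card mod_ring mat" where
  "conj_mat G A v g =
     mat_of_cols (length v) (map (\<lambda>a. coords G A v (g \<otimes>\<^bsub>G\<^esub> a \<otimes>\<^bsub>G\<^esub> inv\<^bsub>G\<^esub> g)) v)"

definition centralizer :: "('g, 'm) monoid_scheme \<Rightarrow> 'g set \<Rightarrow> 'g set" where
  "centralizer G A = {g \<in> carrier G. \<forall>a\<in>A. g \<otimes>\<^bsub>G\<^esub> a = a \<otimes>\<^bsub>G\<^esub> g}"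

definition weyl_group :: "('g, 'm) monoid_scheme \<Rightarrow> 'g set \<Rightarrow> 'g set monoid" where
  "weyl_group G A = (G\<lparr>carrier := normalizer G A\<rparr>) Mod centralizer G A"

text \<open>All representatives $g$ of a coset $w$ of the centralizer have the same matrix.\<close>

definition weyl_mat ::
  "('g, 'm) monoid_scheme \<Rightarrow> 'g set \<Rightarrow> 'g list \<Rightarrow> 'g set \<Rightarrow> 'p::prime_card mod_ring mat" where
  "weyl_mat G A v w = the_elem (conj_mat G A v ` w)"

text \<open>$A \subset G$ is elementary abelian with basis $v$, and in this basis $W(A)$ is the
  matrix group $M$.  The rank of $A$ is the length of $v$.  No Lie group structure on $G$ is
  required: a maximal nontoral elementary abelian subgroup of an exceptional compact Lie group
  enters only through the description of $W(A)$ by Andersen, Grodal, Moeller and Viruel, which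
  is the condition on $M$ here.\<close>

definition elab_with_weyl_group ::
  "('g, 'm) monoid_scheme \<Rightarrow> 'g set \<Rightarrow> 'g list \<Rightarrow> 'p::prime_card mod_ring mat set \<Rightarrow> bool" where
  "elab_with_weyl_group G A v M \<longleftrightarrow>
     group G \<and> elementary_abelian CARD('p) G A \<and> Fp_basis TYPE('p) G A v \<and>
     weyl_mat G A v ` carrier (weyl_group G A) = M"


section \<open>Matrix groups\<close>

definition GL :: "nat \<Rightarrow> 'k::field mat set" where
  "GL n = {g \<in> carrier_mat n n. invertible_mat g}"

definition SL :: "nat \<Rightarrow> 'k::field mat set" where
  "SL n = {g \<in> carrier_mat n n. det g = 1}"

text \<open>
  The Weyl groups of the maximal nontoral subgroups, in suitable bases: \<open>SL 3\<close> over the field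
  with 5 elements for $E_{E_8}^3$ and over the field with 3 elements for $E_{F_4}^3$, and over the
  field with 3 elements the following groups for $E_{3E_6}^4$, $E_{2E_7}^4$ and $E_{E_8}^{5a}$.
\<close>

definition weyl_3E6_4 :: "'k::field mat set" where
  "weyl_3E6_4 = {four_block_mat (1\<^sub>m 1) m0 (0\<^sub>m 3 1) g2 | m0 g2.
     m0 \<in> carrier_mat 1 3 \<and> g2 \<in> SL 3}"

definition weyl_2E7_4 :: "'k::field mat set" where
  "weyl_2E7_4 = {four_block_mat g1 m0 (0\<^sub>m 3 1) g2 | g1 m0 g2.
     g1 \<in> GL 1 \<and> m0 \<in> carrier_mat 1 3 \<and> g2 \<in> SL 3}"

definition weyl_E8_5a :: "'k::field mat set" where
  "weyl_E8_5a =
     {four_block_mat (four_block_mat g1 m0' (0\<^sub>m 3 1) g2') (m0'' @\<^sub>r 0\<^sub>m 3 1)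
                     (0\<^sub>m 1 4)                               eps
      | g1 m0' m0'' g2' eps. g1 \<in> GL 1 \<and> eps \<in> GL 1 \<and> g2' \<in> SL 3 \<and>
          m0' \<in> carrier_mat 1 3 \<and> m0'' \<in> carrier_mat 1 1}"


section \<open>Graded polynomial algebras\<close>

text \<open>A polynomial in variables indexed by \<open>nat\<close> maps exponent vectors to coefficients; the
  library's multiplication on this type is the convolution product.\<close>

type_synonym 'k mpoly = "(nat \<Rightarrow>\<^sub>0 nat) \<Rightarrow>\<^sub>0 'k"

abbreviation Const :: "'k \<Rightarrow> 'k::field mpoly" where
  "Const c \<equiv> Poly_Mapping.single 0 c"

abbreviation Var :: "nat \<Rightarrow> 'k::field mpoly" where
  "Var i \<equiv> Poly_Mapping.single (Poly_Mapping.single i 1) 1"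

definition subst :: "(nat \<Rightarrow> 'k mpoly) \<Rightarrow> 'k mpoly \<Rightarrow> 'k::field mpoly" where
  "subst s f = (\<Sum>m\<in>Poly_Mapping.keys f. Const (Poly_Mapping.lookup f m) *
                  (\<Prod>i\<in>Poly_Mapping.keys m. s i ^ Poly_Mapping.lookup m i))"

record 'r graded_alg =
  total :: "'r set"
  component :: "nat \<Rightarrow> 'r set"

text \<open>The polynomial algebra on \<open>length ds\<close> generators, the \<open>i\<close>-th one in degree \<open>ds ! i\<close>.\<close>

definition poly_alg :: "nat list \<Rightarrow> 'k::field mpoly graded_alg" where
  "poly_alg ds =
     \<lparr>total = {f. \<forall>m\<in>Poly_Mapping.keys f. Poly_Mapping.keys m \<subseteq> {..<length ds}},
      component = (\<lambda>d. {f. \<forall>m\<in>Poly_Mapping.keys f. Poly_Mapping.keys m \<subseteq> {..<length ds} \<and>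
                                     (\<Sum>i\<in>Poly_Mapping.keys m. Poly_Mapping.lookup m i * ds ! i) = d})\<rparr>"

definition graded_alg_isomorphic ::
  "'k::field mpoly graded_alg \<Rightarrow> 'k mpoly graded_alg \<Rightarrow> bool" (infix "\<cong>\<^sub>g\<^sub>r" 50) where
  "R \<cong>\<^sub>g\<^sub>r S \<longleftrightarrow> (\<exists>\<phi>. bij_betw \<phi> (total R) (total S) \<and>
     \<phi> 1 = 1 \<and>
     (\<forall>x\<in>total R. \<forall>y\<in>total R. \<phi> (x + y) = \<phi> x + \<phi> y \<and> \<phi> (x * y) = \<phi> x * \<phi> y) \<and>
     (\<forall>c. \<forall>x\<in>total R. \<phi> (Const c * x) = Const c * \<phi> x) \<and>
     (\<forall>d. \<phi> ` component R d = component S d))"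


section \<open>The algebra $\Gamma H^*BA$ and its invariants\<close>

text \<open>For a basis $v_1,\dots,v_n$ of $A$, the quotient of $H^*BA$ by its nilradical is the
  polynomial algebra on generators $t_1,\dots,t_n$ of degree 2 corresponding to the dual basis.\<close>

definition GammaH :: "'g list \<Rightarrow> 'k::field mpoly graded_alg" where
  "GammaH v = poly_alg (replicate (length v) 2)"

text \<open>The action $g x = B(g^{-1})^* x$, which is the algebra automorphism with
  $g t_i = \sum_j a_{i,j}(g^{-1}) t_j$.\<close>

definition weyl_act :: "('g, 'm) monoid_scheme \<Rightarrow> 'g set \<Rightarrow> 'g list \<Rightarrow> 'g set \<Rightarrow>
    'p::prime_card mod_ring mpoly \<Rightarrow> 'p mod_ring mpoly" where
  "weyl_act G A v w =
     subst (\<lambda>i. \<Sum>j<length v. Const (weyl_mat G A v (inv\<^bsub>weyl_group G A\<^esub> w) $$ (i, j)) * Var j)"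

definition GammaH_invariants ::
  "('g, 'm) monoid_scheme \<Rightarrow> 'g set \<Rightarrow> 'g list \<Rightarrow> 'p::prime_card mod_ring mpoly graded_alg" where
  "GammaH_invariants G A v =
     (let I = {f. \<forall>w\<in>carrier (weyl_group G A). weyl_act G A v w f = f}
      in \<lparr>total = total (GammaH v) \<inter> I, component = (\<lambda>d. component (GammaH v) d \<inter> I)\<rparr>)"

end

theory Submission
  imports Defs
begin

text \<open>
  Let $k$ be the field with $p$ elements and restrict an invariant to the hyperplane $x_n = 0$ of
  the last variable.  If the restriction vanishes, the invariance makes every linear form in the
  orbit of $x_n$ a divisor, hence the product of the orbit divides; the quotient is an invariant
  of smaller degree.  For $SL_3$ and $GL_2$ the restriction is annihilated by all partial
  derivatives, because $f$ is fixed by $x_i \mapsto x_i + x_n$; so it is a $p$-th power of an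
  invariant of the general linear group in one variable fewer, and the Dickson invariants
  restrict to the $p$-th powers of the Dickson invariants in one variable fewer.  Induction on the
  degree then shows that the orbit product together with lifts of generators of the restricted
  ring generate, and the same division shows that they are algebraically independent.
  For the parabolic groups the restriction is an invariant of the smaller group, and the new
  generator is the orbit product of $t_1$ or its $(p-1)$-st power.
\<close>

section \<open>Polynomials and substitutions\<close>

text \<open>The simplifier would turn the exponent 1 inside \<open>Var i\<close> into \<open>Suc 0\<close>.\<close>

declare One_nat_def [simp del]

text \<open>Restriction leads from SL_3 to GL_2 and then GL_1, not to smaller special linear groups:
  a matrix of GL_2 extends to one of SL_3 once the inverse of its determinant is put in the last
  diagonal entry, so the root of a restricted invariant has the full general linear symmetry. The
  scalars gained in this way are what forces (p-1)-st powers. Two descriptions of the Dickson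
  invariants are needed. The recursion makes them polynomials and displays their restrictions but
  hides the symmetry; the Moore determinants display the symmetry but give the invariants only as
  quotients. The link between the two is Cramer's rule for a linear recurrence among Frobenius
  powers. The action is defined through inverses in W(A). As W(A) is a group, only its set of
  matrices matters, and each matrix group is traded for a set of substitutions that has to agree
  with it only on the variables present. Every degree carries a factor 2, the degree of each
  t_i.\<close>

abbreviation keys :: "('a \<Rightarrow>\<^sub>0 'b::zero) \<Rightarrow> 'a set" where "keys \<equiv> Poly_Mapping.keys"
abbreviation lookup :: "('a \<Rightarrow>\<^sub>0 'b::zero) \<Rightarrow> 'a \<Rightarrow> 'b" where "lookup \<equiv> Poly_Mapping.lookup"
abbreviation single :: "'a \<Rightarrow> 'b \<Rightarrow> ('a \<Rightarrow>\<^sub>0 'b::zero)" where "single \<equiv> Poly_Mapping.single"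

section \<open>Substitution as an algebra homomorphism\<close>

definition eval_monom :: "(nat \<Rightarrow> 'k mpoly) \<Rightarrow> (nat \<Rightarrow>\<^sub>0 nat) \<Rightarrow> 'k::field mpoly" where
  "eval_monom s m = (\<Prod>i\<in>keys m. s i ^ lookup m i)"

lemma poly_mapping_sum_singles: "(\<Sum>m\<in>keys f. single m (lookup f m)) = f"
proof (rule poly_mapping_eqI)
  fix k
  show "lookup (\<Sum>m\<in>keys f. single m (lookup f m)) k = lookup f k"
    by (cases "k \<in> keys f") (auto simp: lookup_sum lookup_single when_def in_keys_iff)
qed

lemma keys_add_nat: "keys (m + n :: 'a \<Rightarrow>\<^sub>0 nat) = keys m \<union> keys n"
  by (auto simp: in_keys_iff lookup_add)

lemma eval_monom_superset: "finite A \<Longrightarrow> keys m \<subseteq> A \<Longrightarrow> eval_monom s m = (\<Prod>i\<in>A. s i ^ lookup m i)"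
  unfolding eval_monom_def by (intro prod.mono_neutral_left) (auto simp: in_keys_iff)

lemma eval_monom_zero [simp]: "eval_monom s 0 = 1"
  by (simp add: eval_monom_def)

lemma eval_monom_add: "eval_monom s (m + n) = eval_monom s m * eval_monom s n"
proof -
  let ?A = "keys m \<union> keys n"
  have "eval_monom s (m + n) = (\<Prod>i\<in>?A. s i ^ lookup (m + n) i)"
    by (rule eval_monom_superset) (auto simp: keys_add_nat)
  moreover have "eval_monom s m = (\<Prod>i\<in>?A. s i ^ lookup m i)"
    by (rule eval_monom_superset) auto
  moreover have "eval_monom s n = (\<Prod>i\<in>?A. s i ^ lookup n i)"
    by (rule eval_monom_superset) auto
  ultimately show ?thesis
    by (simp add: lookup_add power_add prod.distrib)
qed

lemma eval_monom_single: "eval_monom s (single i k) = s i ^ k"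
  by (cases "k = 0") (auto simp: eval_monom_def)

lemma eval_monom_cong: "(\<And>i. i \<in> keys m \<Longrightarrow> s i = t i) \<Longrightarrow> eval_monom s m = eval_monom t m"
  unfolding eval_monom_def by (intro prod.cong) auto

lemma Var_power: "Var i ^ k = single (single i k) (1::'k::field)"
proof (induction k)
  case (Suc k)
  have "Var i ^ Suc k = single (single i 1 + single i k) (1::'k)"
    by (simp add: Suc mult_single)
  also have "single i 1 + single i k = single i (Suc k)"
    by (simp add: Suc_eq_plus1_left flip: single_add del: add_Suc_right)
  finally show ?case .
qed simp

lemma eval_monom_Var: "eval_monom Var m = single m (1::'k::field)"
proof -
  have *: "finite S \<Longrightarrow> (\<Prod>i\<in>S. Var i ^ k i) = single (\<Sum>i\<in>S. single i (k i)) (1::'k)" for S k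
    by (induction S rule: finite_induct) (auto simp: Var_power mult_single)
  show ?thesis unfolding eval_monom_def by (subst *) (simp_all add: poly_mapping_sum_singles)
qed

lemma subst_eval_monom: "subst s f = (\<Sum>m\<in>keys f. Const (lookup f m) * eval_monom s m)"
  by (simp add: subst_def eval_monom_def)

lemma subst_superset: "finite A \<Longrightarrow> keys f \<subseteq> A \<Longrightarrow> subst s f = (\<Sum>m\<in>A. Const (lookup f m) * eval_monom s m)"
  unfolding subst_eval_monom by (intro sum.mono_neutral_left) (auto simp: in_keys_iff)

lemma subst_zero [simp]: "subst s 0 = 0"
  by (simp add: subst_eval_monom)

lemma subst_single: "subst s (single m c) = Const c * eval_monom s m"
  by (cases "c = 0") (auto simp: subst_eval_monom)

lemma subst_Const [simp]: "subst s (Const c) = Const c"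
  by (simp add: subst_single)

lemma subst_one [simp]: "subst s 1 = 1"
  using subst_Const[of s 1] by simp

lemma subst_Var [simp]: "subst s (Var i) = s i"
  by (simp add: subst_single eval_monom_single)

lemma subst_add [simp]: "subst s (f + g) = subst s f + subst s g"
proof -
  let ?A = "keys f \<union> keys g"
  have "subst s (f + g) = (\<Sum>m\<in>?A. Const (lookup (f + g) m) * eval_monom s m)"
    by (rule subst_superset) (use Poly_Mapping.keys_add[of f g] in auto)
  moreover have "subst s f = (\<Sum>m\<in>?A. Const (lookup f m) * eval_monom s m)"
    by (rule subst_superset) auto
  moreover have "subst s g = (\<Sum>m\<in>?A. Const (lookup g m) * eval_monom s m)"
    by (rule subst_superset) auto
  ultimately show ?thesis
    by (simp add: lookup_add single_add distrib_right sum.distrib)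
qed

lemma subst_sum [simp]: "subst s (sum f A) = (\<Sum>x\<in>A. subst s (f x))"
  by (induction A rule: infinite_finite_induct) auto

text \<open>Both sides are additive in each factor, so it is enough to compare single terms, where
  exponents add.\<close>

lemma subst_mult [simp]: "subst s (f * g) = subst s f * subst s g"
proof -
  let ?s = "\<lambda>f m. single m (lookup f m)"
  have *: "subst s (?s f m * ?s g n) = subst s (?s f m) * subst s (?s g n)" for m n
    by (simp add: mult_single subst_single eval_monom_add algebra_simps)
  have "subst s (f * g) = subst s ((\<Sum>m\<in>keys f. ?s f m) * (\<Sum>n\<in>keys g. ?s g n))"
    by (simp add: poly_mapping_sum_singles)
  also have "\<dots> = (\<Sum>m\<in>keys f. \<Sum>n\<in>keys g. subst s (?s f m * ?s g n))"
    by (simp only: sum_product subst_sum)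
  also have "\<dots> = subst s (\<Sum>m\<in>keys f. ?s f m) * subst s (\<Sum>n\<in>keys g. ?s g n)"
    by (simp only: * sum_product subst_sum)
  finally show ?thesis by (simp only: poly_mapping_sum_singles)
qed

lemma subst_uminus [simp]: "subst s (- f) = - subst s f"
  using subst_add[of s "- f" f] by (simp add: eq_neg_iff_add_eq_0 del: subst_add)

lemma subst_diff [simp]: "subst s (f - g) = subst s f - subst s g"
  using subst_add[of s f "- g"] by simp

lemma subst_power [simp]: "subst s (f ^ n) = subst s f ^ n"
  by (induction n) auto

lemma subst_prod [simp]: "subst s (prod f A) = (\<Prod>x\<in>A. subst s (f x))"
  by (induction A rule: infinite_finite_induct) auto

section \<open>Polynomials in a given set of variables\<close>

definition polys :: "nat set \<Rightarrow> 'k::field mpoly set" where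
  "polys X = {f. \<forall>m\<in>keys f. keys m \<subseteq> X}"

lemma mpoly_expand:
  fixes f :: "'k::field mpoly"
  shows "f = (\<Sum>m\<in>keys f. Const (lookup f m) * (\<Prod>i\<in>keys m. Var i ^ lookup m i))"
proof -
  have "Const (lookup f m) * (\<Prod>i\<in>keys m. Var i ^ lookup m i) = single m (lookup f m)" for m
    using eval_monom_Var[of m, where 'k = 'k] by (simp add: eval_monom_def mult_single)
  then show ?thesis by (simp add: poly_mapping_sum_singles)
qed

text \<open>Every polynomial is a sum of products of constants and variables. Facts about
  \<open>subst\<close>, which is a homomorphism, therefore reduce to the values on
  variables.\<close>

lemma polys_induct [consumes 1, case_names Const Var add mult]:
  assumes f: "f \<in> polys X"
    and C: "\<And>c. P (Const c)" and V: "\<And>i. i \<in> X \<Longrightarrow> P (Var i)"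
    and A: "\<And>f g. P f \<Longrightarrow> P g \<Longrightarrow> P (f + g)" and M: "\<And>f g. P f \<Longrightarrow> P g \<Longrightarrow> P (f * g)"
  shows "P f"
proof -
  have one: "P 1" using C[of 1] by simp
  have zero: "P 0" using C[of 0] by simp
  have pow: "P g \<Longrightarrow> P (g ^ n)" for g n by (induction n) (auto simp: one M)
  have prd: "finite S \<Longrightarrow> (\<And>x. x \<in> S \<Longrightarrow> P (h x)) \<Longrightarrow> P (prod h S)" for h and S :: "nat set"
    by (induction S rule: finite_induct) (auto simp: one M)
  have sm: "finite S \<Longrightarrow> (\<And>x. x \<in> S \<Longrightarrow> P (h x)) \<Longrightarrow> P (sum h S)" for h and S :: "(nat \<Rightarrow>\<^sub>0 nat) set"
    by (induction S rule: finite_induct) (auto simp: zero A)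
  show ?thesis
    by (subst mpoly_expand[of f], intro sm M C prd pow V) (use f in \<open>auto simp: polys_def\<close>)
qed

lemma polys_UNIV: "polys UNIV = UNIV" by (auto simp: polys_def)

lemma mpoly_induct [case_names Const Var add mult]:
  assumes "\<And>c. P (Const c)" and "\<And>i. P (Var i)"
    and "\<And>f g. P f \<Longrightarrow> P g \<Longrightarrow> P (f + g)" and "\<And>f g. P f \<Longrightarrow> P g \<Longrightarrow> P (f * g)"
  shows "P f"
  using polys_induct[of f UNIV P] assms by (auto simp: polys_UNIV)

lemma subst_cong: "f \<in> polys X \<Longrightarrow> (\<And>i. i \<in> X \<Longrightarrow> s i = t i) \<Longrightarrow> subst s f = subst t f"
  by (induction rule: polys_induct) auto

lemma subst_id [simp]: "subst Var f = f"
  by (induction f rule: mpoly_induct) auto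

lemma subst_id_on: "f \<in> polys X \<Longrightarrow> (\<And>i. i \<in> X \<Longrightarrow> s i = Var i) \<Longrightarrow> subst s f = f"
  by (subst subst_cong[of f X s Var]) auto

lemma subst_subst: "subst s (subst t f) = subst (\<lambda>i. subst s (t i)) f"
  by (induction f rule: mpoly_induct) auto

lemma polys_Const [simp, intro]: "Const c \<in> polys X"
  by (auto simp: polys_def)

lemma polys_Var_iff [simp]: "Var i \<in> polys X \<longleftrightarrow> i \<in> X"
  by (auto simp: polys_def)

lemma polys_zero [simp, intro]: "0 \<in> polys X" and polys_one [simp, intro]: "1 \<in> polys X"
  by (auto simp: polys_def)

lemma polys_add [intro]: "f \<in> polys X \<Longrightarrow> g \<in> polys X \<Longrightarrow> f + g \<in> polys X"
  using Poly_Mapping.keys_add[of f g] by (auto simp: polys_def)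

lemma polys_mult [intro]: "f \<in> polys X \<Longrightarrow> g \<in> polys X \<Longrightarrow> f * g \<in> polys X"
  using keys_mult[of f g] by (fastforce simp: polys_def keys_add_nat)

lemma polys_uminus [intro]: "f \<in> polys X \<Longrightarrow> - f \<in> polys X"
  by (auto simp: polys_def in_keys_iff)

lemma polys_diff [intro]: "f \<in> polys X \<Longrightarrow> g \<in> polys X \<Longrightarrow> f - g \<in> polys X"
  using polys_add[of f X "- g"] polys_uminus[of g X] by simp

lemma polys_power [intro]: "f \<in> polys X \<Longrightarrow> f ^ n \<in> polys X"
  by (induction n) auto

lemma polys_sum [intro]: "(\<And>x. x \<in> A \<Longrightarrow> f x \<in> polys X) \<Longrightarrow> sum f A \<in> polys X"
  by (induction A rule: infinite_finite_induct) auto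

lemma polys_prod [intro]: "(\<And>x. x \<in> A \<Longrightarrow> f x \<in> polys X) \<Longrightarrow> prod f A \<in> polys X"
  by (induction A rule: infinite_finite_induct) auto

lemma polys_mono: "X \<subseteq> Y \<Longrightarrow> f \<in> polys X \<Longrightarrow> f \<in> polys Y"
  by (auto simp: polys_def)

lemma polys_subst: "f \<in> polys X \<Longrightarrow> (\<And>i. i \<in> X \<Longrightarrow> s i \<in> polys Y) \<Longrightarrow> subst s f \<in> polys Y"
  by (induction rule: polys_induct) auto

text \<open>Setting all variables outside \<open>X\<close> to 0 fixes \<open>f\<close> and
  \<open>L\<close>; after cancelling \<open>L\<close> it fixes the quotient as well, which therefore
  contains no such variable.\<close>

lemma polys_quotient:
  assumes "f \<in> polys X" "L \<in> polys X" "L \<noteq> 0" "f = L * g"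
  shows "g \<in> polys X"
proof -
  let ?s = "\<lambda>i. if i \<in> X then Var i else 0"
  have "L * g = subst ?s (L * g)"
    using subst_id_on[OF assms(1), of ?s] assms(4) by simp
  also have "\<dots> = L * subst ?s g"
    using subst_id_on[OF assms(2), of ?s] by simp
  finally have "g = subst ?s g"
    using assms(3) by simp
  also have "\<dots> \<in> polys X"
    by (rule polys_subst[of _ UNIV]) (auto simp: polys_UNIV)
  finally show ?thesis .
qed

section \<open>Weighted degrees and homogeneous components\<close>

definition wt :: "(nat \<Rightarrow> nat) \<Rightarrow> (nat \<Rightarrow>\<^sub>0 nat) \<Rightarrow> nat" where
  "wt w m = (\<Sum>i\<in>keys m. lookup m i * w i)"

text \<open>The weights are left free so that one notion covers both the grading of the t_i, by
  \<open>two\<close>, and the grading of an abstract polynomial ring by the degrees of its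
  generators. Zero is homogeneous of every degree.\<close>

definition homog :: "(nat \<Rightarrow> nat) \<Rightarrow> nat \<Rightarrow> 'k::field mpoly set" where
  "homog w d = {f. \<forall>m\<in>keys f. wt w m = d}"

lemma wt_zero [simp]: "wt w 0 = 0" by (simp add: wt_def)

lemma wt_add: "wt w (m + n) = wt w m + wt w n"
proof -
  have *: "wt w k = (\<Sum>i\<in>keys m \<union> keys n. lookup k i * w i)" if "keys k \<subseteq> keys m \<union> keys n" for k
    unfolding wt_def using that by (intro sum.mono_neutral_left) (auto simp: in_keys_iff)
  show ?thesis
    by (simp add: *[of m] *[of n] *[of "m + n"] keys_add_nat lookup_add algebra_simps sum.distrib)
qed

lemma wt_single [simp]: "wt w (single i k) = k * w i"
  by (simp add: wt_def)

lemma homog_zero [simp, intro]: "0 \<in> homog w d" by (auto simp: homog_def)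
lemma homog_Const [simp, intro]: "Const c \<in> homog w 0" by (auto simp: homog_def)
lemma homog_one [simp, intro]: "1 \<in> homog w 0" by (auto simp: homog_def)
lemma homog_Var [simp, intro]: "Var i \<in> homog w (w i)" by (auto simp: homog_def)

lemma homog_add [intro]: "f \<in> homog w d \<Longrightarrow> g \<in> homog w d \<Longrightarrow> f + g \<in> homog w d"
  using Poly_Mapping.keys_add[of f g] by (auto simp: homog_def)

lemma homog_uminus [intro]: "f \<in> homog w d \<Longrightarrow> - f \<in> homog w d"
  by (auto simp: homog_def in_keys_iff)

lemma homog_diff [intro]: "f \<in> homog w d \<Longrightarrow> g \<in> homog w d \<Longrightarrow> f - g \<in> homog w d"
  using homog_add[of f w d "- g"] homog_uminus[of g w d] by simp

lemma homog_mult: "f \<in> homog w d \<Longrightarrow> g \<in> homog w e \<Longrightarrow> f * g \<in> homog w (d + e)"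
  using keys_mult[of f g] by (fastforce simp: homog_def wt_add)

lemma homog_mult_eq: "f \<in> homog w d \<Longrightarrow> g \<in> homog w e \<Longrightarrow> d + e = r \<Longrightarrow> f * g \<in> homog w r"
  using homog_mult by blast

lemma homog_power: "f \<in> homog w d \<Longrightarrow> f ^ n \<in> homog w (n * d)"
  by (induction n) (auto intro: homog_mult)

lemma homog_power_eq: "f \<in> homog w d \<Longrightarrow> n * d = r \<Longrightarrow> f ^ n \<in> homog w r"
  using homog_power by blast

lemma homog_sum [intro]: "(\<And>x. x \<in> A \<Longrightarrow> f x \<in> homog w d) \<Longrightarrow> sum f A \<in> homog w d"
  by (induction A rule: infinite_finite_induct) auto

lemma homog_prod: "(\<And>x. x \<in> A \<Longrightarrow> f x \<in> homog w (d x)) \<Longrightarrow> prod f A \<in> homog w (\<Sum>x\<in>A. d x)"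
  by (induction A rule: infinite_finite_induct) (auto intro: homog_mult)

lemma homog_Const_mult: "f \<in> homog w d \<Longrightarrow> Const c * f \<in> homog w d"
  using homog_mult[of "Const c" w 0 f d] by simp

definition hcomp :: "(nat \<Rightarrow> nat) \<Rightarrow> nat \<Rightarrow> 'k::field mpoly \<Rightarrow> 'k mpoly" where
  "hcomp w d f = (\<Sum>m\<in>{m\<in>keys f. wt w m = d}. single m (lookup f m))"

lemma lookup_hcomp: "lookup (hcomp w d f) m = (if wt w m = d then lookup f m else 0)"
proof -
  have "lookup (hcomp w d f) m = (\<Sum>k\<in>{k\<in>keys f. wt w k = d}. if k = m then lookup f k else 0)"
    by (simp add: hcomp_def lookup_sum lookup_single when_def)
  also have "\<dots> = (if wt w m = d then lookup f m else 0)"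
    by (subst sum.delta) (auto simp: in_keys_iff)
  finally show ?thesis .
qed

lemma hcomp_homog [simp, intro]: "hcomp w d f \<in> homog w d"
  by (auto simp: homog_def in_keys_iff lookup_hcomp split: if_splits)

lemma hcomp_polys: "f \<in> polys X \<Longrightarrow> hcomp w d f \<in> polys X"
  by (auto simp: polys_def in_keys_iff lookup_hcomp split: if_splits)

lemma hcomp_add: "hcomp w d (f + g) = hcomp w d f + hcomp w d g"
  by (rule poly_mapping_eqI) (simp add: lookup_hcomp lookup_add)

lemma hcomp_zero [simp]: "hcomp w d 0 = 0"
  by (simp add: hcomp_def)

lemma hcomp_sum: "hcomp w d (sum f A) = (\<Sum>x\<in>A. hcomp w d (f x))"
  by (induction A rule: infinite_finite_induct) (auto simp: hcomp_add)

lemma hcomp_of_homog: "f \<in> homog w e \<Longrightarrow> hcomp w d f = (if d = e then f else 0)"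
  by (rule poly_mapping_eqI) (auto simp: lookup_hcomp homog_def in_keys_iff)

lemma sum_hcomp: "(\<Sum>d\<in>wt w ` keys f. hcomp w d f) = f"
proof (rule poly_mapping_eqI)
  fix m
  show "lookup (\<Sum>d\<in>wt w ` keys f. hcomp w d f) m = lookup f m"
    by (cases "m \<in> keys f") (auto simp: lookup_sum lookup_hcomp in_keys_iff)
qed

text \<open>An additive map that raises the degree of each component by \<open>e\<close> only shifts
  components. The case where \<open>e\<close> is 0 serves degree-preserving substitutions, the
  general case multiplication by a homogeneous polynomial.\<close>

lemma hcomp_commutes:
  assumes add: "\<And>f g. F (f + g) = F f + F g" and zero: "F 0 = 0"
    and h: "\<And>d. F (hcomp w d f) \<in> homog u (e + d)"
  shows "hcomp u (e + d) (F f) = F (hcomp w d f)" "d < e \<Longrightarrow> hcomp u d (F f) = 0"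
proof -
  have F_sum: "F (sum g A) = (\<Sum>x\<in>A. F (g x))" for g :: "nat \<Rightarrow> _" and A
    by (induction A rule: infinite_finite_induct) (auto simp: add zero)
  have eq: "hcomp u r (F f) = (\<Sum>d\<in>wt w ` keys f. if r = e + d then F (hcomp w d f) else 0)" for r
  proof -
    have "hcomp u r (F f) = hcomp u r (F (\<Sum>d\<in>wt w ` keys f. hcomp w d f))"
      by (simp add: sum_hcomp)
    also have "\<dots> = (\<Sum>d\<in>wt w ` keys f. if r = e + d then F (hcomp w d f) else 0)"
      unfolding F_sum hcomp_sum by (intro sum.cong refl) (auto simp: hcomp_of_homog[OF h])
    finally show ?thesis .
  qed
  show "d < e \<Longrightarrow> hcomp u d (F f) = 0"
    by (subst eq) auto
  have "hcomp w d f = 0" if "d \<notin> wt w ` keys f"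
    using that by (auto simp: hcomp_def intro!: sum.neutral)
  then show "hcomp u (e + d) (F f) = F (hcomp w d f)"
    by (subst eq) (auto simp: zero)
qed

lemma subst_homog:
  assumes "f \<in> polys X" "f \<in> homog w d" "\<And>i. i \<in> X \<Longrightarrow> s i \<in> homog u (w i)"
  shows "subst s f \<in> homog u d"
proof -
  have "eval_monom s m \<in> homog u d" if "m \<in> keys f" for m
  proof -
    have "eval_monom s m \<in> homog u (\<Sum>i\<in>keys m. lookup m i * w i)"
      unfolding eval_monom_def using that assms by (intro homog_prod homog_power) (auto simp: polys_def)
    also have "(\<Sum>i\<in>keys m. lookup m i * w i) = d"
      using that assms by (auto simp: homog_def wt_def)
    finally show ?thesis .
  qed
  then show ?thesis unfolding subst_eval_monom by (intro homog_sum homog_Const_mult)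
qed

lemma hcomp_subst:
  assumes "f \<in> polys X" "\<And>i. i \<in> X \<Longrightarrow> s i \<in> homog u (w i)"
  shows "hcomp u d (subst s f) = subst s (hcomp w d f)"
  using hcomp_commutes(1)[of "subst s" w f u 0 d] subst_homog[OF hcomp_polys[OF assms(1)] hcomp_homog] assms(2)
  by auto

text \<open>The component of degree \<open>d\<close> of \<open>L * g\<close> is \<open>L\<close>
  times the component of \<open>g\<close> of degree \<open>d - e\<close>, or 0 if
  \<open>d < e\<close>; cancel \<open>L\<close>. This gives the drop in degree on which the
  induction for generation rests.\<close>

lemma homog_factor:
  assumes "L \<in> homog w e" "L \<noteq> 0" "L * g \<in> homog w d"
  shows "g = 0 \<or> (e \<le> d \<and> g \<in> homog w (d - e))"
proof -
  note c = hcomp_commutes[of "(*) L" w g w e]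
  have h: "L * hcomp w d g \<in> homog w (e + d)" for d
    using assms(1) by (intro homog_mult) auto
  show ?thesis
  proof (cases "e \<le> d")
    case True
    have "L * g = hcomp w d (L * g)" using assms(3) by (simp add: hcomp_of_homog)
    also have "\<dots> = L * hcomp w (d - e) g"
      using c(1)[of "d - e"] h True by (simp add: distrib_left)
    finally have "g = hcomp w (d - e) g" using assms(2) by simp
    then show ?thesis using True by (metis hcomp_homog)
  next
    case False
    have "L * g = hcomp w d (L * g)" using assms(3) by (simp add: hcomp_of_homog)
    also have "\<dots> = 0"
      using c(2)[of d] h False by (simp add: distrib_left)
    finally show ?thesis using assms(2) by simp
  qed
qed

section \<open>Divisibility by linear forms\<close>

lemma lookup_subst_zero:
  "lookup (subst (Var(k := 0)) f) m = (if lookup m k = 0 then lookup f m else 0)"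
proof -
  have *: "eval_monom (Var(k := 0)) n = (if lookup n k = 0 then single n 1 else (0::'a mpoly))" for n
  proof (cases "lookup n k = 0")
    case True
    then have "eval_monom (Var(k := 0)) n = eval_monom Var n"
      by (intro eval_monom_cong) (auto simp: in_keys_iff)
    then show ?thesis using True by (simp add: eval_monom_Var)
  next
    case False
    then show ?thesis by (auto simp: eval_monom_def in_keys_iff power_0_left intro!: prod_zero bexI[of _ k])
  qed
  have "lookup (subst (Var(k := 0)) f) m = (\<Sum>n\<in>keys f. if n = m then (if lookup m k = 0 then lookup f m else 0) else 0)"
    unfolding subst_eval_monom lookup_sum * by (intro sum.cong) (auto simp: mult_single lookup_single when_def)
  also have "\<dots> = (if lookup m k = 0 then lookup f m else 0)"
    by (subst sum.delta) (auto simp: in_keys_iff)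
  finally show ?thesis .
qed

text \<open>Modulo \<open>Var k + h\<close> the variable \<open>Var k\<close> equals
  \<open>- h\<close>, so the substitution changes nothing modulo this form: clear for variables, and
  preserved by sums and products.\<close>

lemma dvd_diff_subst: "Var k + h dvd f - subst (Var(k := - h)) f"
proof (induction f rule: mpoly_induct)
  case (add f g)
  let ?s = "subst (Var(k := - h))"
  have "f + g - ?s (f + g) = (f - ?s f) + (g - ?s g)" by simp
  then show ?case using dvd_add[OF add] by (simp only:)
next
  case (mult f g)
  let ?s = "subst (Var(k := - h))"
  have "f * g - ?s (f * g) = f * (g - ?s g) + (f - ?s f) * ?s g"
    by (simp add: algebra_simps)
  then show ?case using dvd_add[OF dvd_mult[OF mult(2), of f] dvd_mult2[OF mult(1), of "?s g"]] by (simp only:)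
qed auto

text \<open>The remainder theorem. As \<open>h\<close> is free of the variable \<open>k\<close>, the
  substitution fixes \<open>h\<close> and kills the form.\<close>

lemma linear_dvd_iff:
  assumes "h \<in> polys (- {k})"
  shows "Var k + h dvd f \<longleftrightarrow> subst (Var(k := - h)) f = 0"
proof
  assume "Var k + h dvd f"
  moreover have "subst (Var(k := - h)) h = h"
    using assms by (rule subst_id_on) auto
  ultimately show "subst (Var(k := - h)) f = 0"
    by (auto elim!: dvdE)
next
  assume "subst (Var(k := - h)) f = 0"
  then show "Var k + h dvd f" using dvd_diff_subst[of k h f] by simp
qed

lemma Var_dvd_iff: "Var k dvd f \<longleftrightarrow> subst (Var(k := 0)) f = 0"
  using linear_dvd_iff[of 0 k f] by simp

lemma linear_neq_zero:
  assumes "h \<in> polys (- {k})"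
  shows "Var k + h \<noteq> 0"
proof
  assume "Var k + h = 0"
  \<comment> \<open>This substitution is chosen to send the form to 1.\<close>
  then have "subst (Var(k := 1 - h)) (Var k + h) = 0" by simp
  moreover have "subst (Var(k := 1 - h)) h = h"
    using assms by (rule subst_id_on) auto
  ultimately show False by simp
qed

text \<open>Divisibility by the form is membership in the kernel of a ring homomorphism to a
  domain.\<close>

lemma prime_elem_linear:
  assumes "h \<in> polys (- {k})"
  shows "prime_elem (Var k + h)"
proof (rule prime_elemI)
  show "\<not> Var k + h dvd 1"
    by (simp add: linear_dvd_iff[OF assms])
  show "Var k + h dvd a \<or> Var k + h dvd b" if "Var k + h dvd a * b" for a b
    using that by (simp add: linear_dvd_iff[OF assms])
qed (rule linear_neq_zero[OF assms])

text \<open>Euclid's lemma for prime powers, by peeling off one factor \<open>x\<close> at a time;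
  the argument works in any domain.\<close>

lemma prime_elem_power_dvd_mult:
  fixes x :: "'a::idom"
  assumes "prime_elem x" "\<not> x dvd a" "x ^ k dvd a * b"
  shows "x ^ k dvd b"
  using assms(3)
proof (induction k arbitrary: b)
  case (Suc k)
  have "x dvd a * b" using dvd_trans[OF _ Suc.prems, of x] by simp
  then obtain c where c: "b = x * c"
    using assms(1,2) prime_elem_dvd_multD by blast
  have "x * x ^ k dvd x * (a * c)"
    using Suc.prems unfolding c by (simp only: power_Suc mult.left_commute)
  then have "x ^ k dvd a * c"
    using prime_elem_not_zeroI[OF assms(1)] by (simp only: dvd_mult_cancel_left simp_thms)
  then have "x ^ k dvd c" by (rule Suc.IH)
  then show ?case by (simp add: c mult_dvd_mono)
qed simp

text \<open>Primes none of which divides another act as coprime factors: divide by the powers in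
  turn, each remaining power passing to the cofactor.\<close>

lemma prod_prime_power_dvd:
  fixes f :: "'a::idom"
  assumes "finite S" "\<And>x. x \<in> S \<Longrightarrow> prime_elem (g x)" "\<And>x y. x \<in> S \<Longrightarrow> y \<in> S \<Longrightarrow> x \<noteq> y \<Longrightarrow> \<not> g x dvd g y"
    "\<And>x. x \<in> S \<Longrightarrow> g x ^ k dvd f"
  shows "(\<Prod>x\<in>S. g x) ^ k dvd f"
  using assms
proof (induction S rule: finite_induct)
  case (insert x S)
  note prems = insert.prems
  have "(\<Prod>x\<in>S. g x) ^ k dvd f"
  proof (rule insert.IH)
    show "prime_elem (g y)" if "y \<in> S" for y by (rule prems(1)) (use that in simp)
    show "\<not> g y dvd g z" if "y \<in> S" "z \<in> S" "y \<noteq> z" for y z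
      by (rule prems(2)) (use that in simp_all)
    show "g y ^ k dvd f" if "y \<in> S" for y by (rule prems(3)) (use that in simp)
  qed
  then obtain c where c: "f = (\<Prod>x\<in>S. g x) ^ k * c" by (elim dvdE)
  have px: "prime_elem (g x)" by (rule prems(1)) simp
  \<comment> \<open>Stated for subsets of \<open>S\<close>, so that the induction can remove
    elements while the distinctness assumptions stay those of \<open>S\<close>.\<close>
  have nd: "T \<subseteq> S \<Longrightarrow> \<not> g x dvd prod g T" if "finite T" for T
    using that
  proof (induction T rule: finite_induct)
    case empty
    then show ?case using px by (simp add: prime_elem_def)
  next
    case (insert y T)
    have "\<not> g x dvd g y"
      by (rule prems(2)) (use insert.prems \<open>x \<notin> S\<close> in auto)
    moreover have "\<not> g x dvd prod g T"
      using insert.IH insert.prems by blast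
    ultimately show ?case
      using prime_elem_dvd_multD[OF px, of "g y" "prod g T"] insert.hyps by auto
  qed
  have "\<not> g x dvd (\<Prod>x\<in>S. g x) ^ k"
    using nd[OF insert.hyps(1) order_refl] prime_elem_dvd_power[OF px] by blast
  moreover have "g x ^ k dvd (\<Prod>x\<in>S. g x) ^ k * c"
    using prems(3)[of x] c by simp
  ultimately have "g x ^ k dvd c"
    by (rule prime_elem_power_dvd_mult[OF px])
  then have "(\<Prod>x\<in>S. g x) ^ k * g x ^ k dvd f"
    unfolding c by (rule mult_dvd_mono[OF dvd_refl])
  then show ?case
    using insert.hyps by (simp add: power_mult_distrib mult.commute)
qed simp

lemma Var_power_dvd:
  assumes "\<And>m. m \<in> keys f \<Longrightarrow> k \<le> lookup m n"
  shows "Var n ^ k dvd f"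
proof -
  have "Var n ^ k dvd single m (lookup f m)" if "m \<in> keys f" for m
  proof -
    have "m = single n k + (m - single n k)"
      using assms[OF that] by (intro poly_mapping_eqI) (auto simp: lookup_add lookup_minus lookup_single when_def)
    then have "single m (lookup f m) = Var n ^ k * single (m - single n k) (lookup f m)"
      by (simp add: Var_power mult_single)
    then show ?thesis by simp
  qed
  then have "Var n ^ k dvd (\<Sum>m\<in>keys f. single m (lookup f m))"
    by (intro dvd_sum) auto
  then show ?thesis by (simp add: poly_mapping_sum_singles)
qed

text \<open>Division with remainder by \<open>Var n\<close>. The bound on the exponent of
  \<open>n\<close> drops by one, which is the induction measure in the proof of algebraic
  independence.\<close>

lemma split_variable:
  assumes "f \<in> polys (insert n X)" "n \<notin> X" "\<And>m. m \<in> keys f \<Longrightarrow> lookup m n \<le> Suc N"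
  obtains f0 f1 where "f = f0 + Var n * f1" "f0 \<in> polys X" "f1 \<in> polys (insert n X)"
    "\<And>m. m \<in> keys f1 \<Longrightarrow> lookup m n \<le> N"
proof -
  define f0 where "f0 = subst (Var(n := 0)) f"
  define S where "S = {m \<in> keys f. lookup m n \<noteq> 0}"
  \<comment> \<open>Subtraction of exponents is truncated; \<open>S\<close> contains only monomials
    in which \<open>n\<close> occurs, so nothing is lost.\<close>
  define f1 where "f1 = (\<Sum>m\<in>S. single (m - single n 1) (lookup f m))"
  have m: "single n 1 + (m - single n 1) = m" if "m \<in> S" for m
    using that by (intro poly_mapping_eqI) (auto simp: S_def lookup_add lookup_minus lookup_single when_def)
  have k1: "\<exists>k\<in>S. m = k - single n 1" if "m \<in> keys f1" for m
    using that keys_sum[of "\<lambda>m. single (m - single n 1) (lookup f m)" S]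
    by (auto simp: f1_def split: if_splits)
  have "Var n * f1 = (\<Sum>m\<in>S. single m (lookup f m))"
    by (simp add: f1_def sum_distrib_left mult_single m cong: sum.cong)
  also have "f0 + \<dots> = f"
  proof (rule poly_mapping_eqI)
    fix k
    have "lookup (\<Sum>m\<in>S. single m (lookup f m)) k = (\<Sum>m\<in>S. if m = k then lookup f m else 0)"
      by (simp add: lookup_sum lookup_single when_def)
    also have "\<dots> = (if lookup k n \<noteq> 0 then lookup f k else 0)"
      by (subst sum.delta) (auto simp: S_def in_keys_iff)
    finally show "lookup (f0 + (\<Sum>m\<in>S. single m (lookup f m))) k = lookup f k"
      by (simp add: lookup_add f0_def lookup_subst_zero)
  qed
  finally have 1: "f = f0 + Var n * f1" by simp
  have 2: "f0 \<in> polys X"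
    unfolding polys_def mem_Collect_eq
  proof (intro ballI subsetI)
    fix m i assume "m \<in> keys f0" "i \<in> keys m"
    then have "m \<in> keys f" "i \<noteq> n"
      by (auto simp: f0_def in_keys_iff lookup_subst_zero split: if_splits)
    then show "i \<in> X" using assms(1) \<open>i \<in> keys m\<close> by (auto simp: polys_def)
  qed
  have 3: "f1 \<in> polys (insert n X)"
    unfolding polys_def mem_Collect_eq
  proof (intro ballI subsetI)
    fix m i assume "m \<in> keys f1" "i \<in> keys m"
    then obtain k where "k \<in> keys f" "i \<in> keys k"
      using k1[of m] by (auto simp: S_def in_keys_iff lookup_minus)
    then show "i \<in> insert n X" using assms(1) by (auto simp: polys_def)
  qed
  have 4: "lookup m n \<le> N" if "m \<in> keys f1" for m
  proof -
    from k1[OF that] obtain k where "k \<in> keys f" "m = k - single n 1" by (auto simp: S_def)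
    then show ?thesis using assms(3)[of k] by (simp add: lookup_minus)
  qed
  show thesis using that 1 2 3 4 by blast
qed

section \<open>Freely generated algebras of invariants\<close>

abbreviation two :: "nat \<Rightarrow> nat" where "two \<equiv> \<lambda>_. 2"

definition subalg :: "'k::field mpoly set \<Rightarrow> bool" where
  "subalg I \<longleftrightarrow> (\<forall>c. Const c \<in> I) \<and> (\<forall>f\<in>I. \<forall>g\<in>I. f + g \<in> I \<and> f * g \<in> I)"

lemma subalg_Const: "subalg I \<Longrightarrow> Const c \<in> I"
  and subalg_add: "subalg I \<Longrightarrow> f \<in> I \<Longrightarrow> g \<in> I \<Longrightarrow> f + g \<in> I"
  and subalg_mult: "subalg I \<Longrightarrow> f \<in> I \<Longrightarrow> g \<in> I \<Longrightarrow> f * g \<in> I"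
  by (auto simp: subalg_def)

lemma subalg_diff:
  assumes "subalg I" "f \<in> I" "g \<in> I"
  shows "f - g \<in> I"
proof -
  have "f - g = f + Const (- 1) * g"
    by (simp add: single_uminus)
  moreover have "f + Const (- 1) * g \<in> I"
    by (intro subalg_add subalg_mult subalg_Const assms)
  ultimately show ?thesis by (simp only:)
qed

lemma subalg_subst:
  assumes "subalg I" "P \<in> polys X" "\<And>i. i \<in> X \<Longrightarrow> g i \<in> I"
  shows "subst g P \<in> I"
  using assms(2) by (induction rule: polys_induct) (auto intro: assms subalg_Const subalg_add subalg_mult)

text \<open>Generation is asked degree by degree, with a polynomial of matching weight: this is what
  induction on the degree yields, and it carries the grading along. The last clause is algebraic
  independence.\<close>

definition freely_gen :: "nat set \<Rightarrow> (nat \<Rightarrow> nat) \<Rightarrow> (nat \<Rightarrow> 'k mpoly) \<Rightarrow> 'k::field mpoly set \<Rightarrow> bool" where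
  "freely_gen X w g I \<longleftrightarrow> (\<forall>i\<in>X. g i \<in> I \<inter> homog two (w i)) \<and>
     (\<forall>d. \<forall>f\<in>I \<inter> homog two d. \<exists>P\<in>polys X \<inter> homog w d. f = subst g P) \<and>
     (\<forall>P\<in>polys X. subst g P = 0 \<longrightarrow> P = 0)"

lemma freely_genI:
  assumes "\<And>i. i \<in> X \<Longrightarrow> g i \<in> I" "\<And>i. i \<in> X \<Longrightarrow> g i \<in> homog two (w i)"
    and "\<And>d f. f \<in> I \<Longrightarrow> f \<in> homog two d \<Longrightarrow> \<exists>P\<in>polys X \<inter> homog w d. f = subst g P"
    and "\<And>P. P \<in> polys X \<Longrightarrow> subst g P = 0 \<Longrightarrow> P = 0"
  shows "freely_gen X w g I"
  using assms by (auto simp: freely_gen_def)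

text \<open>Only the values on \<open>X\<close> count. This allows weights built by function updates
  to be exchanged for lookups in a list of degrees.\<close>

lemma freely_gen_cong:
  assumes "freely_gen X w g I" "\<And>i. i \<in> X \<Longrightarrow> g' i = g i" "\<And>i. i \<in> X \<Longrightarrow> w' i = w i"
  shows "freely_gen X w' g' I"
proof -
  have "subst g' P = subst g P" if "P \<in> polys X" for P
    using that assms(2) by (rule subst_cong)
  moreover have "P \<in> homog w' d \<longleftrightarrow> P \<in> homog w d" if "P \<in> polys X" for P d
    using that assms(3) by (auto simp: homog_def wt_def polys_def subset_iff cong: sum.cong)
  ultimately show ?thesis
    using assms unfolding freely_gen_def by (metis (no_types, lifting) IntE IntI)
qed

lemma polys_empty: "f \<in> polys {} \<Longrightarrow> f \<in> range Const"
  by (induction rule: polys_induct) (auto simp: mult_single simp flip: single_add)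

lemma freely_gen_empty:
  assumes "I \<subseteq> range Const"
  shows "freely_gen {} w g (I :: 'k::field mpoly set)"
proof (rule freely_genI)
  fix d and f :: "'k mpoly" assume f: "f \<in> I" "f \<in> homog two d"
  then obtain c where c: "f = Const c" using assms by auto
  show "\<exists>P\<in>polys {} \<inter> homog w d. f = subst g P"
    by (rule bexI[of _ f]) (use f(2) in \<open>auto simp: c homog_def\<close>)
next
  fix P :: "'k mpoly" assume P: "P \<in> polys {}" "subst g P = 0"
  then show "P = 0" using polys_empty[OF P(1)] by auto
qed auto

lemma homog_restrict: "f \<in> homog two d \<Longrightarrow> subst (Var(k := 0)) f \<in> homog two d"
  by (rule subst_homog[of f UNIV two]) (auto simp: polys_UNIV)

text \<open>The inductive step shared by all cases. \<open>J\<close> is a ring in which the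
  restrictions lie and which the restricted generators present freely: the constants for GL_1, a
  ring of p-th powers for GL_2 and SL_3, a full ring of invariants for the parabolic groups. Since
  \<open>w n > 0\<close>, the quotient by \<open>g n\<close> has smaller degree.\<close>

theorem freely_gen_insert:
  fixes I :: "'k::field mpoly set"
  assumes I: "subalg I" and n: "n \<notin> X" and pos: "w n > 0" and nz: "g n \<noteq> 0"
    and g: "\<And>i. i \<in> insert n X \<Longrightarrow> g i \<in> I" "\<And>i. i \<in> insert n X \<Longrightarrow> g i \<in> homog two (w i)"
    and G0: "freely_gen X w (\<lambda>i. subst (Var(k := 0)) (g i)) J"
    and res: "\<And>f. f \<in> I \<Longrightarrow> subst (Var(k := 0)) f \<in> J"
    and gn: "subst (Var(k := 0)) (g n) = 0"
    and dv: "\<And>f. f \<in> I \<Longrightarrow> subst (Var(k := 0)) f = 0 \<Longrightarrow> \<exists>f'\<in>I. f = g n * f'"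
  shows "freely_gen (insert n X) w g I"
proof (rule freely_genI)
  let ?r = "subst (Var(k := 0))"
  fix d and f :: "'k mpoly" assume "f \<in> I" "f \<in> homog two d"
  then show "\<exists>P\<in>polys (insert n X) \<inter> homog w d. f = subst g P"
  proof (induction d arbitrary: f rule: less_induct)
    case (less d)
    obtain P where P: "P \<in> polys X" "P \<in> homog w d" "?r f = subst (\<lambda>i. ?r (g i)) P"
      using G0 res[OF less.prems(1)] homog_restrict[OF less.prems(2)] unfolding freely_gen_def by blast
    have P': "P \<in> polys (insert n X)"
      using P(1) polys_mono by blast
    have sP: "subst g P \<in> I" "subst g P \<in> homog two d"
      using subalg_subst[OF I P'] subst_homog[OF P' P(2)] g by auto
    have "?r (f - subst g P) = 0"
      using P(3) by (simp add: subst_subst)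
    then obtain f' where f': "f' \<in> I" "f - subst g P = g n * f'"
      using dv[of "f - subst g P"] subalg_diff[OF I less.prems(1) sP(1)] by blast
    have "g n * f' \<in> homog two d"
      using homog_diff[OF less.prems(2) sP(2)] f'(2) by simp
    then consider "f' = 0" | "w n \<le> d" "f' \<in> homog two (d - w n)"
      using homog_factor[OF g(2)[of n] nz] by blast
    then show ?case
    proof cases
      case 1
      then show ?thesis using f' P P' by auto
    next
      case 2
      then obtain Q where Q: "Q \<in> polys (insert n X)" "Q \<in> homog w (d - w n)" "f' = subst g Q"
        using less.IH[of "d - w n" f'] f'(1) pos by auto
      have "f = subst g (P + Var n * Q)"
        using f'(2) Q(3) by (simp add: algebra_simps)
      moreover have "P + Var n * Q \<in> polys (insert n X)"
        by (intro polys_add polys_mult P' Q(1)) simp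
      moreover have "P + Var n * Q \<in> homog w d"
        using P(2) Q(2) 2(1) by (intro homog_add homog_mult_eq[of _ _ "w n" _ "d - w n"]) auto
      ultimately show ?thesis by blast
    qed
  qed
next
  let ?r = "subst (Var(k := 0))"
  have base: "P = 0" if "P \<in> polys X" "?r (subst g P) = 0" for P
    using G0 that unfolding freely_gen_def by (simp add: subst_subst)
  fix P :: "'k mpoly" assume P: "P \<in> polys (insert n X)" "subst g P = 0"
  have "lookup m n \<le> (\<Sum>m\<in>keys P. lookup m n)" if "m \<in> keys P" for m
    using that by (intro member_le_sum) auto
  then obtain N where "\<And>m. m \<in> keys P \<Longrightarrow> lookup m n \<le> N" by blast
  then show "P = 0" using P
  proof (induction N arbitrary: P)
    case 0
    then have "P \<in> polys X"
      unfolding polys_def by (auto simp: in_keys_iff)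
    then show ?case using base[of P] 0 by simp
  next
    case (Suc N)
    obtain P0 P1 where s: "P = P0 + Var n * P1" "P0 \<in> polys X" "P1 \<in> polys (insert n X)"
      "\<And>m. m \<in> keys P1 \<Longrightarrow> lookup m n \<le> N"
      using split_variable[OF Suc.prems(2) n Suc.prems(1)] by blast
    \<comment> \<open>The restriction of \<open>g n\<close> is 0, so only the part of the relation
      without the generator \<open>n\<close> survives. Once that part is known to vanish,
      \<open>g n\<close> can be cancelled from the rest.\<close>
    have "?r (subst g P) = ?r (subst g P0)"
      by (simp add: s(1) gn)
    then have "P0 = 0" using base[OF s(2)] Suc.prems(3) by simp
    then have "subst g P1 = 0" using Suc.prems(3) nz by (simp add: s(1))
    then have "P1 = 0" using Suc.IH s by blast
    then show ?case using s(1) \<open>P0 = 0\<close> by simp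
  qed
qed (use g in auto)

section \<open>The Frobenius endomorphism\<close>

lemma CHAR_mpoly: "CHAR('p::prime_card mod_ring mpoly) = CARD('p)"
proof (rule CHAR_eqI)
  have eq: "of_nat n = (0 :: 'p mod_ring mpoly) \<longleftrightarrow> of_nat n = (0 :: 'p mod_ring)" for n
  proof -
    have "of_nat n = (Const (of_nat n) :: 'p mod_ring mpoly)" by simp
    moreover have "Const c = 0 \<longleftrightarrow> c = 0" for c :: "'p mod_ring"
      by (metis lookup_single_eq lookup_zero single_zero)
    ultimately show ?thesis by (simp only:)
  qed
  show "of_nat CARD('p) = (0 :: 'p mod_ring mpoly)"
    by (subst eq) (rule of_nat_card_eq_0)
  show "CARD('p) dvd n" if "of_nat n = (0 :: 'p mod_ring mpoly)" for n
    using that unfolding eq by (rule of_nat_0_mod_ring_dvd)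
qed

lemma frobenius_add: "(f + g) ^ CARD('p) = f ^ CARD('p) + (g :: 'p::prime_card mod_ring mpoly) ^ CARD('p)"
  by (rule freshmans_dream) (simp_all add: CHAR_mpoly prime_card)

lemma frobenius_sum: "(sum f A) ^ CARD('p) = (\<Sum>x\<in>A. f x ^ CARD('p))"
  for f :: "'a \<Rightarrow> 'p::prime_card mod_ring mpoly"
  by (rule freshmans_dream_sum) (simp_all add: CHAR_mpoly prime_card)

lemma frobenius_minus: "(- f) ^ CARD('p) = - (f ^ CARD('p))"
  for f :: "'p::prime_card mod_ring mpoly"
  using frobenius_add[of "- f" f] by (simp add: eq_neg_iff_add_eq_0 power_0_left)

lemma frobenius_diff: "(f - g) ^ CARD('p) = f ^ CARD('p) - g ^ CARD('p)"
  for f :: "'p::prime_card mod_ring mpoly"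
  using frobenius_add[of f "- g"] by (simp add: frobenius_minus)

lemma frobenius_scalar: "c ^ CARD('p) = (c :: 'p::prime_card mod_ring)"
  using finite_field_power_card_eq_same[of c] by simp

lemma Const_power: "Const c ^ n = Const (c ^ n :: 'k::field)"
  by (induction n) (auto simp: mult_single)

lemma frobenius_Const: "Const c ^ CARD('p) = Const (c :: 'p::prime_card mod_ring)"
  by (simp add: Const_power frobenius_scalar)

text \<open>The coefficients lie in the prime field and are fixed by the Frobenius, so it commutes
  with evaluating \<open>P\<close>.\<close>

lemma frobenius_subst: "subst (\<lambda>i. g i ^ CARD('p)) P = subst g P ^ CARD('p)"
  for P :: "'p::prime_card mod_ring mpoly"
  by (induction P rule: mpoly_induct) (auto simp: frobenius_Const frobenius_add power_mult_distrib)

text \<open>The Frobenius is additive and multiplies degrees by p, so the components of the p-th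
  power are the p-th powers of the components; all but one of these must vanish.\<close>

lemma homog_frobenius:
  fixes h :: "'p::prime_card mod_ring mpoly"
  assumes "h ^ CARD('p) \<in> homog w d" "h \<noteq> 0"
  obtains e where "d = CARD('p) * e" "h \<in> homog w e"
proof -
  let ?p = "CARD('p)"
  have p: "?p > 0" by simp
  have "hcomp w (?p * e) (h ^ ?p) = hcomp w e h ^ ?p" for e
  proof -
    have "hcomp w (?p * e) (h ^ ?p) = hcomp w (?p * e) ((\<Sum>i\<in>wt w ` keys h. hcomp w i h) ^ ?p)"
      by (simp add: sum_hcomp)
    also have "\<dots> = (\<Sum>i\<in>wt w ` keys h. if i = e then hcomp w e h ^ ?p else 0)"
      unfolding frobenius_sum hcomp_sum
      by (intro sum.cong refl) (use p in \<open>auto simp: hcomp_of_homog[OF homog_power[OF hcomp_homog]]\<close>)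
    also have "\<dots> = hcomp w e h ^ ?p"
    proof (cases "e \<in> wt w ` keys h")
      case False
      then have "hcomp w e h = 0" by (auto simp: hcomp_def intro!: sum.neutral)
      then show ?thesis using False p by (simp add: power_0_left)
    qed simp
    finally show ?thesis .
  qed
  then have *: "hcomp w e h = 0" if "d \<noteq> ?p * e" for e
    using that hcomp_of_homog[OF assms(1), of "?p * e"] by simp
  obtain e where e: "d = ?p * e"
    using * assms(2) sum_hcomp[of w h] by (metis sum.neutral)
  have "h = hcomp w e h"
  proof -
    have "(\<Sum>i\<in>wt w ` keys h. hcomp w i h) \<in> homog w e"
      using * e p by (intro homog_sum) (metis hcomp_homog homog_zero mult_cancel1 not_gr0)
    then show ?thesis using sum_hcomp[of w h] hcomp_of_homog[of h w e e] by simp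
  qed
  then have "h \<in> homog w e" by (metis hcomp_homog)
  with e that show ?thesis by blast
qed

text \<open>The Frobenius is an injective algebra endomorphism, so it transports a presentation to
  its image with all degrees multiplied by p.\<close>

theorem freely_gen_frobenius:
  fixes I :: "'p::prime_card mod_ring mpoly set"
  assumes G: "freely_gen X w g I"
  shows "freely_gen X (\<lambda>i. CARD('p) * w i) (\<lambda>i. g i ^ CARD('p)) ((\<lambda>h. h ^ CARD('p)) ` I)"
proof (rule freely_genI)
  let ?p = "CARD('p)"
  fix d and f :: "'p mod_ring mpoly" assume f: "f \<in> (\<lambda>h. h ^ ?p) ` I" "f \<in> homog two d"
  then obtain h where h: "h \<in> I" "f = h ^ ?p" by blast
  show "\<exists>P\<in>polys X \<inter> homog (\<lambda>i. ?p * w i) d. f = subst (\<lambda>i. g i ^ ?p) P"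
  proof (cases "h = 0")
    case True
    then show ?thesis using h by (intro bexI[of _ 0]) (auto simp: power_0_left)
  next
    case False
    then obtain e where e: "d = ?p * e" "h \<in> homog two e"
      using homog_frobenius f(2) h(2) by blast
    then obtain P where P: "P \<in> polys X" "P \<in> homog w e" "h = subst g P"
      using G h(1) unfolding freely_gen_def by blast
    have "wt (\<lambda>i. ?p * w i) m = ?p * wt w m" for m
      by (simp add: wt_def sum_distrib_left mult_ac)
    then have "P \<in> homog (\<lambda>i. ?p * w i) d"
      using P(2) e(1) by (auto simp: homog_def)
    then show ?thesis
      using P h(2) by (intro bexI[of _ P]) (auto simp: frobenius_subst)
  qed
qed (use G in \<open>auto simp: freely_gen_def frobenius_subst intro: homog_power\<close>)

section \<open>Rings of invariants\<close>

definition invars :: "nat set \<Rightarrow> (nat \<Rightarrow> 'k mpoly) set \<Rightarrow> 'k::field mpoly set" where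
  "invars Y S = {f \<in> polys Y. \<forall>s\<in>S. subst s f = f}"

lemma subalg_invars: "subalg (invars Y S)"
  by (auto simp: subalg_def invars_def)

lemma invars_quotient:
  assumes "L * f \<in> invars Y S" "L \<in> invars Y S" "L \<noteq> 0"
  shows "f \<in> invars Y S"
proof -
  have "subst s f = f" if "s \<in> S" for s
  proof -
    have "L * subst s f = subst s L * subst s f"
      using assms(2) that by (simp add: invars_def)
    also have "\<dots> = L * f"
      using assms(1) that by (simp add: invars_def flip: subst_mult)
    finally show ?thesis using assms(3) by simp
  qed
  then show ?thesis
    using assms polys_quotient[of "L * f" Y L f] by (auto simp: invars_def)
qed

text \<open>Linear substitutions preserve the degree, so each component of an invariant is
  invariant. This is how statements on homogeneous invariants extend to all invariants.\<close>

lemma invars_hcomp: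
  assumes "f \<in> invars Y S" "\<And>s i. s \<in> S \<Longrightarrow> i \<in> Y \<Longrightarrow> s i \<in> homog two 2"
  shows "hcomp two d f \<in> invars Y S"
proof -
  have "subst s (hcomp two d f) = hcomp two d f" if "s \<in> S" for s
    using hcomp_subst[of f Y s two two d] assms that by (auto simp: invars_def)
  then show ?thesis using assms(1) by (auto simp: invars_def hcomp_polys)
qed

text \<open>The isomorphism is the inverse of evaluation at the generators. Independence makes
  evaluation injective; surjectivity follows by adding up the representations of the homogeneous
  components.\<close>

theorem freely_gen_iso:
  fixes I :: "'k::field mpoly set"
  assumes G: "freely_gen {..<length ds} ((!) ds) g I" and I: "subalg I"
    and gr: "\<And>d f. f \<in> I \<Longrightarrow> hcomp two d f \<in> I"
    and R: "total R = I" "\<And>d. component R d = I \<inter> homog two d"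
  shows "R \<cong>\<^sub>g\<^sub>r poly_alg ds"
proof -
  let ?X = "{..<length ds}"
  have S: "total (poly_alg ds :: 'k mpoly graded_alg) = polys ?X"
    by (auto simp: poly_alg_def polys_def)
  have Sd: "component (poly_alg ds :: 'k mpoly graded_alg) d = polys ?X \<inter> homog ((!) ds) d" for d
    by (auto simp: poly_alg_def polys_def homog_def wt_def)
  have in_I: "subst g P \<in> I" if "P \<in> polys ?X" for P
    using G by (intro subalg_subst[OF I that]) (auto simp: freely_gen_def)
  have inj: "inj_on (subst g) (polys ?X)"
  proof (rule inj_onI)
    fix P Q :: "'k mpoly" assume "P \<in> polys ?X" "Q \<in> polys ?X" "subst g P = subst g Q"
    then have "P - Q \<in> polys ?X" "subst g (P - Q) = 0" by auto
    then have "P - Q = 0" using G unfolding freely_gen_def by blast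
    then show "P = Q" by simp
  qed
  have surj: "\<exists>P\<in>polys ?X. f = subst g P" if "f \<in> I" for f
  proof -
    have "\<exists>P\<in>polys ?X. hcomp two d f = subst g P" for d
      using G gr[OF that, of d] unfolding freely_gen_def by (meson IntE IntI hcomp_homog)
    then obtain P where P: "\<And>d. P d \<in> polys ?X" "\<And>d. hcomp two d f = subst g (P d)" by metis
    have "f = subst g (\<Sum>d\<in>wt two ` keys f. P d)"
      using sum_hcomp[of two f] by (simp add: P(2))
    then show ?thesis using P(1) by blast
  qed
  have bij: "bij_betw (subst g) (polys ?X) I"
    using inj in_I surj by (auto simp: bij_betw_def)
  define \<phi> where "\<phi> = the_inv_into (polys ?X) (subst g)"
  have \<phi>: "\<phi> (subst g P) = P" if "P \<in> polys ?X" for P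
    unfolding \<phi>_def using inj that by (rule the_inv_into_f_f)
  show ?thesis unfolding graded_alg_isomorphic_def
  proof (intro exI[of _ \<phi>] conjI ballI allI)
    show "bij_betw \<phi> (total R) (total (poly_alg ds))"
      unfolding S R \<phi>_def using bij by (rule bij_betw_the_inv_into)
    show "\<phi> 1 = 1" using \<phi>[of 1] by simp
    fix x y assume "x \<in> total R" "y \<in> total R"
    then obtain P Q where "P \<in> polys ?X" "Q \<in> polys ?X" "x = subst g P" "y = subst g Q"
      using surj R by metis
    then show "\<phi> (x + y) = \<phi> x + \<phi> y" "\<phi> (x * y) = \<phi> x * \<phi> y"
      using \<phi>[of P] \<phi>[of Q] \<phi>[of "P + Q"] \<phi>[of "P * Q"] by auto
  next
    fix c x assume "x \<in> total R"
    then obtain P where "P \<in> polys ?X" "x = subst g P"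
      using surj R by metis
    then show "\<phi> (Const c * x) = Const c * \<phi> x"
      using \<phi>[of P] \<phi>[of "Const c * P"] by auto
  next
    fix d
    have 1: "\<exists>P\<in>polys ?X \<inter> homog ((!) ds) d. f = subst g P" if "f \<in> I \<inter> homog two d" for f
      using G that unfolding freely_gen_def by blast
    have 2: "subst g P \<in> I \<inter> homog two d" if "P \<in> polys ?X \<inter> homog ((!) ds) d" for P
      using that in_I subst_homog[of P ?X "(!) ds" d g two] G unfolding freely_gen_def by blast
    show "\<phi> ` component R d = component (poly_alg ds) d"
      unfolding R Sd
    proof (intro equalityI subsetI)
      fix Q assume "Q \<in> \<phi> ` (I \<inter> homog two d)"
      then show "Q \<in> polys ?X \<inter> homog ((!) ds) d" using 1 \<phi> by fastforce
    next
      fix Q :: "'k mpoly" assume "Q \<in> polys ?X \<inter> homog ((!) ds) d"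
      then show "Q \<in> \<phi> ` (I \<inter> homog two d)" using 2 \<phi>[of Q] by (metis IntD1 imageI)
    qed
  qed
qed

section \<open>Linear forms, their products, and restriction to a hyperplane\<close>

lemma single_power_exponent:
  "\<exists>M. single m c ^ n = single M (c ^ n :: 'k::field) \<and> (\<forall>i. lookup M i = n * lookup (m :: nat \<Rightarrow>\<^sub>0 nat) i)"
proof (induction n)
  case 0
  show ?case by (rule exI[of _ 0]) simp
next
  case (Suc n)
  then obtain M where "single m c ^ n = single M (c ^ n)" "\<forall>i. lookup M i = n * lookup m i" by blast
  then show ?case by (intro exI[of _ "m + M"]) (simp add: mult_single lookup_add)
qed

text \<open>Divide all exponents by p. The coefficients can be kept, since every element of the
  prime field is its own p-th root.\<close>

lemma frobenius_root:
  fixes f :: "'p::prime_card mod_ring mpoly"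
  assumes "f \<in> polys Y" "\<And>m i. m \<in> keys f \<Longrightarrow> CARD('p) dvd lookup m i"
  obtains h where "h \<in> polys Y" "f = h ^ CARD('p)"
proof -
  let ?p = "CARD('p)"
  have "\<exists>n. \<forall>i. lookup m i = ?p * lookup n i" if "m \<in> keys f" for m
  proof -
    have "lookup m i = ?p * lookup (Poly_Mapping.map (\<lambda>e. e div ?p) m) i" for i
      using assms(2)[OF that, of i] by (simp add: Poly_Mapping.map.rep_eq when_def)
    then show ?thesis by blast
  qed
  then obtain r where r: "\<And>m i. m \<in> keys f \<Longrightarrow> lookup m i = ?p * lookup (r m) i" by metis
  define h where "h = (\<Sum>m\<in>keys f. single (r m) (lookup f m))"
  have "h \<in> polys Y"
    unfolding h_def
  proof (rule polys_sum)
    fix m assume m: "m \<in> keys f"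
    have "keys (r m) \<subseteq> keys m" using r[OF m] by (auto simp: in_keys_iff)
    then show "single (r m) (lookup f m) \<in> polys Y"
      using assms(1) m by (auto simp: polys_def)
  qed
  moreover have "h ^ ?p = f"
  proof -
    have "single (r m) (lookup f m) ^ ?p = single m (lookup f m)" if m: "m \<in> keys f" for m
    proof -
      obtain M where M: "single (r m) (lookup f m) ^ ?p = single M (lookup f m ^ ?p)"
        "\<forall>i. lookup M i = ?p * lookup (r m) i"
        using single_power_exponent by blast
      have "M = m" using M(2) r[OF m] by (intro poly_mapping_eqI) simp
      then show ?thesis using M(1) by (simp add: frobenius_scalar)
    qed
    then show ?thesis
      unfolding h_def frobenius_sum by (simp add: poly_mapping_sum_singles)
  qed
  ultimately show ?thesis using that by blast
qed

text \<open>A first-order expansion; the remainder is a multiple of \<open>z ^ 2\<close> and is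
  invisible when coefficients at exponent 1 are compared.\<close>

lemma binomial_mod_square:
  "\<exists>r. (x + z) ^ Suc a = x ^ Suc a + of_nat (Suc a) * x ^ a * z + z ^ 2 * (r :: 'a::comm_ring_1)"
proof (induction a)
  case 0
  show ?case by (rule exI[of _ 0]) simp
next
  case (Suc a)
  then obtain r where r: "(x + z) ^ Suc a = x ^ Suc a + of_nat (Suc a) * x ^ a * z + z ^ 2 * r" by blast
  have "(x + z) ^ Suc (Suc a) = (x + z) * (x ^ Suc a + of_nat (Suc a) * x ^ a * z + z ^ 2 * r)"
    by (simp only: r power_Suc[of _ "Suc a"])
  also have "\<dots> = x ^ Suc (Suc a) + of_nat (Suc (Suc a)) * x ^ Suc a * z
      + z ^ 2 * (x * r + of_nat (Suc a) * x ^ a + z * r)"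
    by (simp add: algebra_simps power2_eq_square)
  finally show ?case by blast
qed

lemma lookup_Var_mult:
  "lookup (Var k ^ n * r) m = (0 :: 'k::field)" if "lookup m k < n"
proof -
  have "lookup m' k \<ge> n" if "m' \<in> keys (Var k ^ n * r)" for m'
  proof -
    have "keys (Var k ^ n * r) \<subseteq> {a + b |a b. a \<in> keys (Var k ^ n :: 'k mpoly) \<and> b \<in> keys r}"
      by (rule keys_mult)
    from this that have "m' \<in> {a + b |a b. a \<in> keys (Var k ^ n :: 'k mpoly) \<and> b \<in> keys r}"
      by blast
    then obtain b where "m' = single k n + b"
      by (auto simp: Var_power)
    then show ?thesis by (simp add: lookup_add)
  qed
  with that show ?thesis by (metis in_keys_iff not_less)
qed

text \<open>Comparing coefficients at exponent 1 of \<open>Var k\<close> replaces the chain rule for partial derivatives.\<close>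

lemma lookup_shear:
  fixes f :: "'k::field mpoly"
  assumes ik: "i \<noteq> k" and m: "lookup m k = 0" "lookup m i > 0"
  defines "m' \<equiv> m - single i 1 + single k 1"
  shows "lookup (subst (Var(i := Var i + Var k)) f) m' = lookup f m' + of_nat (lookup m i) * lookup f m"
proof -
  let ?t = "(Var(i := Var i + Var k)) :: nat \<Rightarrow> 'k mpoly"
  have m'_eq: "n - single i 1 + single k 1 = m' \<longleftrightarrow> n = m" if "lookup n i > 0" for n :: "nat \<Rightarrow>\<^sub>0 nat"
  proof
    assume "n - single i 1 + single k 1 = m'"
    then have eq: "n - single i 1 = m - single i 1" by (simp add: m'_def)
    show "n = m"
    proof (rule poly_mapping_eqI)
      fix v
      have "lookup (n - single i 1) v = lookup (m - single i 1) v" by (simp only: eq)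
      then show "lookup n v = lookup m v"
        using that m(2) by (cases "v = i") (auto simp: lookup_minus lookup_single when_def)
    qed
  qed (simp add: m'_def)
  have m'k: "lookup m' k = 1" using ik m by (simp add: m'_def lookup_add lookup_minus lookup_single)
  have eval_monom_t: "eval_monom ?t n = (Var i + Var k) ^ lookup n i * single (n - single i (lookup n i)) 1" for n
  proof -
    let ?n = "n - single i (lookup n i)"
    have n: "n = single i (lookup n i) + ?n"
      by (intro poly_mapping_eqI) (auto simp: lookup_add lookup_minus lookup_single when_def)
    have "eval_monom ?t n = eval_monom ?t (single i (lookup n i)) * eval_monom ?t ?n"
      by (subst n) (rule eval_monom_add)
    also have "eval_monom ?t ?n = eval_monom Var ?n"
      by (rule eval_monom_cong) (auto simp: in_keys_iff lookup_minus)
    finally show ?thesis by (simp only: eval_monom_single eval_monom_Var fun_upd_same)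
  qed
  \<comment> \<open>A monomial \<open>n\<close> reaches the exponent \<open>m'\<close> in two ways:
    unchanged, when \<open>n\<close> is \<open>m'\<close>, or by trading one factor
    \<open>Var i\<close> for \<open>Var k\<close>, when \<open>n\<close> is \<open>m\<close>.
    Trading more factors gives exponent at least 2 at \<open>k\<close>.\<close>
  have *: "lookup (eval_monom ?t n) m' = (if n = m' then 1 else 0) + (if n = m then of_nat (lookup m i) else 0)" for n
  proof (cases "lookup n i")
    case 0
    then have "n \<noteq> m" using m(2) by auto
    with 0 show ?thesis by (simp add: eval_monom_t lookup_single when_def)
  next
    case (Suc a)
    let ?n = "n - single i (lookup n i)"
    obtain r where r: "(Var i + Var k :: 'k mpoly) ^ Suc a
        = Var i ^ Suc a + of_nat (Suc a) * Var i ^ a * Var k + Var k ^ 2 * r"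
      using binomial_mod_square by blast
    have n1: "single i (Suc a) + ?n = n"
      using Suc by (intro poly_mapping_eqI) (auto simp: lookup_add lookup_minus lookup_single when_def)
    have n2: "single i a + single k 1 + ?n = n - single i 1 + single k 1"
      using Suc by (intro poly_mapping_eqI) (auto simp: lookup_add lookup_minus lookup_single when_def)
    have "of_nat (Suc a) = (Const (of_nat (Suc a)) :: 'k mpoly)" by (rule single_of_nat[symmetric])
    then have "eval_monom ?t n = single n 1 + single (n - single i 1 + single k 1) (of_nat (Suc a))
        + Var k ^ 2 * (r * single ?n 1)"
      unfolding eval_monom_t Suc r
      by (simp only: distrib_right Var_power mult_single n1 n2[unfolded Suc] add_0 mult_1 mult_1_right mult.assoc)
         (simp add: mult_single n1[unfolded Suc] n2[unfolded Suc] flip: add.assoc)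
    then show ?thesis
      using m'_eq[of n] Suc by (auto simp: lookup_add lookup_single when_def lookup_Var_mult m'k)
  qed
  have "lookup (subst ?t f) m' = (\<Sum>n\<in>keys f. lookup f n * lookup (eval_monom ?t n) m')"
  proof -
    have "lookup (Const c * g) m' = c * lookup g m'" for c and g :: "'k mpoly"
      by (simp add: Poly_Mapping.map.rep_eq when_def flip: mult_map_scale_conv_mult)
    then show ?thesis by (simp add: subst_eval_monom lookup_sum)
  qed
  also have "\<dots> = (\<Sum>n\<in>keys f. (if n = m' then lookup f n else 0) + (if n = m then of_nat (lookup m i) * lookup f n else 0))"
    unfolding * by (intro sum.cong) (auto simp: algebra_simps)
  also have "\<dots> = lookup f m' + of_nat (lookup m i) * lookup f m"
    by (simp add: sum.distrib in_keys_iff)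
  finally show ?thesis .
qed

text \<open>By \<open>lookup_shear\<close>, invariance makes exponent times coefficient vanish for
  every monomial free of \<open>Var k\<close>. Hence p divides all exponents of the restriction, and
  \<open>frobenius_root\<close> applies.\<close>

lemma restriction_is_frobenius:
  fixes f :: "'p::prime_card mod_ring mpoly"
  assumes f: "f \<in> polys (insert k Y)" and k: "k \<notin> Y"
    and inv: "\<And>i. i \<in> Y \<Longrightarrow> subst (Var(i := Var i + Var k)) f = f"
  obtains h where "h \<in> polys Y" "subst (Var(k := 0)) f = h ^ CARD('p)"
proof (rule frobenius_root[of "subst (Var(k := 0)) f" Y])
  show 1: "subst (Var(k := 0)) f \<in> polys Y"
    using f by (rule polys_subst) auto
  fix m i assume "m \<in> keys (subst (Var(k := 0)) f)"
  then have m: "lookup m k = 0" "lookup f m \<noteq> 0" "keys m \<subseteq> Y"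
    using 1 by (auto simp: in_keys_iff lookup_subst_zero polys_def split: if_splits)
  show "CARD('p) dvd lookup m i"
  proof (cases "lookup m i = 0")
    case False
    then have "i \<in> Y" using m(3) by (auto simp: in_keys_iff)
    then have "i \<noteq> k" using k by auto
    then have "of_nat (lookup m i) * lookup f m = 0"
      using lookup_shear[of i k m f] inv[OF \<open>i \<in> Y\<close>] m False by simp
    then have "of_nat (lookup m i) = (0 :: 'p mod_ring)" using m(2) by simp
    then show ?thesis by (rule of_nat_0_mod_ring_dvd)
  qed simp
qed (use that in blast)

lemma frobenius_inj: "f ^ CARD('p) = g ^ CARD('p) \<Longrightarrow> f = (g :: 'p::prime_card mod_ring mpoly)"
  using frobenius_diff[of f g] by simp

section \<open>Scaling one variable\<close>

lemma lookup_subst_scale: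
  fixes f :: "'k::field mpoly"
  shows "lookup (subst (Var(n := Const a * Var n)) f) m = a ^ lookup m n * lookup f m"
proof -
  let ?t = "Var(n := Const a * Var n)"
  have *: "eval_monom ?t k = single k (a ^ lookup k n)" for k
  proof -
    have "eval_monom ?t k = (\<Prod>i\<in>insert n (keys k). ?t i ^ lookup k i)" by (rule eval_monom_superset) auto
    also have "\<dots> = (\<Prod>i\<in>insert n (keys k). (if i = n then Const a ^ lookup k n else 1) * Var i ^ lookup k i)"
      by (intro prod.cong) (auto simp: power_mult_distrib)
    also have "\<dots> = Const a ^ lookup k n * eval_monom Var k"
      unfolding prod.distrib eval_monom_superset[of "insert n (keys k)" k Var, OF finite.insertI[OF finite_keys] subset_insertI]
      by simp
    finally show ?thesis by (simp add: Const_power eval_monom_Var mult_single)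
  qed
  have "lookup (subst ?t f) m = (\<Sum>k\<in>keys f. if k = m then a ^ lookup m n * lookup f m else 0)"
    unfolding subst_eval_monom lookup_sum * by (intro sum.cong) (auto simp: mult_single lookup_single when_def)
  then show ?thesis by (simp add: in_keys_iff)
qed

text \<open>A monomial with exponent e at \<open>n\<close> can occur only if all p-1 nonzero scalars
  are roots of X^e - 1. Vanishing of the restriction excludes e = 0, and then the number of roots
  forces e to be at least p-1.\<close>

lemma Var_power_dvd_scaling_invariant:
  fixes f :: "'p::prime_card mod_ring mpoly"
  assumes inv: "\<And>a. a \<noteq> 0 \<Longrightarrow> subst (Var(n := Const a * Var n)) f = f"
    and z: "subst (Var(n := 0)) f = 0"
  shows "Var n ^ (CARD('p) - 1) dvd f"
proof (rule Var_power_dvd)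
  fix m assume m: "m \<in> keys f"
  let ?e = "lookup m n"
  have e: "?e > 0"
  proof (rule ccontr)
    assume "\<not> ?e > 0"
    then have "lookup (subst (Var(n := 0)) f) m = lookup f m" by (simp add: lookup_subst_zero)
    then show False using m z by (simp add: in_keys_iff)
  qed
  have "a ^ ?e = 1" if "a \<noteq> 0" for a :: "'p mod_ring"
    using lookup_subst_scale[of n a f m] inv[OF that] m by (simp add: in_keys_iff)
  then have "UNIV - {0} \<subseteq> {x. poly (Polynomial.monom 1 ?e - 1) x = (0 :: 'p mod_ring)}"
    by (auto simp: poly_monom)
  moreover have nz: "Polynomial.monom 1 ?e - 1 \<noteq> (0 :: 'p mod_ring poly)"
  proof
    assume "Polynomial.monom 1 ?e - 1 = (0 :: 'p mod_ring poly)"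
    then have "poly (Polynomial.monom 1 ?e - 1) 0 = (0 :: 'p mod_ring)" by simp
    then show False using e by (simp add: poly_monom power_0_left)
  qed
  ultimately have "card (UNIV - {0 :: 'p mod_ring}) \<le> card {x. poly (Polynomial.monom 1 ?e - 1) x = (0 :: 'p mod_ring)}"
    by (intro card_mono poly_roots_finite) auto
  also have "\<dots> \<le> Polynomial.degree (Polynomial.monom 1 ?e - 1 :: 'p mod_ring poly)"
    using nz by (rule card_poly_roots_bound)
  also have "\<dots> \<le> ?e"
    by (rule degree_diff_le) (auto simp: degree_monom_le)
  finally show "CARD('p) - 1 \<le> ?e" by (simp add: card_Diff_singleton)
qed

definition lforms :: "nat set \<Rightarrow> 'k::field mpoly set" where
  "lforms Y = polys Y \<inter> homog two 2"

lemma lforms_add: "f \<in> lforms Y \<Longrightarrow> g \<in> lforms Y \<Longrightarrow> f + g \<in> lforms Y"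
  by (auto simp: lforms_def)

lemma lforms_Const_mult: "f \<in> lforms Y \<Longrightarrow> Const c * f \<in> lforms Y"
  by (auto simp: lforms_def intro: homog_Const_mult)

lemma lforms_Var: "i \<in> Y \<Longrightarrow> Var i \<in> lforms Y"
  using homog_Var[of i two] by (auto simp: lforms_def)

lemma lforms_empty: "lforms {} = {0}"
proof -
  have "f = 0" if "f \<in> polys {}" "f \<in> homog two 2" for f :: "'a::field mpoly"
  proof (rule ccontr)
    assume "f \<noteq> 0"
    then obtain m where "m \<in> keys f" by (metis all_not_in_conv keys_eq_empty)
    moreover from this have "m = 0" using that(1) by (auto simp: polys_def)
    ultimately show False using that(2) by (auto simp: homog_def)
  qed
  then show ?thesis by (auto simp: lforms_def)
qed

text \<open>Splitting off the coefficient of one variable; it yields the number of linear forms and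
  lets products over them be computed one variable at a time.\<close>

lemma lforms_insert:
  assumes "j \<notin> Y"
  shows "bij_betw (\<lambda>(b, h). Const b * Var j + h) (UNIV \<times> lforms Y) (lforms (insert j Y) :: 'k::field mpoly set)"
proof (rule bij_betw_imageI)
  have res: "subst (Var(j := 0)) (Const b * Var j + h) = h" if "h \<in> lforms Y" for b and h :: "'k mpoly"
  proof -
    have "subst (Var(j := 0)) h = h"
      by (rule subst_id_on[of _ Y]) (use that assms in \<open>auto simp: lforms_def\<close>)
    then show ?thesis by simp
  qed
  show "inj_on (\<lambda>(b, h). Const b * Var j + h) (UNIV \<times> lforms Y :: ('k \<times> 'k mpoly) set)"
  proof (rule inj_onI, clarify)
    fix b b' :: 'k and h h' assume h: "h \<in> lforms Y" "h' \<in> lforms Y" and eq: "Const b * Var j + h = Const b' * Var j + h'"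
    have "h = h'" using res[OF h(1), of b] res[OF h(2), of b'] eq by simp
    then have "(single (single j 1) b :: 'k mpoly) = single (single j 1) b'" using eq by (simp add: mult_single)
    then show "b = b' \<and> h = h'" using \<open>h = h'\<close> by (metis lookup_single_eq)
  qed
  show "(\<lambda>(b, h). Const b * Var j + h) ` (UNIV \<times> lforms Y) = (lforms (insert j Y) :: 'k mpoly set)"
  proof (intro equalityI subsetI)
    fix f assume "f \<in> (\<lambda>(b, h). Const b * Var j + h) ` (UNIV \<times> lforms Y :: ('k \<times> 'k mpoly) set)"
    then show "f \<in> lforms (insert j Y)"
      by (auto intro!: lforms_add lforms_Const_mult lforms_Var) (auto simp: lforms_def intro: polys_mono)
  next
    fix f :: "'k mpoly" assume f: "f \<in> lforms (insert j Y)"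
    define h where "h = subst (Var(j := 0)) f"
    have h: "h \<in> lforms Y"
      unfolding h_def lforms_def using f
      by (auto simp: lforms_def intro: homog_restrict intro!: polys_subst[of f "insert j Y"])
    have "Var j dvd f - h" using dvd_diff_subst[of j 0 f] by (simp add: h_def)
    then obtain g where g: "f - h = Var j * g" by (elim dvdE)
    have "Var j * g \<in> homog two 2" using g f h by (auto simp: lforms_def simp flip: g)
    moreover have "(Var j :: 'k mpoly) \<noteq> 0" using linear_neq_zero[of 0 j] by simp
    ultimately have "g \<in> homog two 0" using homog_factor[of "Var j" two 2 g 2] homog_Var[of j two] by auto
    then have "m = 0" if "m \<in> keys g" for m
      using that by (auto simp: homog_def wt_def intro!: poly_mapping_eqI) (metis in_keys_iff)
    then have "g = Const (lookup g 0)"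
      by (intro poly_mapping_eqI) (auto simp: lookup_single when_def in_keys_iff)
    then have "f = Const (lookup g 0) * Var j + h" using g by (simp add: algebra_simps)
    then show "f \<in> (\<lambda>(b, h). Const b * Var j + h) ` (UNIV \<times> lforms Y)" using h by force
  qed
qed

lemma lforms_finite_card:
  "finite Y \<Longrightarrow> finite (lforms Y :: 'k::{field,finite} mpoly set) \<and> card (lforms Y :: 'k mpoly set) = CARD('k) ^ card Y"
proof (induction Y rule: finite_induct)
  case empty
  then show ?case by (simp add: lforms_empty)
next
  case (insert j Y)
  then show ?case
    using bij_betw_finite[OF lforms_insert[OF insert(2)]] bij_betw_same_card[OF lforms_insert[OF insert(2)]]
    by (metis card_cartesian_product card_insert_disjoint finite finite_cartesian_product power_Suc)
qed

lemma prod_lforms_insert: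
  assumes "j \<notin> Y"
  shows "(\<Prod>h\<in>lforms (insert j Y). \<phi> h) = (\<Prod>b\<in>UNIV. \<Prod>h\<in>lforms Y. \<phi> (Const (b::'k::{field,finite}) * Var j + h))"
  unfolding prod.cartesian_product
  by (subst prod.reindex_bij_betw[OF lforms_insert[OF assms], symmetric]) (simp add: case_prod_unfold)

text \<open>The orbit product of the variable \<open>k\<close> under all substitutions adding a
  linear form in \<open>Y\<close> to it. The form 0 is included, so \<open>Var k\<close> is one of
  the factors.\<close>

definition orb :: "nat \<Rightarrow> nat set \<Rightarrow> 'k::{field,finite} mpoly" where
  "orb k Y = (\<Prod>h\<in>lforms Y. Var k + h)"

lemma lforms_free: "h \<in> lforms Y \<Longrightarrow> k \<notin> Y \<Longrightarrow> h \<in> polys (- {k})"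
  by (auto simp: lforms_def intro: polys_mono[of Y])

lemma orb_neq_zero: "k \<notin> Y \<Longrightarrow> finite Y \<Longrightarrow> orb k Y \<noteq> 0"
  unfolding orb_def by (subst prod_zero_iff) (use lforms_finite_card linear_neq_zero[OF lforms_free] in blast)+

text \<open>Invariance carries the divisor \<open>Var k ^ e\<close> to every translate of
  \<open>Var k\<close>. The translates are primes, none dividing another and none dividing
  \<open>A\<close>. The factor \<open>A\<close> allows products over several variables to be
  assembled step by step.\<close>

lemma orb_power_dvd:
  fixes f :: "'k::{field,finite} mpoly"
  assumes Y: "k \<notin> Y" "finite Y" and A: "A \<in> polys Y" "A \<noteq> 0" "A ^ e dvd f"
    and k: "Var k ^ e dvd f" and inv: "\<And>h. h \<in> lforms Y \<Longrightarrow> subst (Var(k := Var k + h)) f = f"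
  shows "(A * orb k Y) ^ e dvd f"
proof -
  obtain g where g: "f = A ^ e * g" using A(3) by (elim dvdE)
  have "(\<Prod>h\<in>lforms Y. Var k + h) ^ e dvd g"
  proof (rule prod_prime_power_dvd)
    show "finite (lforms Y :: 'k mpoly set)" using Y lforms_finite_card by blast
    fix h :: "'k mpoly" assume h: "h \<in> lforms Y"
    note free = lforms_free[OF h Y(1)]
    show pr: "prime_elem (Var k + h)" by (rule prime_elem_linear[OF free])
    have "subst (Var(k := - h)) A = A" by (rule subst_id_on[OF A(1)]) (use Y in auto)
    then have "\<not> Var k + h dvd A" using A(2) by (simp add: linear_dvd_iff[OF free])
    then have nd: "\<not> Var k + h dvd A ^ e" using prime_elem_dvd_power[OF pr] by blast
    obtain c where c: "f = Var k ^ e * c" using k by (elim dvdE)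
    have "f = (Var k + h) ^ e * subst (Var(k := Var k + h)) c"
      using inv[OF h] by (simp add: c)
    then have "(Var k + h) ^ e dvd A ^ e * g" unfolding g by (metis dvd_triv_left)
    then show "(Var k + h) ^ e dvd g"
      by (rule prime_elem_power_dvd_mult[OF pr nd])
  next
    fix h h' :: "'k mpoly" assume h: "h \<in> lforms Y" "h' \<in> lforms Y" "h \<noteq> h'"
    have "subst (Var(k := - h)) h' = h'"
      by (rule subst_id_on[of _ Y]) (use Y h in \<open>auto simp: lforms_def\<close>)
    then show "\<not> Var k + h dvd Var k + h'"
      using h(3) by (simp add: linear_dvd_iff[OF lforms_free[OF h(1) Y(1)]])
  qed
  then show ?thesis unfolding g orb_def power_mult_distrib by (rule mult_dvd_mono[OF dvd_refl])
qed

text \<open>The substitution permutes the factors up to the scalar \<open>e\<close>; its left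
  inverse \<open>t\<close> makes the induced map on linear forms injective, hence bijective by
  finiteness. The number of factors is a power of p, so the scalars multiply to \<open>e\<close>
  itself.\<close>

lemma subst_orb:
  fixes s :: "nat \<Rightarrow> 'p::prime_card mod_ring mpoly"
  assumes Y: "finite Y" and e: "e \<noteq> 0" and h0: "h0 \<in> lforms Y" and sk: "s k = Const e * Var k + h0"
    and sY: "\<And>i. i \<in> Y \<Longrightarrow> s i \<in> lforms Y" and inv: "\<And>i. i \<in> Y \<Longrightarrow> subst t (s i) = Var i"
  shows "subst s (orb k Y) = Const e * orb k Y"
proof -
  have fin: "finite (lforms Y :: 'p mod_ring mpoly set)" and
    card: "card (lforms Y :: 'p mod_ring mpoly set) = CARD('p) ^ card Y"
    using lforms_finite_card[OF Y, where 'k = "'p mod_ring"] by auto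
  let ?\<pi> = "\<lambda>h. Const (inverse e) * (h0 + subst s h)"
  have sl: "subst s h \<in> lforms Y" if "h \<in> lforms Y" for h
    using that sY by (auto simp: lforms_def intro!: polys_subst[of h Y] subst_homog[of h Y two])
  have inj: "inj_on ?\<pi> (lforms Y)"
  proof (rule inj_onI)
    fix h h' assume h: "h \<in> lforms Y" "h' \<in> lforms Y" and eq: "?\<pi> h = ?\<pi> h'"
    have "Const e * ?\<pi> h = Const e * ?\<pi> h'" by (simp only: eq)
    then have "h0 + subst s h = h0 + subst s h'" using e by (simp add: mult_single flip: mult.assoc)
    then have "subst t (subst s h) = subst t (subst s h')" by simp
    moreover have "subst t (subst s g) = g" if "g \<in> lforms Y" for g
      unfolding subst_subst by (rule subst_id_on[of _ Y]) (use that inv in \<open>auto simp: lforms_def\<close>)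
    ultimately show "h = h'" using h by simp
  qed
  have "?\<pi> ` lforms Y = lforms Y"
    using inj fin sl h0 by (intro endo_inj_surj) (auto intro!: lforms_Const_mult lforms_add)
  then have bij: "bij_betw ?\<pi> (lforms Y) (lforms Y)" using inj by (simp add: bij_betw_def)
  have "subst s (orb k Y) = (\<Prod>h\<in>lforms Y. Const e * (Var k + ?\<pi> h))"
    unfolding orb_def subst_prod using e
    by (intro prod.cong) (auto simp: sk distrib_left mult_single simp flip: mult.assoc)
  also have "\<dots> = Const e ^ (CARD('p) ^ card Y) * (\<Prod>h\<in>lforms Y. Var k + ?\<pi> h)"
    by (simp add: prod.distrib card)
  also have "(\<Prod>h\<in>lforms Y. Var k + ?\<pi> h) = orb k Y"
    unfolding orb_def by (rule prod.reindex_bij_betw[OF bij])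
  also have "Const e ^ (CARD('p) ^ n) = Const e" for n
    by (induction n) (simp_all add: power_mult frobenius_Const mult.commute)
  finally show ?thesis .
qed

lemma orb_polys: "orb k Y \<in> polys (insert k Y)"
  unfolding orb_def by (intro polys_prod polys_add) (auto simp: lforms_def intro: polys_mono[of Y])

lemma orb_homog:
  assumes "finite Y"
  shows "(orb k Y :: 'k::{field,finite} mpoly) \<in> homog two (2 * CARD('k) ^ card Y)"
proof -
  have "(orb k Y :: 'k mpoly) \<in> homog two (\<Sum>h\<in>(lforms Y :: 'k mpoly set). 2)"
    unfolding orb_def using homog_Var[of k two] by (intro homog_prod homog_add) (auto simp: lforms_def)
  then show ?thesis using lforms_finite_card[OF assms, where 'k = 'k] by (simp add: mult.commute)
qed

lemma orb_restrict:
  assumes "finite Y"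
  shows "subst (Var(k := 0)) (orb k Y) = (0 :: 'k::{field,finite} mpoly)"
proof -
  have "0 \<in> (lforms Y :: 'k mpoly set)" by (simp add: lforms_def)
  then show ?thesis unfolding orb_def using lforms_finite_card[OF assms, where 'k = 'k]
    by (auto intro!: prod_zero bexI[of _ 0])
qed

section \<open>Dickson invariants\<close>

lemma card_gt_1: "CARD('p::prime_card) > 1"
  using prime_card[where 'a = 'p] prime_gt_1_nat by blast

lemma mult_power_pred: "x * x ^ (CARD('p::prime_card) - 1) = (x :: 'a::comm_monoid_mult) ^ CARD('p)"
  using power_minus_mult[of "CARD('p)" x] by (simp add: mult.commute)

lemma scalar_power_pred: "c \<noteq> 0 \<Longrightarrow> c ^ (CARD('p) - 1) = (1 :: 'p::prime_card mod_ring)"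
  using mult_power_pred[of c, where 'p = 'p] by (simp add: frobenius_scalar)

lemma zero_power_pred: "(0 :: 'a::semiring_1) ^ (CARD('p::prime_card) - 1) = 0"
  using card_gt_1[where 'p = 'p] by (simp add: power_0_left)

lemma Const_mult: "Const (a * b) = Const a * Const (b :: 'k::field)"
  by (simp add: mult_single)

text \<open>As polynomials in \<open>X\<close> both sides are monic of degree p and vanish at the
  multiples of \<open>Z\<close> by scalars. For nonzero \<open>Z\<close> these are p distinct
  points; for \<open>Z = 0\<close> both sides are the p-th power of \<open>X\<close>.\<close>

lemma prod_translates:
  fixes X Z :: "'p::prime_card mod_ring mpoly"
  shows "(\<Prod>b\<in>UNIV. X + Const b * Z) = X ^ CARD('p) - Z ^ (CARD('p) - 1) * X"
proof (cases "Z = 0")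
  case True
  then show ?thesis by (simp add: zero_power_pred)
next
  case False
  let ?p = "CARD('p)"
  let ?P = "\<Prod>b\<in>UNIV. [:Const b * Z, 1:]"
  let ?Q = "Polynomial.monom 1 ?p - Polynomial.monom (Z ^ (?p - 1)) 1"
  have deg: "Polynomial.degree ?P = ?p"
    by (subst degree_prod_eq_sum_degree) auto
  have "?P = ?Q"
  proof (rule poly_eqI_degree_lead_coeff)
    have "lead_coeff ?P = 1" by (simp add: lead_coeff_prod)
    then show "poly.coeff ?P ?p = poly.coeff ?Q ?p"
      using deg card_gt_1[where 'p = 'p] by simp
    have "inj (\<lambda>b. - (Const b * Z))"
      using False by (auto simp: inj_def) (metis lookup_single_eq)
    then show "?p \<le> card (range (\<lambda>b. - (Const b * Z)))"
      by (simp add: card_image)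
    show "Polynomial.degree ?P \<le> ?p" using deg by simp
    show "Polynomial.degree ?Q \<le> ?p"
      using card_gt_1[where 'p = 'p]
      by (intro degree_diff_le degree_monom_le[THEN order_trans]) auto
    fix v assume "v \<in> range (\<lambda>b. - (Const b * Z))"
    then obtain b where b: "v = - (Const b * Z)" by blast
    have "poly ?P v = 0" unfolding poly_prod by (intro prod_zero bexI[of _ b]) (auto simp: b)
    moreover have "poly ?Q v = 0"
      by (simp add: poly_monom b frobenius_minus power_mult_distrib frobenius_Const algebra_simps
          flip: mult_power_pred[of Z, where 'p = 'p])
    ultimately show "poly ?P v = poly ?Q v" by simp
  qed
  then have "poly ?P X = poly ?Q X" by (simp only:)
  then show ?thesis by (simp add: poly_prod poly_monom add.commute)
qed

text \<open>
  \<open>V1 x X\<close> and \<open>V2 x y X\<close> are the products of $X + h$ over the linear forms $h$ in $x$, respectively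
  in $x, y$.  As polynomials in $X$ they are additive, and up to sign the Dickson invariants are the
  coefficients of $X^{p^j}$; this gives the recursive formulas below, from which the restriction to
  the hyperplane of the last variable can be read off.
\<close>

definition V1 :: "'p mod_ring mpoly \<Rightarrow> 'p mod_ring mpoly \<Rightarrow> 'p::prime_card mod_ring mpoly" where
  "V1 x X = X ^ CARD('p) - x ^ (CARD('p) - 1) * X"

definition V2 :: "'p mod_ring mpoly \<Rightarrow> 'p mod_ring mpoly \<Rightarrow> 'p mod_ring mpoly \<Rightarrow> 'p::prime_card mod_ring mpoly" where
  "V2 x y X = V1 x X ^ CARD('p) - V1 x y ^ (CARD('p) - 1) * V1 x X"

definition dickson20 :: "'p mod_ring mpoly \<Rightarrow> 'p mod_ring mpoly \<Rightarrow> 'p::prime_card mod_ring mpoly" where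
  "dickson20 x y = (x * V1 x y) ^ (CARD('p) - 1)"

definition dickson21 :: "'p mod_ring mpoly \<Rightarrow> 'p mod_ring mpoly \<Rightarrow> 'p::prime_card mod_ring mpoly" where
  "dickson21 x y = (x ^ (CARD('p) - 1)) ^ CARD('p) + V1 x y ^ (CARD('p) - 1)"

text \<open>The Moore determinant in factored form. Its (p-1)-st power is the top Dickson invariant,
  the coefficient \<open>c\<close> in \<open>frobenius3_relation\<close>.\<close>

definition moore3 :: "'p mod_ring mpoly \<Rightarrow> 'p mod_ring mpoly \<Rightarrow> 'p mod_ring mpoly \<Rightarrow> 'p::prime_card mod_ring mpoly" where
  "moore3 x y z = x * V1 x y * V2 x y z"

definition dickson31 :: "'p mod_ring mpoly \<Rightarrow> 'p mod_ring mpoly \<Rightarrow> 'p mod_ring mpoly \<Rightarrow> 'p::prime_card mod_ring mpoly" where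
  "dickson31 x y z = dickson20 x y ^ CARD('p) + V2 x y z ^ (CARD('p) - 1) * dickson21 x y"

definition dickson32 :: "'p mod_ring mpoly \<Rightarrow> 'p mod_ring mpoly \<Rightarrow> 'p mod_ring mpoly \<Rightarrow> 'p::prime_card mod_ring mpoly" where
  "dickson32 x y z = dickson21 x y ^ CARD('p) + V2 x y z ^ (CARD('p) - 1)"

lemmas dickson_defs = V1_def V2_def dickson20_def dickson21_def moore3_def dickson31_def dickson32_def

section \<open>Roots of the additive polynomials and Moore determinants\<close>

lemma V1_self: "V1 x x = 0"
  by (simp add: V1_def mult.commute[of _ x] mult_power_pred)

lemma V2_first: "V2 x y x = 0"
  by (simp add: V2_def V1_self power_0_left)

lemma V2_second: "V2 x y y = 0"
  by (simp add: V2_def mult.commute[of _ "V1 x y"] mult_power_pred)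

lemma V2_expand:
  fixes x :: "'p::prime_card mod_ring mpoly"
  shows "V2 x y X = (X ^ CARD('p)) ^ CARD('p) - dickson21 x y * X ^ CARD('p) + dickson20 x y * X"
proof -
  have *: "V1 x X ^ CARD('p) = (X ^ CARD('p)) ^ CARD('p) - (x ^ (CARD('p) - 1)) ^ CARD('p) * X ^ CARD('p)"
    by (simp only: V1_def frobenius_diff power_mult_distrib)
  show ?thesis
    unfolding V2_def * unfolding dickson21_def dickson20_def power_mult_distrib V1_def[of x X]
    by (simp only: algebra_simps)
qed

lemma moore2:
  fixes x :: "'p::prime_card mod_ring mpoly"
  shows "x * V1 x y = x * y ^ CARD('p) - x ^ CARD('p) * y"
proof -
  have "x * V1 x y = x * y ^ CARD('p) - (x * x ^ (CARD('p) - 1)) * y"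
    by (simp only: V1_def algebra_simps)
  then show ?thesis by (simp only: mult_power_pred)
qed

lemma moore2_dickson20:
  fixes x :: "'p::prime_card mod_ring mpoly"
  shows "x * V1 x y * dickson20 x y
    = x ^ CARD('p) * (y ^ CARD('p)) ^ CARD('p) - (x ^ CARD('p)) ^ CARD('p) * y ^ CARD('p)"
proof -
  have "x * V1 x y * dickson20 x y = (x * V1 x y) ^ CARD('p)"
    by (simp only: dickson20_def mult_power_pred)
  also have "\<dots> = (x * y ^ CARD('p) - x ^ CARD('p) * y) ^ CARD('p)" by (simp only: moore2)
  finally show ?thesis by (simp only: frobenius_diff power_mult_distrib)
qed

text \<open>At a root of the additive polynomial, in particular at \<open>x\<close> and
  \<open>y\<close>, the second Frobenius power is a combination of the lower ones with Dickson
  coefficients; eliminating it from a determinant is Cramer's rule.\<close>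

lemma frobenius2_relation:
  fixes x :: "'p::prime_card mod_ring mpoly"
  assumes "V2 x y X = 0"
  shows "(X ^ CARD('p)) ^ CARD('p) = dickson21 x y * X ^ CARD('p) - dickson20 x y * X"
  using assms unfolding V2_expand by (simp add: algebra_simps)

lemma moore2_dickson21:
  fixes x :: "'p::prime_card mod_ring mpoly"
  shows "x * V1 x y * dickson21 x y = x * (y ^ CARD('p)) ^ CARD('p) - (x ^ CARD('p)) ^ CARD('p) * y"
  unfolding frobenius2_relation[OF V2_first[of x y]] frobenius2_relation[OF V2_second[of x y]] moore2
  by (simp only: algebra_simps)

definition det3 :: "'a \<Rightarrow> 'a \<Rightarrow> 'a \<Rightarrow> 'a \<Rightarrow> 'a \<Rightarrow> 'a \<Rightarrow> 'a \<Rightarrow> 'a \<Rightarrow> 'a \<Rightarrow> 'a::comm_ring_1" where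
  "det3 a b c d e f g h i = a * (e * i - f * h) - b * (d * i - f * g) + c * (d * h - e * g)"

abbreviation frob :: "'p mod_ring mpoly \<Rightarrow> 'p::prime_card mod_ring mpoly" where
  "frob u \<equiv> u ^ CARD('p)"

text \<open>The determinants of Frobenius powers below transform by the determinant under linear
  substitutions with scalar coefficients; their quotients are therefore invariant.\<close>

lemma moore3_det:
  fixes x :: "'p::prime_card mod_ring mpoly"
  shows "moore3 x y z = det3 x (frob x) (frob (frob x)) y (frob y) (frob (frob y)) z (frob z) (frob (frob z))"
proof -
  have "moore3 x y z = (x * V1 x y) * frob (frob z) - (x * V1 x y * dickson21 x y) * frob z + (x * V1 x y * dickson20 x y) * z"
    unfolding moore3_def V2_expand  by (simp only: algebra_simps)
  then show ?thesis
    unfolding moore2_dickson20 moore2_dickson21 unfolding moore2 det3_def 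
    by (simp only: algebra_simps)
qed

text \<open>The next additive polynomial, V2(X)^p - V2(z)^(p-1) V2(X), vanishes at \<open>x\<close>,
  \<open>y\<close> and \<open>z\<close>: at the first two because V2 does, at \<open>z\<close>
  because the two terms coincide. Expanding it gives the recurrence.\<close>

lemma frobenius3_relation:
  fixes x y z :: "'p::prime_card mod_ring mpoly"
  defines "c \<equiv> V2 x y z ^ (CARD('p) - 1) * dickson20 x y"
  assumes "X \<in> {x, y, z}"
  shows "frob (frob (frob X)) = dickson32 x y z * frob (frob X) - dickson31 x y z * frob X + c * X"
proof -
  let ?v = "V2 x y z ^ (CARD('p) - 1)"
  have "frob (frob (frob X)) - frob (dickson21 x y) * frob (frob X) + frob (dickson20 x y) * frob X = frob (V2 x y X)"
    unfolding V2_expand by (simp only: frobenius_add frobenius_diff power_mult_distrib)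
  also have "\<dots> = ?v * V2 x y X"
    using assms(2) by (auto simp: V2_first V2_second zero_power mult.commute[of _ "V2 x y z"] mult_power_pred)
  also have "V2 x y X = frob (frob X) - dickson21 x y * frob X + dickson20 x y * X"
    by (rule V2_expand)
  finally have "frob (frob (frob X)) = frob (dickson21 x y) * frob (frob X) - frob (dickson20 x y) * frob X
      + ?v * (frob (frob X) - dickson21 x y * frob X + dickson20 x y * X)"
    by (simp only: algebra_simps)
  then show ?thesis
    unfolding dickson31_def dickson32_def c_def by (simp only: algebra_simps)
qed

text \<open>Cramer's rule: in the third Frobenius column the recurrence leaves only the term whose
  column is missing. For \<open>dickson31\<close> the minus sign of the recurrence cancels that of a
  column exchange.\<close>

lemma moore3_dickson:
  fixes x :: "'p::prime_card mod_ring mpoly"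
  shows "moore3 x y z * dickson32 x y z
      = det3 x (frob x) (frob (frob (frob x))) y (frob y) (frob (frob (frob y))) z (frob z) (frob (frob (frob z)))"
    and "moore3 x y z * dickson31 x y z
      = det3 x (frob (frob x)) (frob (frob (frob x))) y (frob (frob y)) (frob (frob (frob y))) z (frob (frob z)) (frob (frob (frob z)))"
proof -
  have rx: "frob (frob (frob x)) = dickson32 x y z * frob (frob x) - dickson31 x y z * frob x + V2 x y z ^ (CARD('p) - 1) * dickson20 x y * x"
    and ry: "frob (frob (frob y)) = dickson32 x y z * frob (frob y) - dickson31 x y z * frob y + V2 x y z ^ (CARD('p) - 1) * dickson20 x y * y"
    and rz: "frob (frob (frob z)) = dickson32 x y z * frob (frob z) - dickson31 x y z * frob z + V2 x y z ^ (CARD('p) - 1) * dickson20 x y * z"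
    by (rule frobenius3_relation, simp)+
  show "moore3 x y z * dickson32 x y z
      = det3 x (frob x) (frob (frob (frob x))) y (frob y) (frob (frob (frob y))) z (frob z) (frob (frob (frob z)))"
    unfolding moore3_det rx ry rz det3_def by (simp only: algebra_simps)
  show "moore3 x y z * dickson31 x y z
      = det3 x (frob (frob x)) (frob (frob (frob x))) y (frob (frob y)) (frob (frob (frob y))) z (frob (frob z)) (frob (frob (frob z)))"
    unfolding moore3_det rx ry rz det3_def by (simp only: algebra_simps)
qed

text \<open>The 2 by 2 Moore determinant is multiplied by the determinant of the substitution. The
  exponent p-1 removes this scalar for \<open>dickson20\<close>; for \<open>dickson21\<close>, a
  quotient of two such determinants, it cancels.\<close>

lemma dickson2_GL:
  fixes x y :: "'p::prime_card mod_ring mpoly"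
  assumes nz: "x * V1 x y \<noteq> 0" and det: "a * d - b * c \<noteq> 0"
  defines "x' \<equiv> Const a * x + Const b * y" and "y' \<equiv> Const c * x + Const d * y"
  shows "dickson20 x' y' = dickson20 x y" "dickson21 x' y' = dickson21 x y"
proof -
  have frob: "(Const r * u + Const t * v) ^ CARD('p) = Const r * u ^ CARD('p) + Const t * v ^ CARD('p)"
    for r t :: "'p mod_ring" and u v
    by (simp only: frobenius_add power_mult_distrib frobenius_Const)
  have m: "x' * V1 x' y' = Const (a * d - b * c) * (x * V1 x y)"
    unfolding moore2 x'_def y'_def frob single_diff Const_mult by (simp only: algebra_simps)
  show "dickson20 x' y' = dickson20 x y"
    unfolding dickson20_def m power_mult_distrib[of "Const _"] Const_power scalar_power_pred[OF det] by simp
  have "x' * V1 x' y' * dickson21 x' y' = Const (a * d - b * c) * (x * V1 x y * dickson21 x y)"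
    unfolding moore2_dickson21 x'_def y'_def frob single_diff Const_mult by (simp only: algebra_simps)
  also have "\<dots> = x' * V1 x' y' * dickson21 x y" by (simp only: m mult.assoc)
  finally have eq: "x' * V1 x' y' * dickson21 x' y' = x' * V1 x' y' * dickson21 x y" .
  have "Const (a * d - b * c) \<noteq> 0" using det by (metis lookup_single_eq lookup_zero)
  then have "x' * V1 x' y' \<noteq> 0" using nz unfolding m by (rule no_zero_divisors)
  then show "dickson21 x' y' = dickson21 x y" using eq by (simp only: mult_cancel_left simp_thms)
qed

lemma det3_linear_SL:
  fixes x1 :: "'a::comm_ring_1"
  shows "det3 (a1 * x1 + b1 * y1 + c1 * z1) (a1 * x2 + b1 * y2 + c1 * z2) (a1 * x3 + b1 * y3 + c1 * z3)
      (a2 * x1 + b2 * y1 + c2 * z1) (a2 * x2 + b2 * y2 + c2 * z2) (a2 * x3 + b2 * y3 + c2 * z3)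
      (a3 * x1 + b3 * y1 + c3 * z1) (a3 * x2 + b3 * y2 + c3 * z2) (a3 * x3 + b3 * y3 + c3 * z3)
    = det3 a1 b1 c1 a2 b2 c2 a3 b3 c3 * det3 x1 x2 x3 y1 y2 y3 z1 z2 z3"
  unfolding det3_def by (simp only: algebra_simps)

text \<open>With determinant 1 the Moore determinant is itself invariant, and the other two are
  quotients of invariant determinants by it.\<close>

lemma dickson3_SL:
  fixes x y z :: "'p::prime_card mod_ring mpoly"
  assumes nz: "moore3 x y z \<noteq> 0" and det: "det3 a1 b1 c1 a2 b2 c2 a3 b3 c3 = 1"
  defines "x' \<equiv> Const a1 * x + Const b1 * y + Const c1 * z"
    and "y' \<equiv> Const a2 * x + Const b2 * y + Const c2 * z"
    and "z' \<equiv> Const a3 * x + Const b3 * y + Const c3 * z"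
  shows "moore3 x' y' z' = moore3 x y z" "dickson31 x' y' z' = dickson31 x y z"
    "dickson32 x' y' z' = dickson32 x y z"
proof -
  have frob: "(Const r * u + Const s * v + Const t * w) ^ CARD('p)
      = Const r * u ^ CARD('p) + Const s * v ^ CARD('p) + Const t * w ^ CARD('p)"
    for r s t :: "'p mod_ring" and u v w
    by (simp only: frobenius_add power_mult_distrib frobenius_Const)
  have "det3 (Const a1) (Const b1) (Const c1) (Const a2) (Const b2) (Const c2) (Const a3) (Const b3) (Const c3)
      = Const (det3 a1 b1 c1 a2 b2 c2 a3 b3 c3)"
    unfolding det3_def by (simp only: single_diff single_add Const_mult)
  also have "\<dots> = 1" by (simp add: det)
  finally have D: "det3 (Const a1) (Const b1) (Const c1) (Const a2) (Const b2) (Const c2) (Const a3) (Const b3) (Const c3) = 1" .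
  show m: "moore3 x' y' z' = moore3 x y z"
    unfolding moore3_det x'_def y'_def z'_def frob det3_linear_SL D by simp
  have "moore3 x' y' z' * dickson31 x' y' z' = moore3 x y z * dickson31 x y z"
    unfolding moore3_dickson x'_def y'_def z'_def frob det3_linear_SL D by simp
  then show "dickson31 x' y' z' = dickson31 x y z" using nz by (simp add: m)
  have "moore3 x' y' z' * dickson32 x' y' z' = moore3 x y z * dickson32 x y z"
    unfolding moore3_dickson x'_def y'_def z'_def frob det3_linear_SL D by simp
  then show "dickson32 x' y' z' = dickson32 x y z" using nz by (simp add: m)
qed

lemma subst_dickson:
  "subst s (V1 x y) = V1 (subst s x) (subst s y)"
  "subst s (V2 x y z) = V2 (subst s x) (subst s y) (subst s z)"
  "subst s (dickson20 x y) = dickson20 (subst s x) (subst s y)"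
  "subst s (dickson21 x y) = dickson21 (subst s x) (subst s y)"
  "subst s (moore3 x y z) = moore3 (subst s x) (subst s y) (subst s z)"
  "subst s (dickson31 x y z) = dickson31 (subst s x) (subst s y) (subst s z)"
  "subst s (dickson32 x y z) = dickson32 (subst s x) (subst s y) (subst s z)"
  by (simp_all only: dickson_defs subst_add subst_diff subst_mult subst_power)

lemma dickson_polys:
  assumes "x \<in> polys Y" "y \<in> polys Y" "z \<in> polys Y"
  shows "V1 x y \<in> polys Y" "V2 x y z \<in> polys Y" "dickson20 x y \<in> polys Y" "dickson21 x y \<in> polys Y"
    "moore3 x y z \<in> polys Y" "dickson31 x y z \<in> polys Y" "dickson32 x y z \<in> polys Y"
  unfolding dickson_defs by (intro polys_add polys_diff polys_mult polys_power assms)+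

lemma dickson_homog:
  fixes x :: "'p::prime_card mod_ring mpoly"
  assumes "x \<in> homog two 2" "y \<in> homog two 2" "z \<in> homog two 2"
  defines "p \<equiv> CARD('p)"
  shows "V1 x y \<in> homog two (2 * p)" "V2 x y z \<in> homog two (2 * p ^ 2)"
    "dickson20 x y \<in> homog two (2 * (p ^ 2 - 1))" "dickson21 x y \<in> homog two (2 * (p ^ 2 - p))"
    "moore3 x y z \<in> homog two (2 * (1 + p + p ^ 2))" "dickson31 x y z \<in> homog two (2 * (p ^ 3 - p))"
    "dickson32 x y z \<in> homog two (2 * (p ^ 3 - p ^ 2))"
proof -
  \<comment> \<open>Writing p as a successor removes the truncated subtractions from the degree
    computations.\<close>
  obtain q where p: "p = Suc q" "CARD('p) = Suc q"
    using not0_implies_Suc[of "CARD('p)"] by (auto simp: p_def)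
  have V1: "V1 x y \<in> homog two (2 * p)" if "x \<in> homog two 2" "y \<in> homog two 2" for x y :: "'p mod_ring mpoly"
    unfolding V1_def p
    by (intro homog_diff homog_power_eq[OF that(2)] homog_mult_eq[OF homog_power[OF that(1)] that(2)]) (simp_all)
  show 1: "V1 x y \<in> homog two (2 * p)" by (rule V1[OF assms(1,2)])
  show 2: "V2 x y z \<in> homog two (2 * p ^ 2)"
    unfolding V2_def
    by (intro homog_diff homog_power_eq[OF V1[OF assms(1,3)]] homog_mult_eq[OF homog_power[OF 1] V1[OF assms(1,3)]])
       (simp_all add: p power2_eq_square algebra_simps)
  show 3: "dickson20 x y \<in> homog two (2 * (p ^ 2 - 1))"
    unfolding dickson20_def
    by (rule homog_power_eq[OF homog_mult[OF assms(1) 1]]) (simp add: p power2_eq_square algebra_simps)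
  show 4: "dickson21 x y \<in> homog two (2 * (p ^ 2 - p))"
    unfolding dickson21_def
    by (intro homog_add homog_power_eq[OF homog_power[OF assms(1)]] homog_power_eq[OF 1])
       (simp_all add: p power2_eq_square algebra_simps)
  show "moore3 x y z \<in> homog two (2 * (1 + p + p ^ 2))"
    unfolding moore3_def by (rule homog_mult_eq[OF homog_mult[OF assms(1) 1] 2]) simp
  show "dickson31 x y z \<in> homog two (2 * (p ^ 3 - p))"
    unfolding dickson31_def
    by (intro homog_add homog_power_eq[OF 3] homog_mult_eq[OF homog_power[OF 2] 4])
       (simp_all add: p power2_eq_square power3_eq_cube algebra_simps)
  show "dickson32 x y z \<in> homog two (2 * (p ^ 3 - p ^ 2))"
    unfolding dickson32_def
    by (intro homog_add homog_power_eq[OF 4] homog_power_eq[OF 2])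
       (simp_all add: p power2_eq_square power3_eq_cube algebra_simps)
qed

lemma V1_orb:
  fixes X :: "'p::prime_card mod_ring mpoly"
  shows "(\<Prod>h\<in>lforms {i}. X + h) = V1 (Var i) X"
  by (simp add: prod_lforms_insert[of i "{}"] lforms_empty prod_translates V1_def)

lemma orb1: "orb j {i} = V1 (Var i) (Var j :: 'p::prime_card mod_ring mpoly)"
  by (simp add: orb_def V1_orb)

text \<open>\<open>V1\<close> is additive in its second argument and commutes with scalars, so the
  product over the remaining coefficient is again of the shape treated by
  \<open>prod_translates\<close>.\<close>

lemma orb2:
  assumes "i \<noteq> j"
  shows "orb k {j, i} = V2 (Var i) (Var j) (Var k :: 'p::prime_card mod_ring mpoly)"
proof -
  have V1_add: "V1 x (X + Const b * Y) = V1 x X + Const b * V1 x Y" for x X Y and b :: "'p mod_ring"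
    by (simp only: V1_def frobenius_add power_mult_distrib frobenius_Const algebra_simps)
  have "orb k {j, i} = (\<Prod>b\<in>UNIV. \<Prod>h\<in>lforms {i}. (Var k + Const (b :: 'p mod_ring) * Var j) + h)"
    unfolding orb_def using assms by (subst prod_lforms_insert) (auto simp: add.assoc)
  also have "\<dots> = (\<Prod>b\<in>UNIV. V1 (Var i) (Var k) + Const (b :: 'p mod_ring) * V1 (Var i) (Var j))"
    by (simp only: V1_orb V1_add)
  finally show ?thesis by (simp only: prod_translates V2_def)
qed

section \<open>Linear groups as sets of substitutions\<close>

definition GL1s :: "nat \<Rightarrow> (nat \<Rightarrow> 'k::field mpoly) set" where
  "GL1s i = {Var(i := Const a * Var i) |a. a \<noteq> 0}"

definition GL2s :: "nat \<Rightarrow> nat \<Rightarrow> (nat \<Rightarrow> 'k::field mpoly) set" where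
  "GL2s i j = {Var(i := Const a * Var i + Const b * Var j, j := Const c * Var i + Const d * Var j)
     |a b c d. a * d - b * c \<noteq> 0}"

definition SL3s :: "nat \<Rightarrow> nat \<Rightarrow> nat \<Rightarrow> (nat \<Rightarrow> 'k::field mpoly) set" where
  "SL3s i j k = {Var(i := Const a1 * Var i + Const b1 * Var j + Const c1 * Var k,
                     j := Const a2 * Var i + Const b2 * Var j + Const c2 * Var k,
                     k := Const a3 * Var i + Const b3 * Var j + Const c3 * Var k)
     |a1 b1 c1 a2 b2 c2 a3 b3 c3. det3 a1 b1 c1 a2 b2 c2 a3 b3 c3 = 1}"

lemma GL2sI:
  assumes "a * d - b * c \<noteq> 0" "i \<noteq> j"
    "s i = Const a * Var i + Const b * Var j" "s j = Const c * Var i + Const d * Var j"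
    "\<And>v. v \<noteq> i \<Longrightarrow> v \<noteq> j \<Longrightarrow> s v = Var v"
  shows "s \<in> GL2s i j"
proof -
  have "s = Var(i := Const a * Var i + Const b * Var j, j := Const c * Var i + Const d * Var j)"
    using assms(2-) by auto
  then show ?thesis using assms(1) unfolding GL2s_def by blast
qed

lemma SL3sI:
  assumes "det3 a1 b1 c1 a2 b2 c2 a3 b3 c3 = 1" "distinct [i, j, k]"
    "s i = Const a1 * Var i + Const b1 * Var j + Const c1 * Var k"
    "s j = Const a2 * Var i + Const b2 * Var j + Const c2 * Var k"
    "s k = Const a3 * Var i + Const b3 * Var j + Const c3 * Var k"
    "\<And>v. v \<noteq> i \<Longrightarrow> v \<noteq> j \<Longrightarrow> v \<noteq> k \<Longrightarrow> s v = Var v"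
  shows "s \<in> SL3s i j k"
proof -
  have "s = Var(i := Const a1 * Var i + Const b1 * Var j + Const c1 * Var k,
                j := Const a2 * Var i + Const b2 * Var j + Const c2 * Var k,
                k := Const a3 * Var i + Const b3 * Var j + Const c3 * Var k)"
    using assms(2-) by auto
  then show ?thesis using assms(1) unfolding SL3s_def by blast
qed

section \<open>Invariants of GL_1, GL_2 and SL_3\<close>

lemma Var_pow_dvd_subst:
  assumes "Var n ^ e dvd f" "subst s f = f"
  shows "s n ^ e dvd f"
proof -
  obtain c where "f = Var n ^ e * c" using assms(1) by (elim dvdE)
  then have "f = s n ^ e * subst s c" using assms(2) by (metis subst_Var subst_mult subst_power)
  then show ?thesis by simp
qed

lemma invarsD: "f \<in> invars Y S \<Longrightarrow> s \<in> S \<Longrightarrow> subst s f = f"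
  by (simp add: invars_def)

lemma invars_polys: "f \<in> invars Y S \<Longrightarrow> f \<in> polys Y"
  by (simp add: invars_def)

lemma invars_dvd:
  assumes "f \<in> invars Y S" "L \<in> invars Y S" "L \<noteq> 0" "L dvd f"
  shows "\<exists>f'\<in>invars Y S. f = L * f'"
proof -
  obtain f' where "f = L * f'" using assms(4) by (elim dvdE)
  then show ?thesis using invars_quotient[of L f' Y S] assms by blast
qed

theorem freely_gen_GL1:
  "freely_gen {m} (\<lambda>_. 2 * (CARD('p) - 1)) (\<lambda>_. Var i ^ (CARD('p) - 1))
     (invars {i} (GL1s i) :: 'p::prime_card mod_ring mpoly set)"
proof (rule freely_gen_insert[where X = "{}" and k = i and J = "range (Const :: 'p mod_ring \<Rightarrow> _)"])
  have p: "CARD('p) - 1 > 0" using card_gt_1[where 'p = 'p] by simp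
  show "2 * (CARD('p) - 1) > 0" using p by simp
  have nz: "(Var i :: 'p mod_ring mpoly) \<noteq> 0" using linear_neq_zero[of 0 i] by simp
  then show nz': "Var i ^ (CARD('p) - 1) \<noteq> (0 :: 'p mod_ring mpoly)" by simp
  show in_I: "Var i ^ (CARD('p) - 1) \<in> (invars {i} (GL1s i) :: 'p mod_ring mpoly set)"
    by (auto simp: invars_def GL1s_def power_mult_distrib Const_power scalar_power_pred intro!: polys_power)
  show "Var i ^ (CARD('p) - 1) \<in> homog two (2 * (CARD('p) - 1))"
    by (rule homog_power_eq[of _ _ 2]) (use homog_Var[of i two] in auto)
  show "subst (Var(i := 0)) (Var i ^ (CARD('p) - 1)) = (0 :: 'p mod_ring mpoly)"
    using p by (simp add: zero_power)
  fix f :: "'p mod_ring mpoly" assume f: "f \<in> invars {i} (GL1s i)"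
  show "subst (Var(i := 0)) f \<in> range Const"
    by (rule polys_empty, rule polys_subst[OF invars_polys[OF f]]) auto
  assume z: "subst (Var(i := 0)) f = 0"
  have "Var i ^ (CARD('p) - 1) dvd f"
    by (rule Var_power_dvd_scaling_invariant[OF _ z]) (use f in \<open>auto intro!: invarsD[of f] simp: GL1s_def\<close>)
  then show "\<exists>f'\<in>invars {i} (GL1s i). f = Var i ^ (CARD('p) - 1) * f'"
    using invars_dvd[OF f in_I nz'] by blast
qed (auto intro: subalg_invars freely_gen_empty)

lemma Var_neq_zero: "(Var i :: 'k::field mpoly) \<noteq> 0"
  using linear_neq_zero[of 0 i] by simp

lemma V1_Var_neq_zero: "i \<noteq> j \<Longrightarrow> V1 (Var i) (Var j) \<noteq> 0"
  unfolding orb1[symmetric] by (rule orb_neq_zero) auto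

lemma V2_Var_neq_zero: "distinct [i, j, k] \<Longrightarrow> V2 (Var i) (Var j) (Var k) \<noteq> (0 :: 'a::prime_card mod_ring mpoly)"
proof -
  assume d: "distinct [i, j, k]"
  then have "orb k {j, i} \<noteq> (0 :: 'a mod_ring mpoly)" by (intro orb_neq_zero) auto
  then show ?thesis using d by (simp add: orb2)
qed

lemma lforms1:
  assumes "(h :: 'k::field mpoly) \<in> lforms {i}"
  obtains a where "h = Const a * Var i"
proof -
  have "h \<in> (\<lambda>(b, h). Const b * Var i + h) ` (UNIV \<times> lforms {})"
    using bij_betw_imp_surj_on[OF lforms_insert[of i "{}", where 'k = 'k]] assms by simp
  then obtain q where "q \<in> UNIV \<times> lforms {}" "h = (\<lambda>(b, h). Const b * Var i + h) q" by (rule imageE)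
  then have "h = Const (fst q) * Var i" by (auto simp: lforms_empty)
  then show ?thesis by (rule that)
qed

lemma lforms2:
  assumes "(h :: 'k::field mpoly) \<in> lforms {j, i}" "i \<noteq> j"
  obtains a b where "h = Const a * Var i + Const b * Var j"
proof -
  have "h \<in> (\<lambda>(b, h). Const b * Var j + h) ` (UNIV \<times> lforms {i})"
    using bij_betw_imp_surj_on[OF lforms_insert[of j "{i}", where 'k = 'k]] assms by simp
  then obtain b h' where h: "h = Const b * Var j + h'" "h' \<in> lforms {i}" by auto
  obtain a where "h' = Const a * Var i" using h(2) by (rule lforms1)
  then have "h = Const a * Var i + Const b * Var j" using h(1) by (simp only: add.commute)
  then show ?thesis by (rule that)
qed

text \<open>Each symmetry \<open>s\<close> on the hyperplane is induced by a symmetry of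
  \<open>f\<close>, so the p-th power of \<open>h\<close> is invariant; injectivity of the Frobenius
  passes this to \<open>h\<close>.\<close>

lemma invars_frobenius_root:
  fixes h :: "'p::prime_card mod_ring mpoly"
  assumes f: "f \<in> invars Y' S'" and h: "h \<in> polys Y" "subst (Var(k := 0)) f = frob h"
    and S: "\<And>s. s \<in> S \<Longrightarrow> \<exists>s'\<in>S'. \<forall>v\<in>Y'. subst s ((Var(k := 0)) v) = subst (Var(k := 0)) (s' v)"
  shows "h \<in> invars Y S"
proof -
  have "subst s h = h" if s: "s \<in> S" for s
  proof -
    obtain s' where s': "s' \<in> S'" "\<forall>v\<in>Y'. subst s ((Var(k := 0)) v) = subst (Var(k := 0)) (s' v)"
      using S[OF s] by blast
    have "frob (subst s h) = subst s (subst (Var(k := 0)) f)" by (simp add: h(2))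
    also have "\<dots> = subst (Var(k := 0)) (subst s' f)"
      unfolding subst_subst using invars_polys[OF f] s'(2) by (intro subst_cong[of f Y']) auto
    also have "\<dots> = frob h" using invarsD[OF f s'(1)] h(2) by simp
    finally show ?thesis by (rule frobenius_inj)
  qed
  then show ?thesis using h(1) by (simp add: invars_def)
qed

text \<open>On the hyperplane \<open>dickson21\<close> becomes the p-th power of the GL_1 generator,
  while \<open>dickson20\<close> vanishes and divides every invariant that vanishes there. The
  indices are free so that later lists can be ordered by degree; the value 0 elsewhere is a
  dummy.\<close>

theorem freely_gen_GL2:
  assumes ij: "i \<noteq> j" and m: "m1 \<noteq> m2"
  shows "freely_gen {m2, m1} ((\<lambda>_. 0)(m1 := 2 * (CARD('p) ^ 2 - CARD('p)), m2 := 2 * (CARD('p) ^ 2 - 1)))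
     ((\<lambda>_. 0)(m1 := dickson21 (Var i) (Var j), m2 := dickson20 (Var i) (Var j)))
     (invars {i, j} (GL2s i j) :: 'p::prime_card mod_ring mpoly set)"
    (is "freely_gen _ ?w ?g ?I")
proof (rule freely_gen_insert[where X = "{m1}" and k = j and J = "frob ` (invars {i} (GL1s i) :: 'p mod_ring mpoly set)"])
  let ?x = "Var i :: 'p mod_ring mpoly" and ?y = "Var j :: 'p mod_ring mpoly"
  have p: "CARD('p) > 1" by (rule card_gt_1)
  have hv: "Var v \<in> homog two 2" for v using homog_Var[of v two] by simp
  have V: "?x * V1 ?x ?y \<noteq> 0" using V1_Var_neq_zero[OF ij] by (simp add: Var_neq_zero)
  show "m2 \<notin> {m1}" using m by simp
  have "CARD('p) ^ 2 > 1" using p by (simp add: power2_eq_square less_1_mult)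
  then show "?w m2 > 0" by simp
  have "dickson20 ?x ?y \<noteq> 0" using V by (simp add: dickson20_def)
  then show nz: "?g m2 \<noteq> 0" by simp
  have D: "dickson20 ?x ?y \<in> ?I" "dickson21 ?x ?y \<in> ?I"
    unfolding invars_def GL2s_def mem_Collect_eq using ij
    by (auto simp: subst_dickson dickson2_GL[OF V] intro!: dickson_polys)
  then show g: "?g v \<in> ?I" if "v \<in> {m2, m1}" for v
    using that m by auto
  show "?g v \<in> homog two (?w v)" if "v \<in> {m2, m1}" for v
    using that m dickson_homog(3,4)[OF hv hv hv, of i j] by auto
  have res: "subst (Var(j := 0)) (dickson21 ?x ?y) = frob (?x ^ (CARD('p) - 1))"
    using p ij by (simp add: subst_dickson dickson21_def V1_def zero_power)
  show "freely_gen {m1} ?w (\<lambda>v. subst (Var(j := 0)) (?g v)) (frob ` invars {i} (GL1s i))"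
    by (rule freely_gen_cong[OF freely_gen_frobenius[OF freely_gen_GL1]])
       (use m res in \<open>auto simp: power2_eq_square algebra_simps\<close>)
  show "subst (Var(j := 0)) (?g m2) = 0"
    using p ij by (simp add: subst_dickson dickson20_def V1_def zero_power)
  fix f assume f: "f \<in> ?I"
  show "subst (Var(j := 0)) f \<in> frob ` invars {i} (GL1s i)"
  proof -
    have "subst (Var(v := Var v + Var j)) f = f" if "v \<in> {i}" for v
      by (rule invarsD[OF f], rule GL2sI[of 1 1 1 0]) (use that ij in auto)
    then obtain h where h: "h \<in> polys {i}" "subst (Var(j := 0)) f = frob h"
      using restriction_is_frobenius[of f j "{i}"] invars_polys[OF f] ij by (auto simp: insert_commute)
    have "h \<in> invars {i} (GL1s i)"
    proof (rule invars_frobenius_root[OF f h])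
      fix s assume "s \<in> (GL1s i :: (nat \<Rightarrow> 'p mod_ring mpoly) set)"
      then obtain a where a: "s = Var(i := Const a * Var i)" "a \<noteq> 0" by (auto simp: GL1s_def)
      then have "s \<in> GL2s i j" using ij by (intro GL2sI[of a 1 0 0]) auto
      then show "\<exists>s'\<in>GL2s i j. \<forall>v\<in>{i, j}. subst s ((Var(j := 0)) v) = subst (Var(j := 0)) (s' v)"
        using a ij by (intro bexI[of _ s]) auto
    qed
    then show ?thesis using h(2) by blast
  qed
  assume z: "subst (Var(j := 0)) f = 0"
  let ?e = "CARD('p) - 1"
  \<comment> \<open>The diagonal matrices with entries 1, a scale \<open>Var j\<close> alone, whence
    the exponent p-1.\<close>
  have y: "Var j ^ ?e dvd f"
  proof (rule Var_power_dvd_scaling_invariant[OF _ z])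
    fix a :: "'p mod_ring" assume "a \<noteq> 0"
    then show "subst (Var(j := Const a * Var j)) f = f"
      by (intro invarsD[OF f] GL2sI[of 1 a 0 0]) (use ij in auto)
  qed
  \<comment> \<open>The exchange of the two variables has determinant -1 and is available in
    GL_2.\<close>
  have "(Var(i := Var j, j := Var i)) j ^ ?e dvd f"
    by (rule Var_pow_dvd_subst[OF y], rule invarsD[OF f], rule GL2sI[of 0 0 1 1]) (use ij in auto)
  then have x: "Var i ^ ?e dvd f" using ij by simp
  have "(Var i * orb j {i}) ^ ?e dvd f"
  proof (rule orb_power_dvd[OF _ _ _ _ x y])
    fix h :: "'p mod_ring mpoly" assume "h \<in> lforms {i}"
    then obtain a where "h = Const a * Var i" by (rule lforms1)
    then show "subst (Var(j := Var j + h)) f = f"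
      by (intro invarsD[OF f] GL2sI[of 1 1 0 a]) (use ij in auto)
  qed (use ij Var_neq_zero in auto)
  then have "dickson20 ?x ?y dvd f" by (simp add: orb1 dickson20_def)
  then show "\<exists>f'\<in>?I. f = ?g m2 * f'"
    using invars_dvd[OF f g nz] by auto
qed (rule subalg_invars)

text \<open>The restrictions of \<open>dickson31\<close> and \<open>dickson32\<close> are the p-th
  powers of the two GL_2 generators, and \<open>moore3\<close> restricts to 0. The generators are
  indexed by increasing degree.\<close>

theorem freely_gen_SL3:
  assumes ij: "distinct [i, j, k]" and m: "distinct [m0, m1, m2]"
  shows "freely_gen {m0, m2, m1} ((\<lambda>_. 0)(m0 := 2 * (1 + CARD('p) + CARD('p) ^ 2),
       m1 := 2 * (CARD('p) ^ 3 - CARD('p) ^ 2), m2 := 2 * (CARD('p) ^ 3 - CARD('p))))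
     ((\<lambda>_. 0)(m0 := moore3 (Var i) (Var j) (Var k), m1 := dickson32 (Var i) (Var j) (Var k),
       m2 := dickson31 (Var i) (Var j) (Var k)))
     (invars {i, j, k} (SL3s i j k) :: 'p::prime_card mod_ring mpoly set)"
    (is "freely_gen _ ?w ?g ?I")
proof (rule freely_gen_insert[where X = "{m2, m1}" and k = k and J = "frob ` (invars {i, j} (GL2s i j) :: 'p mod_ring mpoly set)"])
  let ?x = "Var i :: 'p mod_ring mpoly" and ?y = "Var j :: 'p mod_ring mpoly" and ?z = "Var k :: 'p mod_ring mpoly"
  have p: "CARD('p) > 1" by (rule card_gt_1)
  have hv: "Var v \<in> homog two 2" for v using homog_Var[of v two] by simp
  have V: "moore3 ?x ?y ?z \<noteq> 0"
    using V1_Var_neq_zero[of i j] V2_Var_neq_zero[OF ij] ij by (simp add: moore3_def Var_neq_zero)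
  show "m0 \<notin> {m2, m1}" using m by simp
  show "?w m0 > 0" using m by simp
  show nz: "?g m0 \<noteq> 0" using V m by simp
  have D: "moore3 ?x ?y ?z \<in> ?I" "dickson31 ?x ?y ?z \<in> ?I" "dickson32 ?x ?y ?z \<in> ?I"
    unfolding invars_def SL3s_def mem_Collect_eq using ij
    by (auto simp: subst_dickson dickson3_SL[OF V] intro!: dickson_polys)
  then show g: "?g v \<in> ?I" if "v \<in> {m0, m2, m1}" for v
    using that m by auto
  show "?g v \<in> homog two (?w v)" if "v \<in> {m0, m2, m1}" for v
    using that m dickson_homog(5-7)[OF hv hv hv, of i j k] by auto
  have V2z: "V2 ?x ?y 0 = 0" using p by (simp add: V2_def V1_def zero_power)
  have res: "subst (Var(k := 0)) (dickson31 ?x ?y ?z) = frob (dickson20 ?x ?y)"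
    "subst (Var(k := 0)) (dickson32 ?x ?y ?z) = frob (dickson21 ?x ?y)"
    "subst (Var(k := 0)) (moore3 ?x ?y ?z) = 0"
    using p ij by (simp_all add: subst_dickson dickson31_def dickson32_def moore3_def V2z zero_power)
  show "freely_gen {m2, m1} ?w (\<lambda>v. subst (Var(k := 0)) (?g v)) (frob ` invars {i, j} (GL2s i j))"
    by (rule freely_gen_cong[OF freely_gen_frobenius[OF freely_gen_GL2[of i j m1 m2]]])
       (use m ij res in \<open>auto simp: power2_eq_square power3_eq_cube algebra_simps\<close>)
  show "subst (Var(k := 0)) (?g m0) = 0"
    using m res by simp
  fix f assume f: "f \<in> ?I"
  show "subst (Var(k := 0)) f \<in> frob ` invars {i, j} (GL2s i j)"
  proof -
    have "subst (Var(v := Var v + Var k)) f = f" if "v \<in> {i, j}" for v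
    proof (cases "v = i")
      case True
      then show ?thesis
        by (intro invarsD[OF f] SL3sI[of 1 0 1 0 1 0 0 0 1]) (use ij in \<open>auto simp: det3_def\<close>)
    next
      case False
      with that have "v = j" by simp
      then show ?thesis
        by (intro invarsD[OF f] SL3sI[of 1 0 0 0 1 1 0 0 1]) (use ij in \<open>auto simp: det3_def\<close>)
    qed
    then obtain h where h: "h \<in> polys {i, j}" "subst (Var(k := 0)) f = frob h"
      using restriction_is_frobenius[of f k "{i, j}"] invars_polys[OF f] ij by (auto simp: insert_commute)
    have "h \<in> invars {i, j} (GL2s i j)"
    proof (rule invars_frobenius_root[OF f h])
      fix s assume "s \<in> (GL2s i j :: (nat \<Rightarrow> 'p mod_ring mpoly) set)"
      then obtain a b c d where s: "s = Var(i := Const a * Var i + Const b * Var j, j := Const c * Var i + Const d * Var j)"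
        "a * d - b * c \<noteq> 0" by (auto simp: GL2s_def)
      \<comment> \<open>The inverse determinant on the diagonal puts the extension into SL_3 and is
        invisible on the hyperplane, where \<open>Var k\<close> is 0.\<close>
      let ?s = "s(k := Const (inverse (a * d - b * c)) * Var k)"
      have "?s \<in> SL3s i j k"
        by (rule SL3sI[of a b 0 c d 0 0 0 "inverse (a * d - b * c)"])
           (use s ij in \<open>auto simp: det3_def simp flip: left_diff_distrib mult.assoc\<close>)
      then show "\<exists>s'\<in>SL3s i j k. \<forall>v\<in>{i, j, k}. subst s ((Var(k := 0)) v) = subst (Var(k := 0)) (s' v)"
        using s ij by (intro bexI[of _ ?s]) auto
    qed
    then show ?thesis using h(2) by blast
  qed
  assume z: "subst (Var(k := 0)) f = 0"
  have dz: "Var k ^ 1 dvd f" using z by (simp add: Var_dvd_iff)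
  \<comment> \<open>The minus sign gives this exchange of two variables determinant 1.\<close>
  have "(Var(k := Var j, j := - Var k)) k ^ 1 dvd f"
    by (rule Var_pow_dvd_subst[OF dz], rule invarsD[OF f], rule SL3sI[of 1 0 0 0 0 "-1" 0 1 0])
       (use ij in \<open>auto simp: det3_def single_uminus\<close>)
  then have dy: "Var j ^ 1 dvd f" using ij by simp
  have "(Var(k := Var i, i := - Var k)) k ^ 1 dvd f"
    by (rule Var_pow_dvd_subst[OF dz], rule invarsD[OF f], rule SL3sI[of 0 0 "-1" 0 1 0 1 0 0])
       (use ij in \<open>auto simp: det3_def single_uminus\<close>)
  then have dx: "Var i ^ 1 dvd f" using ij by simp
  \<comment> \<open>With the next step this collects one linear form from each line:
    \<open>Var i\<close>, the translates of \<open>Var j\<close>, the translates of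
    \<open>Var k\<close>. Their product is the factored Moore determinant.\<close>
  have dxy: "(Var i * orb j {i}) ^ 1 dvd f"
  proof (rule orb_power_dvd[OF _ _ _ _ dx dy])
    fix h :: "'p mod_ring mpoly" assume "h \<in> lforms {i}"
    then obtain a where "h = Const a * Var i" by (rule lforms1)
    then show "subst (Var(j := Var j + h)) f = f"
      by (intro invarsD[OF f] SL3sI[of 1 0 0 a 1 0 0 0 1]) (use ij in \<open>auto simp: det3_def\<close>)
  qed (use ij Var_neq_zero in auto)
  have "(Var i * orb j {i} * orb k {j, i}) ^ 1 dvd f"
  proof (rule orb_power_dvd[OF _ _ _ _ dxy dz])
    fix h :: "'p mod_ring mpoly" assume "h \<in> lforms {j, i}"
    then obtain a b where "h = Const a * Var i + Const b * Var j" by (rule lforms2) (use ij in simp)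
    then show "subst (Var(k := Var k + h)) f = f"
      by (intro invarsD[OF f] SL3sI[of 1 0 0 0 1 0 a b 1]) (use ij in \<open>auto simp: det3_def\<close>)
  next
    show "Var i * orb j {i} \<in> (polys {j, i} :: 'p mod_ring mpoly set)"
      using orb_polys[of j "{i}"] by (intro polys_mult) auto
    show "Var i * orb j {i} \<noteq> (0 :: 'p mod_ring mpoly)"
      using Var_neq_zero orb_neq_zero[of j "{i}"] ij by auto
  qed (use ij in auto)
  then have "moore3 ?x ?y ?z dvd f" using ij by (simp add: orb1 orb2 moore3_def)
  then show "\<exists>f'\<in>?I. f = ?g m0 * f'"
    using invars_dvd[OF f g nz] m by auto
qed (rule subalg_invars)

section \<open>Adjoining a variable\<close>

text \<open>Invertibility is expressed by a substitution undoing \<open>s\<close> on the variables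
  of \<open>Z\<close>, the form in which \<open>subst_orb\<close> uses it.\<close>

definition linear_auto :: "nat set \<Rightarrow> (nat \<Rightarrow> 'k::field mpoly) \<Rightarrow> bool" where
  "linear_auto Z s \<longleftrightarrow> (\<forall>i\<in>Z. s i \<in> lforms Z) \<and> (\<exists>t. \<forall>i\<in>Z. subst t (s i) = Var i)"

text \<open>The parabolic Weyl groups arise from \<open>SL 3\<close> by iterating this construction.\<close>

definition affine_ext :: "nat \<Rightarrow> nat set \<Rightarrow> 'k set \<Rightarrow> (nat \<Rightarrow> 'k mpoly) set \<Rightarrow> (nat \<Rightarrow> 'k::field mpoly) set" where
  "affine_ext k Z C S = {s(k := Const c * Var k + h) |s c h. s \<in> S \<and> c \<in> C \<and> h \<in> lforms Z}"

lemma affine_extI: "s \<in> S \<Longrightarrow> c \<in> C \<Longrightarrow> h \<in> lforms Z \<Longrightarrow> s(k := Const c * Var k + h) \<in> affine_ext k Z C S"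
  unfolding affine_ext_def by blast

text \<open>Invariants of \<open>S\<close> do not involve the new variable and lift unchanged, so
  restriction is onto. An extended substitution multiplies \<open>orb k Z\<close> by its scalar in
  \<open>C\<close>; the exponent \<open>e\<close> is the order of \<open>C\<close>, which makes the
  power invariant. \<open>Z\<close> may be smaller than \<open>Y\<close>, even empty.\<close>

theorem freely_gen_ext:
  fixes S :: "(nat \<Rightarrow> 'p::prime_card mod_ring mpoly) set"
  assumes G: "freely_gen X w g (invars Y S)" and k: "k \<notin> Y" and n: "n \<notin> X" and Z: "Z \<subseteq> Y" "finite Z"
    and aut: "\<And>s. s \<in> S \<Longrightarrow> linear_auto Z s" and pol: "\<And>s i. s \<in> S \<Longrightarrow> i \<in> Y \<Longrightarrow> s i \<in> polys Y"
    and id: "Var \<in> S"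
    and C: "C = {1} \<and> e = 1 \<or> C = - {0} \<and> e = CARD('p) - 1"
  shows "freely_gen (insert n X) (w(n := e * (2 * CARD('p) ^ card Z))) (g(n := orb k Z ^ e))
    (invars (insert k Y) (affine_ext k Z C S))"
    (is "freely_gen _ ?w ?g ?I")
proof (rule freely_gen_insert[where X = X and k = k and J = "invars Y S"])
  have e: "e > 0" using C card_gt_1[where 'p = 'p] by auto
  have C1: "1 \<in> C" and Ce: "\<And>c. c \<in> C \<Longrightarrow> c \<noteq> 0" "\<And>c. c \<in> C \<Longrightarrow> c ^ e = 1"
    using C by (auto simp: scalar_power_pred)
  have kZ: "k \<notin> Z" using k Z by auto
  have l0: "0 \<in> (lforms Z :: 'p mod_ring mpoly set)" by (simp add: lforms_def)
  show "n \<notin> X" by (rule n)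
  show "?w n > 0" using e by simp
  have "orb k Z \<noteq> (0 :: 'p mod_ring mpoly)" by (rule orb_neq_zero[OF kZ Z(2)])
  then have nz: "orb k Z ^ e \<noteq> (0 :: 'p mod_ring mpoly)" by simp
  then show "?g n \<noteq> 0" by simp
  have gX: "g v \<in> invars Y S" "g v \<in> homog two (w v)" if "v \<in> X" for v
    using G that by (auto simp: freely_gen_def)
  have "subst s (g v) = g v" if "v \<in> X" "s \<in> affine_ext k Z C S" for s v
  proof -
    obtain s0 c h where s: "s = s0(k := Const c * Var k + h)" "s0 \<in> S"
      using \<open>s \<in> affine_ext k Z C S\<close> by (auto simp: affine_ext_def)
    have "subst s (g v) = subst s0 (g v)"
      using k invars_polys[OF gX(1)[OF that(1)]] by (intro subst_cong[of _ Y]) (auto simp: s)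
    then show ?thesis using invarsD[OF gX(1)[OF that(1)] s(2)] by simp
  qed
  then have 1: "g v \<in> ?I" if "v \<in> X" for v
    using that invars_polys[OF gX(1)[OF that]] polys_mono[of Y "insert k Y"] by (auto simp: invars_def)
  have orb_sub: "subst s (orb k Z ^ e) = orb k Z ^ e" if "s \<in> affine_ext k Z C S" for s
  proof -
    obtain s0 c h where s: "s = s0(k := Const c * Var k + h)" "s0 \<in> S" "c \<in> C" "h \<in> lforms Z"
      using \<open>s \<in> affine_ext k Z C S\<close> by (auto simp: affine_ext_def)
    obtain t where t: "\<And>i. i \<in> Z \<Longrightarrow> s0 i \<in> lforms Z" "\<And>i. i \<in> Z \<Longrightarrow> subst t (s0 i) = Var i"
      using aut[OF s(2)] by (auto simp: linear_auto_def)
    have "subst s (orb k Z) = Const c * orb k Z"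
      by (rule subst_orb[OF Z(2) Ce(1)[OF s(3)] s(4), where t = t]) (use t kZ in \<open>auto simp: s(1)\<close>)
    then show ?thesis using Ce(2)[OF s(3)] by (simp add: power_mult_distrib Const_power)
  qed
  have 2: "orb k Z ^ e \<in> ?I"
    using orb_sub orb_polys[of k Z] polys_mono[of "insert k Z" "insert k Y"] Z(1)
    by (auto simp: invars_def)
  show gI: "?g v \<in> ?I" if "v \<in> insert n X" for v
    using that 1 2 by auto
  show "?g v \<in> homog two (?w v)" if "v \<in> insert n X" for v
    using that gX(2) homog_power[OF orb_homog[OF Z(2), where 'k = "'p mod_ring"], of k e] by auto
  show "freely_gen X ?w (\<lambda>v. subst (Var(k := 0)) (?g v)) (invars Y S)"
  proof (rule freely_gen_cong[OF G])
    fix v assume v: "v \<in> X"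
    have "subst (Var(k := 0)) (g v) = g v"
      by (rule subst_id_on[OF invars_polys[OF gX(1)[OF v]]]) (use k in auto)
    then show "subst (Var(k := 0)) (?g v) = g v" using v n by auto
  qed (use n in auto)
  show "subst (Var(k := 0)) (?g n) = 0"
    using e by (simp add: orb_restrict[OF Z(2)] zero_power)
  fix f :: "'p mod_ring mpoly" assume f: "f \<in> ?I"
  note fp = invars_polys[OF f]
  show "subst (Var(k := 0)) f \<in> invars Y S"
    unfolding invars_def
  proof (intro CollectI conjI ballI)
    show "subst (Var(k := 0)) f \<in> polys Y"
      by (rule polys_subst[OF fp]) auto
    fix s assume s: "s \<in> S"
    \<comment> \<open>The extension of \<open>s\<close> that fixes the new variable.\<close>
    let ?s = "s(k := Const 1 * Var k + 0)"
    have "subst s (subst (Var(k := 0)) f) = subst (Var(k := 0)) (subst ?s f)"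
      unfolding subst_subst
    proof (rule subst_cong[OF fp])
      fix i assume "i \<in> insert k Y"
      moreover have "subst (Var(k := 0)) (s i) = s i" if "i \<in> Y"
        by (rule subst_id_on[OF pol[OF s that]]) (use k in auto)
      ultimately show "subst s ((Var(k := 0)) i) = subst (Var(k := 0)) (?s i)" by auto
    qed
    also have "subst ?s f = f" by (rule invarsD[OF f affine_extI[OF s C1 l0]])
    finally show "subst s (subst (Var(k := 0)) f) = subst (Var(k := 0)) f" .
  qed
  assume z: "subst (Var(k := 0)) f = 0"
  have "Var k ^ e dvd f"
  proof (cases "e = 1")
    case True
    then show ?thesis using z by (simp add: Var_dvd_iff)
  next
    case False
    then have C': "C = - {0}" "e = CARD('p) - 1" using C by auto
    show ?thesis unfolding C'
    proof (rule Var_power_dvd_scaling_invariant[OF _ z])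
      fix a :: "'p mod_ring" assume "a \<noteq> 0"
      then show "subst (Var(k := Const a * Var k)) f = f"
        using invarsD[OF f affine_extI[OF id _ l0, of a]] by (simp add: C')
    qed
  qed
  \<comment> \<open>The factor \<open>A\<close> of \<open>orb_power_dvd\<close> is 1, as nothing has
    been split off before.\<close>
  then have "(1 * orb k Z) ^ e dvd f"
  proof (rule orb_power_dvd[OF kZ Z(2), rotated 3])
    fix h :: "'p mod_ring mpoly" assume "h \<in> lforms Z"
    then show "subst (Var(k := Var k + h)) f = f"
      using invarsD[OF f affine_extI[OF id C1, of h]] by simp
  qed auto
  then have "orb k Z ^ e dvd f" by simp
  then show "\<exists>f'\<in>?I. f = ?g n * f'"
    using invars_dvd[OF f 2 nz] by simp
qed (rule subalg_invars)

section \<open>Invertibility of the substitutions\<close>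

lemma SL3s_id: "distinct [i, j, k] \<Longrightarrow> Var \<in> SL3s i j k"
  by (rule SL3sI[of 1 0 0 0 1 0 0 0 1]) (auto simp: det3_def)

lemma SL3s_linear_auto:
  assumes d: "distinct [i, j, k]" and s: "s \<in> SL3s i j k"
  shows "linear_auto {i, j, k} (s :: nat \<Rightarrow> 'k::field mpoly)"
proof -
  obtain a1 b1 c1 a2 b2 c2 a3 b3 c3 :: 'k where
    s: "s = Var(i := Const a1 * Var i + Const b1 * Var j + Const c1 * Var k,
                j := Const a2 * Var i + Const b2 * Var j + Const c2 * Var k,
                k := Const a3 * Var i + Const b3 * Var j + Const c3 * Var k)"
    and det: "det3 a1 b1 c1 a2 b2 c2 a3 b3 c3 = 1"
    using s unfolding SL3s_def by blast
  \<comment> \<open>The adjugate matrix, which is the inverse because the determinant is 1.\<close>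
  define t where
    "t = Var(i := Const (b2*c3 - c2*b3) * Var i + Const (c1*b3 - b1*c3) * Var j + Const (b1*c2 - c1*b2) * Var k,
             j := Const (c2*a3 - a2*c3) * Var i + Const (a1*c3 - c1*a3) * Var j + Const (c1*a2 - a1*c2) * Var k,
             k := Const (a2*b3 - b2*a3) * Var i + Const (b1*a3 - a1*b3) * Var j + Const (a1*b2 - b1*a2) * Var k)"
  have lc: "Const a * (Const u1 * x + Const v1 * y + Const w1 * z) + Const b * (Const u2 * x + Const v2 * y + Const w2 * z)
      + Const c * (Const u3 * x + Const v3 * y + Const w3 * z)
    = Const (a * u1 + b * u2 + c * u3) * x + Const (a * v1 + b * v2 + c * v3) * y + Const (a * w1 + b * w2 + c * w3) * z"
    for a b c u1 v1 w1 u2 v2 w2 u3 v3 w3 :: 'k and x y z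
    unfolding single_add Const_mult by (simp only: algebra_simps)
  have t: "t i = Const (b2*c3 - c2*b3) * Var i + Const (c1*b3 - b1*c3) * Var j + Const (b1*c2 - c1*b2) * Var k"
    "t j = Const (c2*a3 - a2*c3) * Var i + Const (a1*c3 - c1*a3) * Var j + Const (c1*a2 - a1*c2) * Var k"
    "t k = Const (a2*b3 - b2*a3) * Var i + Const (b1*a3 - a1*b3) * Var j + Const (a1*b2 - b1*a2) * Var k"
    using d by (auto simp: t_def)
  have ts: "subst t (s i) = Const a1 * t i + Const b1 * t j + Const c1 * t k"
    "subst t (s j) = Const a2 * t i + Const b2 * t j + Const c2 * t k"
    "subst t (s k) = Const a3 * t i + Const b3 * t j + Const c3 * t k"
    using d by (auto simp: s)
  have sc: "a1 * (b2*c3 - c2*b3) + b1 * (c2*a3 - a2*c3) + c1 * (a2*b3 - b2*a3) = 1"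
    "a2 * (c1*b3 - b1*c3) + b2 * (a1*c3 - c1*a3) + c2 * (b1*a3 - a1*b3) = 1"
    "a3 * (b1*c2 - c1*b2) + b3 * (c1*a2 - a1*c2) + c3 * (a1*b2 - b1*a2) = 1"
    using det by (simp_all add: det3_def algebra_simps)
  have z: "a1 * (c1*b3 - b1*c3) + b1 * (a1*c3 - c1*a3) + c1 * (b1*a3 - a1*b3) = 0"
    "a1 * (b1*c2 - c1*b2) + b1 * (c1*a2 - a1*c2) + c1 * (a1*b2 - b1*a2) = 0"
    "a2 * (b2*c3 - c2*b3) + b2 * (c2*a3 - a2*c3) + c2 * (a2*b3 - b2*a3) = 0"
    "a2 * (b1*c2 - c1*b2) + b2 * (c1*a2 - a1*c2) + c2 * (a1*b2 - b1*a2) = 0"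
    "a3 * (b2*c3 - c2*b3) + b3 * (c2*a3 - a2*c3) + c3 * (a2*b3 - b2*a3) = 0"
    "a3 * (c1*b3 - b1*c3) + b3 * (a1*c3 - c1*a3) + c3 * (b1*a3 - a1*b3) = 0"
    by (simp_all add: algebra_simps)
  have "subst t (s i) = Var i" "subst t (s j) = Var j" "subst t (s k) = Var k"
    unfolding ts t lc sc z by simp_all
  moreover have "s v \<in> lforms {i, j, k}" if "v \<in> {i, j, k}" for v
    using that d by (auto simp: s intro!: lforms_add lforms_Const_mult lforms_Var)
  ultimately show ?thesis unfolding linear_auto_def by blast
qed

text \<open>Needed for iterated extension: the second step translates by linear forms that involve
  the variable adjoined in the first.\<close>

lemma linear_auto_ext:
  assumes "linear_auto Y s" "k \<notin> Y" "c \<noteq> 0"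
  shows "linear_auto (insert k Y) (s(k := Const c * Var k))"
proof -
  obtain t where t: "\<And>i. i \<in> Y \<Longrightarrow> s i \<in> lforms Y" "\<And>i. i \<in> Y \<Longrightarrow> subst t (s i) = Var i"
    using assms(1) by (auto simp: linear_auto_def)
  have "subst (t(k := Const (inverse c) * Var k)) ((s(k := Const c * Var k)) i) = Var i" if "i \<in> insert k Y" for i
  proof (cases "i = k")
    case True
    have "Const c * (Const (inverse c) * Var k) = Const (c * inverse c) * Var k"
      by (simp only: Const_mult mult.assoc)
    then show ?thesis using assms(3) True by simp
  next
    case False
    then have i: "i \<in> Y" using that by simp
    have "subst (t(k := Const (inverse c) * Var k)) (s i) = subst t (s i)"
      by (rule subst_cong[of _ Y]) (use t(1)[OF i] assms(2) in \<open>auto simp: lforms_def\<close>)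
    then show ?thesis using t(2)[OF i] False by simp
  qed
  moreover have "(s(k := Const c * Var k)) i \<in> lforms (insert k Y)" if "i \<in> insert k Y" for i
    using that t(1) polys_mono[of Y "insert k Y"] assms(2)
    by (auto intro!: lforms_Const_mult lforms_Var) (auto simp: lforms_def)
  ultimately show ?thesis unfolding linear_auto_def by blast
qed

text \<open>Matrix substitutions and the explicit ones differ outside \<open>Y\<close>, so the
  groups can only be compared through their values on \<open>Y\<close>.\<close>

lemma invars_mono_cong:
  assumes "\<And>s. s \<in> S \<Longrightarrow> \<exists>s'\<in>S'. \<forall>i\<in>Y. s i = s' i"
  shows "invars Y S' \<subseteq> invars Y S"
proof
  fix f assume f: "f \<in> invars Y S'"
  have "subst s f = f" if "s \<in> S" for s
  proof -
    from assms[OF that] obtain s' where s': "s' \<in> S'" "\<forall>i\<in>Y. s i = s' i" by blast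
    have "subst s f = subst s' f" by (rule subst_cong[OF invars_polys[OF f]]) (use s' in auto)
    then show ?thesis using invarsD[OF f s'(1)] by simp
  qed
  then show "f \<in> invars Y S" using invars_polys[OF f] by (simp add: invars_def)
qed

lemma lforms_sum:
  assumes "finite Y" "(h :: 'k::field mpoly) \<in> lforms Y"
  shows "\<exists>c. h = (\<Sum>i\<in>Y. Const (c i) * Var i)"
  using assms
proof (induction Y arbitrary: h rule: finite_induct)
  case empty
  then show ?case by (simp add: lforms_empty)
next
  case (insert j Y)
  have "h \<in> (\<lambda>(b, h). Const b * Var j + h) ` (UNIV \<times> lforms Y)"
    using bij_betw_imp_surj_on[OF lforms_insert[OF insert(2), where 'k = 'k]] insert.prems by simp
  then obtain b h' where h: "h = Const b * Var j + h'" "h' \<in> lforms Y" by auto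
  obtain c where c: "h' = (\<Sum>i\<in>Y. Const (c i) * Var i)" using insert.IH[OF h(2)] by blast
  have "h = (\<Sum>i\<in>insert j Y. Const ((c(j := b)) i) * Var i)"
    using insert.hyps by (simp add: h(1) c) (intro sum.cong; auto)
  then show ?case by blast
qed

section \<open>Matrices acting by substitution\<close>

definition mat_subst :: "nat \<Rightarrow> 'k::field mat \<Rightarrow> nat \<Rightarrow> 'k mpoly" where
  "mat_subst n M i = (\<Sum>j<n. Const (M $$ (i, j)) * Var j)"

lemma mat_subst_homog: "mat_subst n M i \<in> homog two 2"
  unfolding mat_subst_def using homog_Var[of _ two] by (intro homog_sum homog_Const_mult) auto

lemma sum_lessThan_numeral:
  fixes f :: "nat \<Rightarrow> 'a::comm_monoid_add"
  shows "(\<Sum>j<3. f j) = f 0 + f 1 + f 2" "(\<Sum>j<4. f j) = f 0 + f 1 + f 2 + f 3"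
    "(\<Sum>j<5. f j) = f 0 + f 1 + f 2 + f 3 + f 4"
  by (simp_all add: eval_nat_numeral One_nat_def)

lemma det_mat3:
  fixes A :: "'k::comm_ring_1 mat"
  assumes A: "A \<in> carrier_mat 3 3"
  shows "det A = det3 (A $$ (0,0)) (A $$ (0,1)) (A $$ (0,2)) (A $$ (1,0)) (A $$ (1,1)) (A $$ (1,2))
     (A $$ (2,0)) (A $$ (2,1)) (A $$ (2,2))"
proof -
  have d2: "det B = B $$ (0,0) * B $$ (1,1) - B $$ (0,1) * B $$ (1,0)" if B: "B \<in> carrier_mat 2 2" for B :: "'k mat"
  proof -
    have "det B = (\<Sum>j<2. B $$ (0, j) * cofactor B 0 j)"
      by (rule laplace_expansion_row[OF B]) simp
    also have "\<dots> = B $$ (0,0) * det (mat_delete B 0 0) - B $$ (0,1) * det (mat_delete B 0 1)"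
      by (simp add: numeral_2_eq_2 One_nat_def cofactor_def)
    also have "det (mat_delete B 0 0) = B $$ (1,1)"
      by (subst det_single) (use B in \<open>auto simp: mat_delete_def One_nat_def\<close>)
    also have "det (mat_delete B 0 1) = B $$ (1,0)"
      by (subst det_single) (use B in \<open>auto simp: mat_delete_def One_nat_def\<close>)
    finally show ?thesis .
  qed
  have "det A = (\<Sum>j<3. A $$ (0, j) * cofactor A 0 j)"
    by (rule laplace_expansion_row[OF A]) simp
  also have "\<dots> = A $$ (0,0) * det (mat_delete A 0 0) - A $$ (0,1) * det (mat_delete A 0 1) + A $$ (0,2) * det (mat_delete A 0 2)"
    by (simp add: sum_lessThan_numeral cofactor_def)
  finally show ?thesis
    using A by (simp add: d2 mat_delete_carrier[OF A, simplified] det3_def mat_delete_def numeral_2_eq_2 One_nat_def)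
qed

text \<open>The offset \<open>m\<close> is the first variable of the block: 0 for SL_3 itself, 1 in
  the parabolic groups, where variable 0 belongs to the corner entry.\<close>

definition sl_subst :: "nat \<Rightarrow> 'k::field mat \<Rightarrow> nat \<Rightarrow> 'k mpoly" where
  "sl_subst m M = (\<lambda>i. if i \<in> {m..<m + 3} then \<Sum>j<3. Const (M $$ (i - m, j)) * Var (m + j) else Var i)"

lemma sl_subst_eq: "sl_subst m M =
    Var(m := Const (M $$ (0,0)) * Var m + Const (M $$ (0,1)) * Var (m + 1) + Const (M $$ (0,2)) * Var (m + 2),
        m + 1 := Const (M $$ (1,0)) * Var m + Const (M $$ (1,1)) * Var (m + 1) + Const (M $$ (1,2)) * Var (m + 2),
        m + 2 := Const (M $$ (2,0)) * Var m + Const (M $$ (2,1)) * Var (m + 1) + Const (M $$ (2,2)) * Var (m + 2))"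
proof
  fix v
  consider "v = m" | "v = m + 1" | "v = m + 2" | "v \<notin> {m..<m + 3}" by force
  then show "sl_subst m M v = (Var(m := Const (M $$ (0,0)) * Var m + Const (M $$ (0,1)) * Var (m + 1) + Const (M $$ (0,2)) * Var (m + 2),
        m + 1 := Const (M $$ (1,0)) * Var m + Const (M $$ (1,1)) * Var (m + 1) + Const (M $$ (1,2)) * Var (m + 2),
        m + 2 := Const (M $$ (2,0)) * Var m + Const (M $$ (2,1)) * Var (m + 1) + Const (M $$ (2,2)) * Var (m + 2))) v"
    by cases (auto simp: sl_subst_def sum_lessThan_numeral)
qed

lemma SL3s_mat: "SL3s m (m + 1) (m + 2) = sl_subst m ` (SL 3 :: 'k::field mat set)"
proof (intro equalityI subsetI)
  fix s :: "nat \<Rightarrow> 'k mpoly" assume "s \<in> SL3s m (m + 1) (m + 2)"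
  then obtain a1 b1 c1 a2 b2 c2 a3 b3 c3 :: 'k where
    s: "s = Var(m := Const a1 * Var m + Const b1 * Var (m+1) + Const c1 * Var (m+2),
                m+1 := Const a2 * Var m + Const b2 * Var (m+1) + Const c2 * Var (m+2),
                m+2 := Const a3 * Var m + Const b3 * Var (m+1) + Const c3 * Var (m+2))"
    and det: "det3 a1 b1 c1 a2 b2 c2 a3 b3 c3 = 1"
    unfolding SL3s_def by blast
  let ?M = "mat_of_rows_list 3 [[a1, b1, c1], [a2, b2, c2], [a3, b3, c3]]"
  have M: "?M \<in> carrier_mat 3 3" by (auto simp: mat_of_rows_list_def)
  have e: "?M $$ (0,0) = a1" "?M $$ (0,1) = b1" "?M $$ (0,2) = c1" "?M $$ (1,0) = a2" "?M $$ (1,1) = b2" "?M $$ (1,2) = c2"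
    "?M $$ (2,0) = a3" "?M $$ (2,1) = b3" "?M $$ (2,2) = c3"
    by (simp_all add: mat_of_rows_list_def)
  have "?M \<in> SL 3" unfolding SL_def mem_Collect_eq det_mat3[OF M] e using M det by simp
  moreover have "s = sl_subst m ?M" unfolding sl_subst_eq e s ..
  ultimately show "s \<in> sl_subst m ` SL 3" by blast
next
  fix s :: "nat \<Rightarrow> 'k mpoly" assume "s \<in> sl_subst m ` SL 3"
  then obtain M where M: "M \<in> carrier_mat 3 3" "det M = 1" "s = sl_subst m M" by (auto simp: SL_def)
  have "det3 (M $$ (0,0)) (M $$ (0,1)) (M $$ (0,2)) (M $$ (1,0)) (M $$ (1,1)) (M $$ (1,2))
     (M $$ (2,0)) (M $$ (2,1)) (M $$ (2,2)) = 1"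
    using M(2) unfolding det_mat3[OF M(1)] .
  then show "s \<in> SL3s m (m + 1) (m + 2)"
    unfolding SL3s_def M(3) sl_subst_eq by blast
qed

lemma GL1_iff: "g \<in> GL 1 \<longleftrightarrow> g \<in> carrier_mat 1 1 \<and> g $$ (0,0) \<noteq> (0 :: 'k::field)"
proof (intro iffI conjI; (elim conjE)?)
  assume "g \<in> GL 1"
  then have g: "g \<in> carrier_mat 1 1" and "invertible_mat g" by (auto simp: GL_def)
  then obtain B where B: "g * B = 1\<^sub>m 1" "B * g = 1\<^sub>m (dim_row B)" by (auto simp: invertible_mat_def inverts_mat_def)
  have dims: "dim_row B = 1" "dim_col B = 1"
    using B g by (metis carrier_matD index_mult_mat(2,3) index_one_mat(2,3))+
  have "(g * B) $$ (0,0) = g $$ (0,0) * B $$ (0,0)"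
    using g dims by (simp add: scalar_prod_def One_nat_def)
  then show "g $$ (0,0) \<noteq> 0" using B(1) by auto
  show "g \<in> carrier_mat 1 1" by (rule g)
next
  assume g: "g \<in> carrier_mat 1 1" "g $$ (0,0) \<noteq> 0"
  let ?B = "mat 1 1 (\<lambda>_. inverse (g $$ (0,0)))"
  have "g * ?B = 1\<^sub>m 1" "?B * g = 1\<^sub>m 1"
    using g by (auto intro!: eq_matI simp: scalar_prod_def)
  then show "g \<in> GL 1"
    using g by (auto simp: GL_def invertible_mat_def inverts_mat_def intro!: exI[of _ ?B])
qed

section \<open>The five Weyl groups\<close>

text \<open>The action is by inverses, so inversion has to permute W(A). This follows from the
  centralizer being normal in the normalizer.\<close>

lemma (in group) weyl_group_is_group:
  assumes "subgroup A G"
  shows "group (weyl_group G A)"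
proof -
  have AG: "A \<subseteq> carrier G" using assms by (rule subgroup.subset)
  let ?N = "normalizer G A" and ?C = "centralizer G A"
  have N: "subgroup ?N G" by (rule normalizer_imp_subgroup[OF AG])
  have Ndef: "g \<in> ?N \<longleftrightarrow> g \<in> carrier G \<and> l_coset G g A #> inv g = A" for g
    using AG by (auto simp: normalizer_def stabilizer_def)
  have conj: "g \<otimes> a \<otimes> inv g \<in> A" if "g \<in> ?N" "a \<in> A" for g a
    using that Ndef[of g] by (auto simp: l_coset_def r_coset_def)
  interpret N: group "G\<lparr>carrier := ?N\<rparr>" by (rule subgroup_imp_group[OF N])
  have C: "subgroup ?C G"
  proof (rule subgroupI)
    show "?C \<subseteq> carrier G" by (auto simp: centralizer_def)
    show "?C \<noteq> {}" using AG by (auto simp: centralizer_def intro!: exI[of _ \<one>])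
    fix g assume g: "g \<in> ?C"
    then have gG: "g \<in> carrier G" and c: "\<And>a. a \<in> A \<Longrightarrow> g \<otimes> a = a \<otimes> g" by (auto simp: centralizer_def)
    show "inv g \<in> ?C" unfolding centralizer_def
    proof (intro CollectI conjI ballI)
      fix a assume a: "a \<in> A"
      then have aG: "a \<in> carrier G" using AG by blast
      have "inv g \<otimes> a = inv g \<otimes> (a \<otimes> g) \<otimes> inv g" using gG aG by (simp add: m_assoc)
      also have "\<dots> = a \<otimes> inv g" using gG aG by (simp add: c[OF a, symmetric] m_assoc[symmetric])
      finally show "inv g \<otimes> a = a \<otimes> inv g" .
    qed (use gG in simp)
    fix h assume h: "h \<in> ?C"
    then have hG: "h \<in> carrier G" and d: "\<And>a. a \<in> A \<Longrightarrow> h \<otimes> a = a \<otimes> h" by (auto simp: centralizer_def)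
    show "g \<otimes> h \<in> ?C" unfolding centralizer_def
    proof (intro CollectI conjI ballI)
      fix a assume a: "a \<in> A"
      then have aG: "a \<in> carrier G" using AG by blast
      have "g \<otimes> h \<otimes> a = g \<otimes> (a \<otimes> h)" using gG hG aG by (simp add: m_assoc d[OF a])
      also have "\<dots> = a \<otimes> (g \<otimes> h)" using gG hG aG by (simp add: m_assoc[symmetric] c[OF a])
      finally show "g \<otimes> h \<otimes> a = a \<otimes> (g \<otimes> h)" .
    qed (use gG hG in simp)
  qed
  have CN: "?C \<subseteq> ?N"
  proof
    fix g assume g: "g \<in> ?C"
    then have gG: "g \<in> carrier G" and c: "\<And>a. a \<in> A \<Longrightarrow> g \<otimes> a = a \<otimes> g" by (auto simp: centralizer_def)
    have "g \<otimes> a \<otimes> inv g = a" if "a \<in> A" for a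
      using that gG AG by (auto simp: c[OF that] m_assoc)
    then have "l_coset G g A #> inv g = A" by (auto simp: l_coset_def r_coset_def)
    then show "g \<in> ?N" using gG Ndef by blast
  qed
  have "?C \<lhd> G\<lparr>carrier := ?N\<rparr>"
  proof (rule N.normal_invI)
    show "subgroup ?C (G\<lparr>carrier := ?N\<rparr>)" by (rule subgroup_incl[OF C N CN])
    fix x h assume x: "x \<in> carrier (G\<lparr>carrier := ?N\<rparr>)" and h: "h \<in> ?C"
    then have xN: "x \<in> ?N" by simp
    then have xG: "x \<in> carrier G" using Ndef by blast
    have ixN: "inv x \<in> ?N" using N xN by (rule subgroup.m_inv_closed)
    have hG: "h \<in> carrier G" and c: "\<And>a. a \<in> A \<Longrightarrow> h \<otimes> a = a \<otimes> h" using h by (auto simp: centralizer_def)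
    have "x \<otimes> h \<otimes> inv x \<in> ?C" unfolding centralizer_def
    proof (intro CollectI conjI ballI)
      fix a assume a: "a \<in> A"
      then have aG: "a \<in> carrier G" using AG by blast
      \<comment> \<open>As \<open>x\<close> normalizes \<open>A\<close>, this conjugate lies in
        \<open>A\<close> and commutes with \<open>h\<close>; conjugating back by \<open>x\<close>
        gives the claim for \<open>a\<close>.\<close>
      define b where "b = inv x \<otimes> a \<otimes> x"
      have b: "b \<in> A" using conj[OF ixN a] xG by (simp add: b_def)
      have bG: "b \<in> carrier G" using b AG by blast
      have 1: "inv x \<otimes> a = b \<otimes> inv x" and 2: "a \<otimes> x = x \<otimes> b"
        using xG aG by (simp_all add: b_def m_assoc) (simp_all add: m_assoc[symmetric])
      have "x \<otimes> h \<otimes> inv x \<otimes> a = x \<otimes> (h \<otimes> b) \<otimes> inv x"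
        using xG hG aG bG by (simp add: m_assoc 1)
      also have "\<dots> = a \<otimes> (x \<otimes> h \<otimes> inv x)"
        using xG hG aG bG by (simp add: m_assoc[symmetric] c[OF b] 2)
      finally show "x \<otimes> h \<otimes> inv x \<otimes> a = a \<otimes> (x \<otimes> h \<otimes> inv x)" .
    qed (use xG hG in simp)
    then show "x \<otimes>\<^bsub>G\<lparr>carrier := ?N\<rparr>\<^esub> h \<otimes>\<^bsub>G\<lparr>carrier := ?N\<rparr>\<^esub> inv\<^bsub>G\<lparr>carrier := ?N\<rparr>\<^esub> x \<in> ?C"
      using m_inv_consistent[OF N xN] by simp
  qed
  then show ?thesis unfolding weyl_group_def by (rule normal.factorgroup_is_group)
qed

text \<open>Inversion permutes W(A), so being fixed by all inverses is being fixed by all matrices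
  of \<open>M\<close>; the invariants depend on \<open>M\<close> alone.\<close>

lemma GammaH_invariants_eq:
  fixes G :: "('g, 'm) monoid_scheme" and M :: "'p::prime_card mod_ring mat set"
  assumes "elab_with_weyl_group G A v M"
  defines "I \<equiv> invars {..<length v} (mat_subst (length v) ` M)"
  shows "total (GammaH_invariants G A v) = I" "component (GammaH_invariants G A v) d = I \<inter> homog two d"
proof -
  let ?n = "length v" and ?W = "weyl_group G A"
  have G: "group G" "subgroup A G" and M: "weyl_mat G A v ` carrier ?W = M"
    using assms(1) by (auto simp: elab_with_weyl_group_def elementary_abelian_def)
  interpret W: group ?W by (rule group.weyl_group_is_group[OF G])
  have inv_img: "(\<lambda>w. inv\<^bsub>?W\<^esub> w) ` carrier ?W = carrier ?W"
    using W.inv_inv W.inv_closed by (metis (no_types, lifting) image_eqI image_subsetI subsetI subset_antisym)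
  have fix_iff: "(\<forall>w\<in>carrier ?W. weyl_act G A v w f = f) \<longleftrightarrow> (\<forall>s\<in>mat_subst ?n ` M. subst s f = f)" for f
  proof -
    have "(\<forall>w\<in>carrier ?W. weyl_act G A v w f = f)
        \<longleftrightarrow> (\<forall>w\<in>(\<lambda>w. inv\<^bsub>?W\<^esub> w) ` carrier ?W. subst (mat_subst ?n (weyl_mat G A v w)) f = f)"
      by (simp add: weyl_act_def mat_subst_def[abs_def])
    also have "\<dots> \<longleftrightarrow> (\<forall>s\<in>mat_subst ?n ` M. subst s f = f)"
      unfolding inv_img by (simp add: M[symmetric])
    finally show ?thesis .
  qed
  \<comment> \<open>The lookup in the list of degrees equals 2 only for indices in range, hence the
    condition on the variables of \<open>m\<close>.\<close>
  have w: "(\<Sum>i\<in>keys m. lookup m i * replicate ?n 2 ! i) = wt two m" if "keys m \<subseteq> {..<?n}" for m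
    unfolding wt_def by (intro sum.cong refl) (use that in auto)
  show "total (GammaH_invariants G A v) = I"
    unfolding I_def invars_def polys_def GammaH_invariants_def GammaH_def poly_alg_def Let_def fix_iff by auto
  show "component (GammaH_invariants G A v) d = I \<inter> homog two d"
    unfolding I_def invars_def polys_def homog_def GammaH_invariants_def GammaH_def poly_alg_def Let_def fix_iff
    by (auto simp: w)
qed

theorem GammaH_invariants_iso:
  fixes G :: "('g, 'm) monoid_scheme" and M :: "'p::prime_card mod_ring mat set"
  assumes W: "elab_with_weyl_group G A v M" and n: "length v = n"
    and M: "invars {..<n} (mat_subst n ` M) = I"
    and G: "freely_gen {..<n} ((!) ds) g I" and ds: "length ds = n"
  shows "(GammaH_invariants G A v :: 'p mod_ring mpoly graded_alg) \<cong>\<^sub>g\<^sub>r poly_alg ds"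
proof (rule freely_gen_iso[where I = I and g = g])
  show "freely_gen {..<length ds} ((!) ds) g I"
    using G ds by simp
  show "subalg I" unfolding M[symmetric] by (rule subalg_invars)
  show "hcomp two d f \<in> I" if "f \<in> I" for d f
    using that unfolding M[symmetric] by (rule invars_hcomp) (auto intro: mat_subst_homog)
qed (use GammaH_invariants_eq[OF W] M n in auto)

section \<open>The block matrix groups as iterated extensions\<close>

lemma invars_SL3:
  "invars {..<3} (mat_subst 3 ` SL 3) = (invars {0, 1, 2} (SL3s 0 1 2) :: 'k::field mpoly set)"
proof -
  have e: "mat_subst 3 M i = sl_subst 0 M i" if "i \<in> {0,1,2}" for M i
    using that by (auto simp: mat_subst_def sl_subst_def)
  have Y: "{..<3} = {0, 1, 2 :: nat}" by auto
  have S: "SL3s 0 1 2 = sl_subst 0 ` (SL 3 :: 'k mat set)" using SL3s_mat[of 0] by (simp only: add_0)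
  show ?thesis unfolding Y S
  proof (intro equalityI invars_mono_cong)
    fix s :: "nat \<Rightarrow> 'k mpoly" assume "s \<in> sl_subst 0 ` SL 3"
    then obtain M where "M \<in> SL 3" "s = sl_subst 0 M" by blast
    then show "\<exists>s'\<in>mat_subst 3 ` SL 3. \<forall>i\<in>{0, 1, 2}. s i = s' i"
      by (intro bexI[of _ "mat_subst 3 M"]) (simp_all add: e)
  next
    fix s :: "nat \<Rightarrow> 'k mpoly" assume "s \<in> mat_subst 3 ` SL 3"
    then obtain M where "M \<in> SL 3" "s = mat_subst 3 M" by blast
    then show "\<exists>s'\<in>sl_subst 0 ` SL 3. \<forall>i\<in>{0, 1, 2}. s i = s' i"
      by (intro bexI[of _ "sl_subst 0 M"]) (simp_all add: e)
  qed
qed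

text \<open>Row \<open>i\<close> of the matrix is the image of variable \<open>i\<close>. The top
  row therefore scales and translates variable 0, and the zero column below it keeps the other
  images free of that variable.\<close>

lemma mat_subst_block4:
  assumes "g1 \<in> carrier_mat 1 1" "m0 \<in> carrier_mat 1 3" "g2 \<in> carrier_mat 3 3" "i < 4"
  shows "mat_subst 4 (four_block_mat g1 m0 (0\<^sub>m 3 1) g2) i =
    ((sl_subst 1 g2)(0 := Const (g1 $$ (0,0)) * Var 0 + (\<Sum>j<3. Const (m0 $$ (0,j)) * Var (1 + j)))) i"
proof -
  have "i = 0 \<or> i = 1 \<or> i = 2 \<or> i = 3" using assms(4) by linarith
  then show ?thesis
    using assms(1-3) by (elim disjE) (simp_all add: mat_subst_def sl_subst_def sum_lessThan_numeral add.assoc flip: One_nat_def)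
qed

text \<open>The set \<open>C\<close> of allowed corner entries serves both groups of rank 4: it is
  {1} for E_6 and all nonzero scalars for E_7.\<close>

lemma invars_block4:
  fixes C :: "'k::field set"
  shows "invars {..<4} (mat_subst 4 ` {four_block_mat g1 m0 (0\<^sub>m 3 1) g2 |g1 m0 g2.
      g1 \<in> carrier_mat 1 1 \<and> g1 $$ (0,0) \<in> C \<and> m0 \<in> carrier_mat 1 3 \<and> g2 \<in> SL 3})
    = invars (insert 0 {1, 2, 3}) (affine_ext 0 {1, 2, 3} C (SL3s 1 2 3))"
    (is "invars _ (mat_subst 4 ` ?W) = invars _ ?E")
proof -
  have Y: "insert 0 {1, 2, 3} = {..<4 :: nat}" by auto
  have S: "SL3s 1 2 3 = sl_subst 1 ` (SL 3 :: 'k mat set)" using SL3s_mat[of 1] by simp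
  have 1: "\<exists>s'\<in>?E. \<forall>i\<in>{..<4}. s i = s' i" if "s \<in> mat_subst 4 ` ?W" for s
  proof -
    obtain g1 m0 g2 where s: "s = mat_subst 4 (four_block_mat g1 m0 (0\<^sub>m 3 1) g2)" "g1 \<in> carrier_mat 1 1"
      "g1 $$ (0,0) \<in> C" "m0 \<in> carrier_mat 1 3" "g2 \<in> SL 3"
      using \<open>s \<in> mat_subst 4 ` ?W\<close> by blast
    let ?s = "(sl_subst 1 g2)(0 := Const (g1 $$ (0,0)) * Var 0 + (\<Sum>j<3. Const (m0 $$ (0,j)) * Var (1 + j)))"
    have "?s \<in> ?E"
      using s(3,5) by (intro affine_extI) (auto simp: S sum_lessThan_numeral intro!: lforms_add lforms_Const_mult lforms_Var)
    moreover have "\<forall>i\<in>{..<4}. s i = ?s i"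
      unfolding s(1) using s(5) by (intro ballI mat_subst_block4[OF s(2,4)]) (auto simp: SL_def)
    ultimately show ?thesis by blast
  qed
  have 2: "\<exists>s'\<in>mat_subst 4 ` ?W. \<forall>i\<in>{..<4}. s i = s' i" if "s \<in> ?E" for s
  proof -
    obtain g2 a h where s: "s = (sl_subst 1 g2)(0 := Const a * Var 0 + h)" "g2 \<in> SL 3" "a \<in> C" "h \<in> lforms {1, 2, 3}"
      using \<open>s \<in> ?E\<close> unfolding S affine_ext_def by blast
    obtain c where c: "h = (\<Sum>i\<in>{1, 2, 3}. Const (c i) * Var i)" using lforms_sum[OF _ s(4)] by auto
    let ?g1 = "mat 1 1 (\<lambda>_. a)" and ?m0 = "mat 1 3 (\<lambda>(_, j). c (1 + j))"
    have "h = (\<Sum>j<3. Const (?m0 $$ (0,j)) * Var (1 + j))"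
      by (simp add: c sum_lessThan_numeral add.assoc)
    moreover have "?g1 \<in> carrier_mat 1 1" "?m0 \<in> carrier_mat 1 3" "g2 \<in> carrier_mat 3 3" "?g1 $$ (0,0) = a"
      using s(2) by (auto simp: SL_def)
    ultimately have "s i = mat_subst 4 (four_block_mat ?g1 ?m0 (0\<^sub>m 3 1) g2) i" if "i < 4" for i
      using mat_subst_block4[OF _ _ _ that, of ?g1 ?m0 g2] s(1) by simp
    moreover have "four_block_mat ?g1 ?m0 (0\<^sub>m 3 1) g2 \<in> ?W"
      using s(2,3) by (intro CollectI exI[of _ ?g1] exI[of _ ?m0] exI[of _ g2]) auto
    ultimately show ?thesis by blast
  qed
  show ?thesis unfolding Y
    by (intro equalityI invars_mono_cong) (use 1 2 in auto)
qed

lemma weyl_3E6_4_eq: "weyl_3E6_4 = {four_block_mat g1 m0 (0\<^sub>m 3 1) g2 |g1 m0 g2.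
      g1 \<in> carrier_mat 1 1 \<and> g1 $$ (0,0) \<in> {1 :: 'k::field} \<and> m0 \<in> carrier_mat 1 3 \<and> g2 \<in> SL 3}"
proof -
  have "g1 \<in> carrier_mat 1 1 \<and> g1 $$ (0,0) \<in> {1} \<longleftrightarrow> g1 = 1\<^sub>m 1" for g1 :: "'k mat"
    by (auto intro!: eq_matI)
  then show ?thesis unfolding weyl_3E6_4_def by (metis (no_types, lifting))
qed

lemma weyl_2E7_4_eq: "weyl_2E7_4 = {four_block_mat g1 m0 (0\<^sub>m 3 1) g2 |g1 m0 g2.
      g1 \<in> carrier_mat 1 1 \<and> g1 $$ (0,0) \<in> - {0 :: 'k::field} \<and> m0 \<in> carrier_mat 1 3 \<and> g2 \<in> SL 3}"
  unfolding weyl_2E7_4_def GL1_iff by auto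

lemma mat_subst_block5:
  assumes "g1 \<in> carrier_mat 1 1" "eps \<in> carrier_mat 1 1" "g2 \<in> carrier_mat 3 3" "m' \<in> carrier_mat 1 3"
    "m'' \<in> carrier_mat 1 1" "i < 5"
  shows "mat_subst 5 (four_block_mat (four_block_mat g1 m' (0\<^sub>m 3 1) g2) (m'' @\<^sub>r 0\<^sub>m 3 1) (0\<^sub>m 1 4) eps) i =
    ((sl_subst 1 g2)(4 := Const (eps $$ (0,0)) * Var 4 + 0, 0 := Const (g1 $$ (0,0)) * Var 0 +
       ((\<Sum>j<3. Const (m' $$ (0,j)) * Var (1 + j)) + Const (m'' $$ (0,0)) * Var 4))) i"
proof -
  have "i = 0 \<or> i = 1 \<or> i = 2 \<or> i = 3 \<or> i = 4" using assms(6) by linarith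
  then show ?thesis
    using assms(1-5)
    by (elim disjE) (simp_all add: mat_subst_def sl_subst_def sum_lessThan_numeral append_rows_def add.assoc flip: One_nat_def)
qed

text \<open>Two extensions of SL_3: first variable 4, scaled by the entry \<open>eps\<close> and not
  translated because the last row is otherwise 0; then variable 0, translated by all linear forms in
  the other four, with coefficients from \<open>m0'\<close> and \<open>m0''\<close>.\<close>

lemma invars_E8_5a:
  "invars {..<5} (mat_subst 5 ` weyl_E8_5a) = (invars (insert 0 (insert 4 {1, 2, 3}))
     (affine_ext 0 {1, 2, 3, 4} (- {0}) (affine_ext 4 {} (- {0}) (SL3s 1 2 3))) :: 'k::field mpoly set)"
    (is "_ = invars _ ?E")
proof -
  let ?W = "weyl_E8_5a :: 'k mat set"
  have Y: "insert 0 (insert 4 {1, 2, 3}) = {..<5 :: nat}" by auto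
  have S: "SL3s 1 2 3 = sl_subst 1 ` (SL 3 :: 'k mat set)" using SL3s_mat[of 1] by simp
  have 1: "\<exists>s'\<in>?E. \<forall>i\<in>{..<5}. s i = s' i" if "s \<in> mat_subst 5 ` ?W" for s
  proof -
    obtain g1 m' m'' g2 eps where
      s: "s = mat_subst 5 (four_block_mat (four_block_mat g1 m' (0\<^sub>m 3 1) g2) (m'' @\<^sub>r 0\<^sub>m 3 1) (0\<^sub>m 1 4) eps)"
      and g: "g1 \<in> GL 1" "eps \<in> GL 1" "g2 \<in> SL 3" "m' \<in> carrier_mat 1 3" "m'' \<in> carrier_mat 1 1"
      using \<open>s \<in> mat_subst 5 ` ?W\<close> unfolding weyl_E8_5a_def by blast
    let ?s = "(sl_subst 1 g2)(4 := Const (eps $$ (0,0)) * Var 4 + 0, 0 := Const (g1 $$ (0,0)) * Var 0 +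
       ((\<Sum>j<3. Const (m' $$ (0,j)) * Var (1 + j)) + Const (m'' $$ (0,0)) * Var 4))"
    have "?s \<in> ?E"
      using g(1-3)
      by (intro affine_extI)
         (auto simp: S GL1_iff lforms_empty sum_lessThan_numeral intro!: lforms_add lforms_Const_mult lforms_Var)
    moreover have "\<forall>i\<in>{..<5}. s i = ?s i"
      unfolding s using g by (intro ballI mat_subst_block5) (auto simp: SL_def GL1_iff)
    ultimately show ?thesis by blast
  qed
  have 2: "\<exists>s'\<in>mat_subst 5 ` ?W. \<forall>i\<in>{..<5}. s i = s' i" if "s \<in> ?E" for s
  proof -
    obtain g2 a e h where s: "s = (sl_subst 1 g2)(4 := Const e * Var 4 + 0, 0 := Const a * Var 0 + h)"
      and g: "g2 \<in> SL 3" "a \<noteq> 0" "e \<noteq> 0" "h \<in> lforms {1, 2, 3, 4}"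
    proof -
      obtain s1 a h where 1: "s = s1(0 := Const a * Var 0 + h)" "s1 \<in> affine_ext 4 {} (- {0}) (SL3s 1 2 3)"
        "a \<noteq> 0" "h \<in> lforms {1, 2, 3, 4}"
        using \<open>s \<in> ?E\<close> unfolding affine_ext_def[of 0] by blast
      obtain g2 e where "s1 = (sl_subst 1 g2)(4 := Const e * Var 4)" "g2 \<in> SL 3" "e \<noteq> 0"
        using 1(2) unfolding S affine_ext_def lforms_empty by auto
      then show ?thesis using that[of g2 e a h] 1 by simp
    qed
    obtain c where c: "h = (\<Sum>i\<in>{1, 2, 3, 4}. Const (c i) * Var i)" using lforms_sum[OF _ g(4)] by auto
    let ?g1 = "mat 1 1 (\<lambda>_. a)" and ?eps = "mat 1 1 (\<lambda>_. e)" and ?m' = "mat 1 3 (\<lambda>(_, j). c (1 + j))"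
      and ?m'' = "mat 1 1 (\<lambda>_. c 4)"
    have h: "h = (\<Sum>j<3. Const (?m' $$ (0,j)) * Var (1 + j)) + Const (?m'' $$ (0,0)) * Var 4"
      by (simp add: c sum_lessThan_numeral add.assoc)
    have g2: "g2 \<in> carrier_mat 3 3" using g(1) by (simp add: SL_def)
    let ?M = "four_block_mat (four_block_mat ?g1 ?m' (0\<^sub>m 3 1) g2) (?m'' @\<^sub>r 0\<^sub>m 3 1) (0\<^sub>m 1 4) ?eps"
    have "s i = mat_subst 5 ?M i" if "i < 5" for i
      unfolding s h using mat_subst_block5[OF _ _ g2 _ _ that, of ?g1 ?eps ?m' ?m''] by simp
    moreover have "?g1 \<in> GL 1" "?eps \<in> GL 1" using g(2,3) by (auto simp: GL1_iff)
    then have "?M \<in> ?W"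
      unfolding weyl_E8_5a_def mem_Collect_eq using g(1)
      by (intro exI conjI) (rule refl, simp_all)
    ultimately show ?thesis by blast
  qed
  show ?thesis unfolding Y
    by (intro equalityI invars_mono_cong) (use 1 2 in auto)
qed

section \<open>Generator degrees in the five cases\<close>

lemma linear_auto_polys: "linear_auto Y s \<Longrightarrow> i \<in> Y \<Longrightarrow> s i \<in> polys Y"
  by (auto simp: linear_auto_def lforms_def)

text \<open>The last degree is that of the \<open>e\<close>-th power of a product of p^3 linear
  factors, the translates of variable 0 by linear forms in three variables.\<close>

theorem freely_gen_block4:
  assumes C: "C = {1} \<and> e = 1 \<or> C = - {0} \<and> e = CARD('p) - 1"
  shows "\<exists>g. freely_gen {..<4} ((!) [2 * (1 + CARD('p) + CARD('p) ^ 2), 2 * (CARD('p) ^ 3 - CARD('p) ^ 2),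
      2 * (CARD('p) ^ 3 - CARD('p)), e * (2 * CARD('p) ^ 3)]) g
    (invars (insert 0 {1, 2, 3}) (affine_ext 0 {1, 2, 3} C (SL3s 1 2 3)) :: 'p::prime_card mod_ring mpoly set)"
proof -
  note g3 = freely_gen_SL3[of 1 2 3 0 1 2, where 'p = 'p]
  note g4 = freely_gen_ext[OF g3, of 0 3 "{1, 2, 3}", OF _ _ _ _ _ _ _ _ _ C]
  have X: "insert 3 {0, 2, 1} = {..<4 :: nat}" by auto
  have aut: "linear_auto {1, 2, 3} s" if "s \<in> SL3s 1 2 3" for s :: "nat \<Rightarrow> 'p mod_ring mpoly"
    by (rule SL3s_linear_auto[OF _ that]) simp
  show ?thesis
  proof (rule exI, rule freely_gen_cong[OF g4[unfolded X]])
    show "Var \<in> SL3s 1 2 3" by (rule SL3s_id) simp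
  qed (use aut linear_auto_polys in \<open>auto simp: less_Suc_eq numeral_eq_Suc\<close>)
qed

text \<open>The first extension has no translations, so its orbit product is \<open>Var 4\<close>
  and its generator the (p-1)-st power. The second has p^4 translates, again raised to the power
  p-1.\<close>

theorem freely_gen_block5:
  "\<exists>g. freely_gen {..<5} ((!) [2 * (CARD('p) - 1), 2 * (1 + CARD('p) + CARD('p) ^ 2), 2 * (CARD('p) ^ 3 - CARD('p) ^ 2),
      2 * (CARD('p) ^ 3 - CARD('p)), (CARD('p) - 1) * (2 * CARD('p) ^ 4)]) g
    (invars (insert 0 (insert 4 {1, 2, 3})) (affine_ext 0 {1, 2, 3, 4} (- {0}) (affine_ext 4 {} (- {0}) (SL3s 1 2 3)))
      :: 'p::prime_card mod_ring mpoly set)"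
proof -
  let ?S = "SL3s 1 2 3 :: (nat \<Rightarrow> 'p mod_ring mpoly) set" and ?e = "CARD('p) - 1"
  let ?T = "affine_ext 4 {} (- {0}) ?S"
  have C: "(- {0 :: 'p mod_ring}) = {1} \<and> ?e = 1 \<or> (- {0 :: 'p mod_ring}) = - {0} \<and> ?e = ?e" by simp
  have aut: "linear_auto {1, 2, 3} s" if "s \<in> ?S" for s
    by (rule SL3s_linear_auto[OF _ that]) simp
  have id: "Var \<in> ?S" by (rule SL3s_id) simp
  \<comment> \<open>The identity is the extension of itself with scalar 1 and translation 0; its
    membership is required for the second extension.\<close>
  have "Var(4 := Var 4) = (Var :: nat \<Rightarrow> 'p mod_ring mpoly)" by auto
  then have idT: "Var \<in> ?T" using affine_extI[OF id, of 1 "- {0}" 0 "{}" 4] by (simp add: lforms_empty)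
  have autT: "linear_auto (insert 4 {1, 2, 3}) s" if "s \<in> ?T" for s
  proof -
    from that obtain s0 c where "s = s0(4 := Const c * Var 4)" "s0 \<in> ?S" "c \<noteq> 0"
      by (auto simp: affine_ext_def lforms_empty)
    then show ?thesis using linear_auto_ext[OF aut, of s0 4 c] by simp
  qed
  \<comment> \<open>Index 0 is kept for the generator from variable 4, which comes first in the
    list.\<close>
  define w :: "nat \<Rightarrow> nat" where "w = (\<lambda>_. 0)(1 := 2 * (1 + CARD('p) + CARD('p) ^ 2),
    2 := 2 * (CARD('p) ^ 3 - CARD('p) ^ 2), 3 := 2 * (CARD('p) ^ 3 - CARD('p)))"
  have "\<exists>g. freely_gen {1, 3, 2} w g (invars {1, 2, 3} ?S)"
    unfolding w_def by (rule exI, rule freely_gen_SL3) auto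
  then obtain g where g: "freely_gen {1, 3, 2} w g (invars {1, 2, 3} ?S)" by blast
  let ?w = "w(0 := ?e * (2 * CARD('p) ^ card ({} :: nat set)))" and ?g = "g(0 := orb 4 {} ^ ?e)"
  have "freely_gen (insert 0 {1, 3, 2}) ?w ?g (invars (insert 4 {1, 2, 3}) ?T)"
    by (rule freely_gen_ext[OF g]) (use linear_auto_polys[OF aut] id in \<open>auto simp: linear_auto_def\<close>)
  then have G5: "freely_gen (insert 4 (insert 0 {1, 3, 2})) (?w(4 := ?e * (2 * CARD('p) ^ card {1, 2, 3, 4 :: nat})))
      (?g(4 := orb 0 {1, 2, 3, 4} ^ ?e))
      (invars (insert 0 (insert 4 {1, 2, 3})) (affine_ext 0 {1, 2, 3, 4} (- {0}) ?T))"
  proof (rule freely_gen_ext)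
    show "Var \<in> ?T" by (rule idT)
    have Z: "insert 4 {1, 2, 3} = {1, 2, 3, 4 :: nat}" by auto
    show "linear_auto {1, 2, 3, 4} s" if "s \<in> ?T" for s
      using autT[OF that] by (simp only: Z)
    show "s i \<in> polys (insert 4 {1, 2, 3})" if "s \<in> ?T" "i \<in> insert 4 {1, 2, 3}" for s i
      using autT[OF that(1)] that(2) by (rule linear_auto_polys)
  qed auto
  have X: "insert 4 (insert 0 {1, 3, 2}) = {..<5 :: nat}" by auto
  show ?thesis
    by (rule exI, rule freely_gen_cong[OF G5[unfolded X]]) (auto simp: w_def less_Suc_eq numeral_eq_Suc)
qed

theorem freely_gen_SL3_list:
  "\<exists>g. freely_gen {..<3} ((!) [2 * (1 + CARD('p) + CARD('p) ^ 2), 2 * (CARD('p) ^ 3 - CARD('p) ^ 2),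
      2 * (CARD('p) ^ 3 - CARD('p))]) g (invars {0, 1, 2} (SL3s 0 1 2) :: 'p::prime_card mod_ring mpoly set)"
proof -
  have X: "{0, 2, 1} = {..<3 :: nat}" by auto
  show ?thesis
    by (rule exI, rule freely_gen_cong[OF freely_gen_SL3[of 0 1 2 0 1 2, unfolded X]])
       (auto simp: less_Suc_eq numeral_eq_Suc)
qed

theorem proposition3p2:
  assumes "CARD('p::prime_card) = 5" and "CARD('q::prime_card) = 3"
  shows
    "(\<forall>(G :: 'g monoid) A v. length v = 3 \<and>
        elab_with_weyl_group G A v (SL 3 :: 'p mod_ring mat set) \<longrightarrow>
        (GammaH_invariants G A v :: 'p mod_ring mpoly graded_alg) \<cong>\<^sub>g\<^sub>r poly_alg [62, 200, 240]) \<and>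
     (\<forall>(G :: 'g monoid) A v. length v = 3 \<and>
        elab_with_weyl_group G A v (SL 3 :: 'q mod_ring mat set) \<longrightarrow>
        (GammaH_invariants G A v :: 'q mod_ring mpoly graded_alg) \<cong>\<^sub>g\<^sub>r poly_alg [26, 36, 48]) \<and>
     (\<forall>(G :: 'g monoid) A v. length v = 4 \<and>
        elab_with_weyl_group G A v (weyl_3E6_4 :: 'q mod_ring mat set) \<longrightarrow>
        (GammaH_invariants G A v :: 'q mod_ring mpoly graded_alg) \<cong>\<^sub>g\<^sub>r poly_alg [26, 36, 48, 54]) \<and>
     (\<forall>(G :: 'g monoid) A v. length v = 4 \<and>
        elab_with_weyl_group G A v (weyl_2E7_4 :: 'q mod_ring mat set) \<longrightarrow>
        (GammaH_invariants G A v :: 'q mod_ring mpoly graded_alg) \<cong>\<^sub>g\<^sub>r poly_alg [26, 36, 48, 108]) \<and>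
     (\<forall>(G :: 'g monoid) A v. length v = 5 \<and>
        elab_with_weyl_group G A v (weyl_E8_5a :: 'q mod_ring mat set) \<longrightarrow>
        (GammaH_invariants G A v :: 'q mod_ring mpoly graded_alg) \<cong>\<^sub>g\<^sub>r poly_alg [4, 26, 36, 48, 324])"
proof (intro conjI allI impI; elim conjE)
  fix G :: "'g monoid" and A and v :: "'g list"
  {
    assume v: "length v = 3" and W: "elab_with_weyl_group G A v (SL 3 :: 'p mod_ring mat set)"
    \<comment> \<open>For p = 5: 62 = 2(1 + 5 + 25), 200 = 2(125 - 25), 240 = 2(125 - 5).\<close>
    obtain g where "freely_gen {..<3} ((!) [62, 200, 240]) g (invars {0, 1, 2} (SL3s 0 1 2) :: 'p mod_ring mpoly set)"
      using freely_gen_SL3_list[where 'p = 'p] assms(1) by auto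
    then show "(GammaH_invariants G A v :: 'p mod_ring mpoly graded_alg) \<cong>\<^sub>g\<^sub>r poly_alg [62, 200, 240]"
      by (intro GammaH_invariants_iso[OF W v invars_SL3]) auto
  next
    assume v: "length v = 3" and W: "elab_with_weyl_group G A v (SL 3 :: 'q mod_ring mat set)"
    \<comment> \<open>For p = 3: 26 = 2(1 + 3 + 9), 36 = 2(27 - 9), 48 = 2(27 - 3).\<close>
    obtain g where "freely_gen {..<3} ((!) [26, 36, 48]) g (invars {0, 1, 2} (SL3s 0 1 2) :: 'q mod_ring mpoly set)"
      using freely_gen_SL3_list[where 'p = 'q] assms(2) by auto
    then show "(GammaH_invariants G A v :: 'q mod_ring mpoly graded_alg) \<cong>\<^sub>g\<^sub>r poly_alg [26, 36, 48]"
      by (intro GammaH_invariants_iso[OF W v invars_SL3]) auto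
  next
    assume v: "length v = 4" and W: "elab_with_weyl_group G A v (weyl_3E6_4 :: 'q mod_ring mat set)"
    \<comment> \<open>The corner entry is 1, so the orbit product itself is invariant, of degree 54
      = 2 * 27.\<close>
    obtain g where g: "freely_gen {..<4} ((!) [26, 36, 48, 54]) g
      (invars (insert 0 {1, 2, 3}) (affine_ext 0 {1, 2, 3} {1} (SL3s 1 2 3)) :: 'q mod_ring mpoly set)"
      using freely_gen_block4[of "{1 :: 'q mod_ring}" 1] assms(2) by auto
    show "(GammaH_invariants G A v :: 'q mod_ring mpoly graded_alg) \<cong>\<^sub>g\<^sub>r poly_alg [26, 36, 48, 54]"
      by (rule GammaH_invariants_iso[OF W[unfolded weyl_3E6_4_eq] v invars_block4]) (use g in auto)
  next
    assume v: "length v = 4" and W: "elab_with_weyl_group G A v (weyl_2E7_4 :: 'q mod_ring mat set)"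
    \<comment> \<open>The corner entry may be -1, so the orbit product has to be squared: 108 = 2 *
      54.\<close>
    obtain g where g: "freely_gen {..<4} ((!) [26, 36, 48, 108]) g
      (invars (insert 0 {1, 2, 3}) (affine_ext 0 {1, 2, 3} (- {0}) (SL3s 1 2 3)) :: 'q mod_ring mpoly set)"
      using freely_gen_block4[of "- {0 :: 'q mod_ring}" 2] assms(2) by auto
    show "(GammaH_invariants G A v :: 'q mod_ring mpoly graded_alg) \<cong>\<^sub>g\<^sub>r poly_alg [26, 36, 48, 108]"
      by (rule GammaH_invariants_iso[OF W[unfolded weyl_2E7_4_eq] v invars_block4]) (use g in auto)
  next
    assume v: "length v = 5" and W: "elab_with_weyl_group G A v (weyl_E8_5a :: 'q mod_ring mat set)"
    \<comment> \<open>Here 4 is the degree of the square of one variable, and 324 = 2 * 2 * 81 that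
      of the square of a product of 81 linear forms.\<close>
    obtain g where g: "freely_gen {..<5} ((!) [4, 26, 36, 48, 324]) g
      (invars (insert 0 (insert 4 {1, 2, 3})) (affine_ext 0 {1, 2, 3, 4} (- {0}) (affine_ext 4 {} (- {0}) (SL3s 1 2 3)))
        :: 'q mod_ring mpoly set)"
      using freely_gen_block5[where 'p = 'q] assms(2) by auto
    show "(GammaH_invariants G A v :: 'q mod_ring mpoly graded_alg) \<cong>\<^sub>g\<^sub>r poly_alg [4, 26, 36, 48, 324]"
      by (rule GammaH_invariants_iso[OF W v invars_E8_5a]) (use g in auto)
  }
qed

end
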